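(* Let $G=(V,E)$ be a simple connected graph with $n=|V|$, and consider the algorithm Approx-3 described in the context. Then Approx-3 can be implemented to run in $O(|V||E|)$ time, and the tripartition $\{V_1,V_2,V_3\}$ it returns (with $|V_1|\le|V_2|\le|V_3|$) is feasible and satisfies $|V_3|\le \frac32\,\mathrm{OPT}$, where $\mathrm{OPT}$ is the optimum value of 3-BGP on $G$. Moreover, the ratio $\frac32$ is tight for the algorithm: there is a connected graph (e.g. the simple path on $12$ vertices, for which $\mathrm{OPT}=4$) on which an execution of Approx-3 terminates with a tripartition whose largest part has size $6=\frac32\,\mathrm{OPT}$.
   Context: For a simple connected graph $G=(V,E)$ and an integer $k\ge 2$, a feasible $k$-partition is a partition of $V$ into $k$ non-empty parts $V_1,\dots,V_k$ such that each induced subgraph $G[V_i]$ is connected; its size is $\max_i|V_i|$. The problem $k$-BGP asks for a feasible $k$-partition of minimum size; $\mathrm{OPT}$ denotes this minimum. Parts are always relabelled so that $|V_1|\le\dots\le|V_k|$. Two disjoint vertex sets $A,B$ are adjacent if some edge of $E$ joins a vertex of $A$ to a vertex of $B$. Operations on a feasible tripartition $\{V_1,V_2,V_3\}$ with $|V_1|\le|V_2|\le|V_3|$: - Merge$(V_1,V_2)$: applicable if $|V_3|>\frac12 n$ and $V_1,V_2$ are adjacent; it replaces the tripartition by $\{V_1\cup V_2,V_{31},V_{32}\}$, where $\{V_{31},V_{32}\}$ is an arbitrary feasible bipartition of $V_3$ (two non-empty parts each inducing a connected subgraph). - Pull$(U\subset V_3,V_i)$, $i\in\{1,2\}$: applicable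 if $|V_3|>\frac12 n$, $U$ is a non-empty proper subset of $V_3$ such that $G[U]$ and $G[V_3\setminus U]$ are connected, $U$ is adjacent to $V_i$, and $|V_i|+|U|<|V_3|$; it replaces the tripartition by $\{V_3\setminus U,V_i\cup U,V_{3-i}\}$. Algorithm Approx-3: compute an initial feasible tripartition (e.g. take a spanning tree of $G$ and delete two of its edges); while $|V_3|>\frac12 n$ and some Merge or Pull operation is applicable, apply one and relabel the parts by size; return the final tripartition. *)

theory Defs
  imports Complex_Main "HOL-Library.Disjoint_Sets"
begin

section \<open>Graphs and feasible partitions\<close>

definition simple_graph :: "'a set \<Rightarrow> 'a set set \<Rightarrow> bool" where
  "simple_graph V E \<longleftrightarrow> finite V \<and> E \<subseteq> {{u, v} |u v. u \<in> V \<and> v \<in> V \<and> u \<noteq> v}"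

definition connected_graph :: "'a set \<Rightarrow> 'a set set \<Rightarrow> bool" where
  "connected_graph V E \<longleftrightarrow>
     V \<noteq> {} \<and> (\<forall>u\<in>V. \<forall>v\<in>V. (u, v) \<in> {(x, y). {x, y} \<in> E}\<^sup>*)"

definition induced_edges :: "'a set set \<Rightarrow> 'a set \<Rightarrow> 'a set set" where
  "induced_edges E U = {e \<in> E. e \<subseteq> U}"

definition induces_connected :: "'a set set \<Rightarrow> 'a set \<Rightarrow> bool" where
  "induces_connected E U \<longleftrightarrow> connected_graph U (induced_edges E U)"

definition adjacent :: "'a set set \<Rightarrow> 'a set \<Rightarrow> 'a set \<Rightarrow> bool" where
  "adjacent E A B \<longleftrightarrow> (\<exists>a\<in>A. \<exists>b\<in>B. {a, b} \<in> E)"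

definition feasible_partition :: "nat \<Rightarrow> 'a set \<Rightarrow> 'a set set \<Rightarrow> 'a set set \<Rightarrow> bool" where
  "feasible_partition k V E P \<longleftrightarrow>
     partition_on V P \<and> card P = k \<and> (\<forall>U\<in>P. induces_connected E U)"

definition partition_size :: "'a set set \<Rightarrow> nat" where
  "partition_size P = Max (card ` P)"

text \<open>The minimum below ranges over a non-empty set whenever \<open>V\<close> is connected and
  \<open>1 \<le> k \<le> card V\<close>; otherwise its value is unspecified.\<close>

definition opt_bgp :: "nat \<Rightarrow> 'a set \<Rightarrow> 'a set set \<Rightarrow> nat" where
  "opt_bgp k V E = Min (partition_size ` {P. feasible_partition k V E P})"

section \<open>The local search algorithm\<close>

text \<open>Tripartitions are unordered. The operations refer to an arbitrary labelling of the parts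
  that is sorted by size, so ties may be broken either way, and relabelling after an operation
  needs no separate step.\<close>

definition sorted_tripartition ::
    "'a set \<Rightarrow> 'a set set \<Rightarrow> 'a set set \<Rightarrow> 'a set \<Rightarrow> 'a set \<Rightarrow> 'a set \<Rightarrow> bool" where
  "sorted_tripartition V E P V1 V2 V3 \<longleftrightarrow>
     P = {V1, V2, V3} \<and> feasible_partition 3 V E P \<and> card V1 \<le> card V2 \<and> card V2 \<le> card V3"

definition merge_step :: "'a set \<Rightarrow> 'a set set \<Rightarrow> 'a set set \<Rightarrow> 'a set set \<Rightarrow> bool" where
  "merge_step V E P Q \<longleftrightarrow>
     (\<exists>V1 V2 V3 V31 V32. sorted_tripartition V E P V1 V2 V3 \<and>
        real (card V3) > real (card V) / 2 \<and> adjacent E V1 V2 \<and>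
        feasible_partition 2 V3 (induced_edges E V3) {V31, V32} \<and>
        Q = {V1 \<union> V2, V31, V32})"

definition pull_step :: "'a set \<Rightarrow> 'a set set \<Rightarrow> 'a set set \<Rightarrow> 'a set set \<Rightarrow> bool" where
  "pull_step V E P Q \<longleftrightarrow>
     (\<exists>V1 V2 V3 U Vi Vj. sorted_tripartition V E P V1 V2 V3 \<and>
        (Vi = V1 \<and> Vj = V2 \<or> Vi = V2 \<and> Vj = V1) \<and>
        real (card V3) > real (card V) / 2 \<and>
        U \<noteq> {} \<and> U \<subset> V3 \<and> induces_connected E U \<and> induces_connected E (V3 - U) \<and>
        adjacent E U Vi \<and> card Vi + card U < card V3 \<and>
        Q = {V3 - U, Vi \<union> U, Vj})"

definition approx3_step :: "'a set \<Rightarrow> 'a set set \<Rightarrow> 'a set set \<Rightarrow> 'a set set \<Rightarrow> bool" where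
  "approx3_step V E P Q \<longleftrightarrow> merge_step V E P Q \<or> pull_step V E P Q"

text \<open>The loop guard (largest part bigger than \<open>card V / 2\<close>) is part of the applicability of
  both operations, so the loop ends exactly when no step is possible.\<close>

definition approx3_loop :: "'a set \<Rightarrow> 'a set set \<Rightarrow> 'a set set \<Rightarrow> 'a set set \<Rightarrow> bool" where
  "approx3_loop V E P Q \<longleftrightarrow> (approx3_step V E)\<^sup>*\<^sup>* P Q \<and> \<not> (\<exists>R. approx3_step V E Q R)"

definition approx3_output :: "'a set \<Rightarrow> 'a set set \<Rightarrow> 'a set set \<Rightarrow> bool" where
  "approx3_output V E Q \<longleftrightarrow> (\<exists>P. feasible_partition 3 V E P \<and> approx3_loop V E P Q)"

definition path_edges :: "nat \<Rightarrow> nat set set" where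
  "path_edges n = {{i, Suc i} |i. Suc i < n}"

section \<open>A machine model with running time\<close>

text \<open>Programs of a RAM with scalar registers and arrays of natural numbers; the only arithmetic
  is addition and truncated subtraction. Every command and every test costs one unit: a fixed
  program contains expressions of bounded size only, so charging for each operation would change
  the running time by at most a constant factor.\<close>

datatype aexp =
    Lit nat
  | Var string
  | Read string aexp
  | Add aexp aexp
  | Sub aexp aexp

datatype bexp =
    Less aexp aexp
  | Not bexp
  | And bexp bexp

datatype com =
    Skip
  | Assign string aexp
  | Store string aexp aexp
  | Seq com com
  | Cond bexp com com
  | While bexp com

record state =
  scal :: "string \<Rightarrow> nat"
  arr :: "string \<Rightarrow> nat \<Rightarrow> nat"

primrec aval :: "aexp \<Rightarrow> state \<Rightarrow> nat" where
  "aval (Lit k) s = k"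
| "aval (Var x) s = scal s x"
| "aval (Read a i) s = arr s a (aval i s)"
| "aval (Add e1 e2) s = aval e1 s + aval e2 s"
| "aval (Sub e1 e2) s = aval e1 s - aval e2 s"

primrec bval :: "bexp \<Rightarrow> state \<Rightarrow> bool" where
  "bval (Less e1 e2) s \<longleftrightarrow> aval e1 s < aval e2 s"
| "bval (Not b) s \<longleftrightarrow> \<not> bval b s"
| "bval (And b1 b2) s \<longleftrightarrow> bval b1 s \<and> bval b2 s"

text \<open>\<open>exec W c s t s'\<close>: started in \<open>s\<close>, the command \<open>c\<close> stops in \<open>s'\<close> after \<open>t\<close> units of time.
  The machine gets stuck on an attempt to store a value, or to write to an address, larger than
  \<open>W\<close>; with \<open>W\<close> linear in the size of the input this is the usual restriction to words of
  logarithmic length.\<close>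

inductive exec :: "nat \<Rightarrow> com \<Rightarrow> state \<Rightarrow> nat \<Rightarrow> state \<Rightarrow> bool" for W where
  Skip: "exec W Skip s 1 s"
| Assign: "aval e s \<le> W \<Longrightarrow>
    exec W (Assign x e) s 1 (s\<lparr>scal := (scal s)(x := aval e s)\<rparr>)"
| Store: "aval i s \<le> W \<Longrightarrow> aval e s \<le> W \<Longrightarrow>
    exec W (Store a i e) s 1 (s\<lparr>arr := (arr s)(a := (arr s a)(aval i s := aval e s))\<rparr>)"
| Seq: "exec W c1 s1 t1 s2 \<Longrightarrow> exec W c2 s2 t2 s3 \<Longrightarrow> exec W (Seq c1 c2) s1 (t1 + t2) s3"
| CondTrue: "bval b s \<Longrightarrow> exec W c1 s t s' \<Longrightarrow> exec W (Cond b c1 c2) s (1 + t) s'"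
| CondFalse: "\<not> bval b s \<Longrightarrow> exec W c2 s t s' \<Longrightarrow> exec W (Cond b c1 c2) s (1 + t) s'"
| WhileFalse: "\<not> bval b s \<Longrightarrow> exec W (While b c) s 1 s"
| WhileTrue: "bval b s1 \<Longrightarrow> exec W c s1 t1 s2 \<Longrightarrow> exec W (While b c) s2 t2 s3 \<Longrightarrow>
    exec W (While b c) s1 (1 + t1 + t2) s3"

definition runs_within :: "nat \<Rightarrow> nat \<Rightarrow> com \<Rightarrow> state \<Rightarrow> state \<Rightarrow> bool" where
  "runs_within W T c s s' \<longleftrightarrow> (\<exists>t\<le>T. exec W c s t s')"

text \<open>Input: a graph on \<open>{..<n}\<close> given by adjacency lists; the neighbours of \<open>v\<close> are stored
  without repetition, in any order, in the cells \<open>off v, \<dots>, off (v + 1) - 1\<close> of the array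
  \<open>nbr\<close>. All other registers and cells have arbitrary contents.\<close>

definition stores_graph :: "nat \<Rightarrow> nat set set \<Rightarrow> state \<Rightarrow> bool" where
  "stores_graph n E s \<longleftrightarrow>
     scal s ''n'' = n \<and> arr s ''off'' 0 = 0 \<and>
     (\<forall>v<n. arr s ''off'' v \<le> arr s ''off'' (Suc v) \<and>
        bij_betw (arr s ''nbr'') {arr s ''off'' v ..< arr s ''off'' (Suc v)} {u. {v, u} \<in> E})"

text \<open>A tripartition is stored as an array mapping each vertex to the number of its part.\<close>

definition stored_parts :: "nat \<Rightarrow> state \<Rightarrow> nat set set" where
  "stored_parts n s = (\<lambda>i. {v. v < n \<and> arr s ''part'' v = i}) ` {1, 2, 3}"

text \<open>The program is \<open>Seq init loop\<close>: \<open>init\<close> computes some feasible tripartition and \<open>loop\<close>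
  carries out the local search. The two phases are specified separately, and \<open>loop\<close> for every
  feasible tripartition it may be started with, because the initial tripartition of the algorithm
  is arbitrary: a specification of the final result alone would also be met by a program that finds
  a terminal tripartition by different means and uses it as the initial one.\<close>

definition implements_approx3 ::
    "com \<Rightarrow> com \<Rightarrow> nat \<Rightarrow> nat \<Rightarrow> nat \<Rightarrow> nat set set \<Rightarrow> bool" where
  "implements_approx3 init loop W T n E \<longleftrightarrow>
     (\<forall>s. stores_graph n E s \<longrightarrow>
        (\<exists>s'. runs_within W T init s s' \<and> stores_graph n E s' \<and>
           feasible_partition 3 {..<n} E (stored_parts n s'))) \<and>
     (\<forall>s. stores_graph n E s \<and> feasible_partition 3 {..<n} E (stored_parts n s) \<longrightarrow>
        (\<exists>s'. runs_within W T loop s s' \<and>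
           approx3_loop {..<n} E (stored_parts n s) (stored_parts n s'))) \<and>
     (\<forall>s. stores_graph n E s \<longrightarrow>
        (\<exists>s'. runs_within W T (Seq init loop) s s' \<and>
           approx3_output {..<n} E (stored_parts n s')))"

end

theory Submission
  imports Defs
begin

text \<open>Let \<open>|V\<^sub>3| > n/2\<close> and let \<open>v \<in> V\<^sub>3\<close> be a neighbour of \<open>V\<^sub>i\<close>. The best set to pull through \<open>v\<close>
  is all of \<open>V\<^sub>3\<close> but the largest component \<open>D\<close> of \<open>V\<^sub>3 - v\<close>, and this is possible iff \<open>|D| > |V\<^sub>i|\<close>.
  Two vertices of \<open>V\<^sub>3\<close> cannot both leave small components only: if those of \<open>V\<^sub>3 - v\<close> have at most
  \<open>|V\<^sub>1|\<close> vertices, then for \<open>x \<noteq> v\<close> the component of \<open>v\<close> in \<open>V\<^sub>3 - x\<close> has at least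
  \<open>|V\<^sub>3| - |V\<^sub>1| > |V\<^sub>2|\<close>. So if no operation is applicable, all contacts of \<open>V\<^sub>3\<close> go through a single
  \<open>v\<close>, and the components of \<open>G - v\<close> are \<open>V\<^sub>1\<close>, \<open>V\<^sub>2\<close> and sets of at most \<open>|V\<^sub>1|\<close> vertices. The two
  parts of any tripartition that avoid \<open>v\<close> then have at most \<open>|V\<^sub>1| + |V\<^sub>2|\<close> vertices, so \<open>|V\<^sub>3|\<close> is
  optimal; and \<open>|V\<^sub>3| \<le> n/2 \<le> 3/2 OPT\<close> otherwise. Each step shrinks the largest part, and by the
  same observation a constant number of graph scans finds a step or shows that there is none.\<close>

section \<open>Connected vertex sets\<close>

text \<open>A Pull that moves v leaves behind a connected set missing v, hence part of one component
  of V_3 - v. Leaving all of D therefore moves as little as possible, and the size condition becomes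
  |V_i| < |D|. The obstacle to O(|V||E|) is the number of candidate cut vertices: measuring the
  components left by a single vertex already takes a scan of the largest part, and it may have many
  contact vertices. So components are measured for one contact v only. It is taken at the smallest
  part: failure then bounds every piece by |V_1|, and any second contact vertex x works without its
  components being measured, because keeping the side of v leaves more than |V_2| vertices, enough
  whichever small part x touches. The guard |V_3| > n/2 enters the proof as |V_3| > |V_1| + |V_2|.
  It makes the labelling unique up to exchanging the two small parts, and makes every step shrink
  the largest part. One fact about connectivity carries all constructions: a connected set minus one
  component of its remainder after deleting v is still connected, held together by v. Merge, Pull
  and the initial tripartition all cut in this way.\<close>

definition component :: "'a set set \<Rightarrow> 'a set \<Rightarrow> 'a \<Rightarrow> 'a set" where
  "component E A r = {x. (r, x) \<in> {(x, y). {x, y} \<in> induced_edges E A}\<^sup>*}"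

text \<open>Closed sets stand in for walks: a component is the least closed set containing its root,
  so connectivity is proved and used by exhibiting closed sets. \<open>S\<close> need not lie in
  \<open>A\<close>, so a set closed in a graph stays closed relative to every smaller vertex
  set.\<close>

definition closed_in :: "'a set set \<Rightarrow> 'a set \<Rightarrow> 'a set \<Rightarrow> bool" where
  "closed_in E A S \<longleftrightarrow> (\<forall>x\<in>S. \<forall>y\<in>A. {x, y} \<in> E \<longrightarrow> y \<in> S)"

lemma closed_inD: "closed_in E A S \<Longrightarrow> x \<in> S \<Longrightarrow> y \<in> A \<Longrightarrow> {x, y} \<in> E \<Longrightarrow> y \<in> S"
  by (auto simp: closed_in_def)

lemma closed_in_Diff:
  assumes "closed_in E A S"
  shows "closed_in E A (A - S)"
  using assms unfolding closed_in_def by (metis DiffD1 DiffD2 DiffI insert_commute)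

lemma component_refl [simp]: "r \<in> component E A r"
  by (simp add: component_def)

lemma component_subset:
  assumes "r \<in> A"
  shows "component E A r \<subseteq> A"
proof
  fix x assume "x \<in> component E A r"
  then have "(r, x) \<in> {(x, y). {x, y} \<in> induced_edges E A}\<^sup>*" by (simp add: component_def)
  then show "x \<in> A" using assms
    by (induction rule: rtrancl_induct) (auto simp: induced_edges_def)
qed

lemma closed_in_component:
  assumes "r \<in> A"
  shows "closed_in E A (component E A r)"
  unfolding closed_in_def
proof (intro ballI impI)
  fix x y assume x: "x \<in> component E A r" and y: "y \<in> A" "{x, y} \<in> E"
  have "x \<in> A" using component_subset[OF assms] x by blast
  then have "(x, y) \<in> {(x, y). {x, y} \<in> induced_edges E A}" using y by (simp add: induced_edges_def)
  then show "y \<in> component E A r" using x unfolding component_def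
    by (simp add: rtrancl_into_rtrancl)
qed

lemma component_least:
  assumes "r \<in> S" "closed_in E A S"
  shows "component E A r \<subseteq> S"
proof
  fix x assume "x \<in> component E A r"
  then have "(r, x) \<in> {(x, y). {x, y} \<in> induced_edges E A}\<^sup>*" by (simp add: component_def)
  then show "x \<in> S" using assms(1)
    by (induction rule: rtrancl_induct) (auto simp: induced_edges_def dest: closed_inD[OF assms(2)])
qed

lemma induces_connected_iff:
  "induces_connected E U \<longleftrightarrow> U \<noteq> {} \<and> (\<forall>r\<in>U. U \<subseteq> component E U r)"
  unfolding induces_connected_def connected_graph_def component_def by blast

lemma induces_connectedD:
  assumes "induces_connected E U" "closed_in E U S" "r \<in> S" "r \<in> U"
  shows "U \<subseteq> S"
proof -
  have "U \<subseteq> component E U r" using assms(1,4) by (auto simp: induces_connected_iff)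
  then show ?thesis using component_least[OF assms(3,2)] by blast
qed

text \<open>One root is enough because edges are undirected. If \<open>r\<close> were outside the
  component of some \<open>u\<close>, the complement of that component would be closed and contain
  \<open>r\<close>, hence contain everything, \<open>u\<close> included.\<close>

lemma induces_connectedI:
  assumes "r \<in> U" "\<And>S. r \<in> S \<Longrightarrow> S \<subseteq> U \<Longrightarrow> closed_in E U S \<Longrightarrow> U \<subseteq> S"
  shows "induces_connected E U"
  unfolding induces_connected_iff
proof (intro conjI ballI)
  fix u assume u: "u \<in> U"
  have "r \<in> component E U u"
  proof (rule ccontr)
    assume "r \<notin> component E U u"
    then have "U \<subseteq> U - component E U u"
      using assms(2)[OF _ Diff_subset closed_in_Diff[OF closed_in_component[OF u]]] assms(1) by blast
    then show False using u component_refl[of u E U] by blast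
  qed
  then show "U \<subseteq> component E U u"
    using assms(2)[OF _ component_subset[OF u] closed_in_component[OF u]] by blast
qed (use assms(1) in auto)

lemma induces_connected_component:
  assumes "r \<in> A"
  shows "induces_connected E (component E A r)"
proof (rule induces_connectedI[OF component_refl])
  fix S assume S: "r \<in> S" "S \<subseteq> component E A r" "closed_in E (component E A r) S"
  then have "closed_in E A S"
    using closed_in_component[OF assms] unfolding closed_in_def by blast
  then show "component E A r \<subseteq> S" by (rule component_least[OF S(1)])
qed

lemma induces_connected_subset_component:
  assumes "induces_connected E U" "r \<in> U" "U \<subseteq> A"
  shows "U \<subseteq> component E A r"
proof -
  have "closed_in E U (component E A r)"
    using closed_in_component[of r A E] assms unfolding closed_in_def by blast
  then show ?thesis using induces_connectedD[OF assms(1) _ component_refl assms(2)] by blast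
qed

text \<open>No edge leaves a closed \<open>R\<close> within \<open>A\<close>, so searching inside
  \<open>R\<close> sees the same component. The search for a large piece relies on this: after some
  components have been erased, the marked rest is such an \<open>R\<close>.\<close>

lemma component_closed_eq:
  assumes "closed_in E A R" "R \<subseteq> A" "r \<in> R"
  shows "component E R r = component E A r"
proof
  have "closed_in E A (component E R r)"
    using assms closed_in_component[OF assms(3)] component_subset[OF assms(3)]
    unfolding closed_in_def by blast
  then show "component E A r \<subseteq> component E R r" by (rule component_least[OF component_refl])
  have "component E A r \<subseteq> R" using component_least[OF assms(3,1)] .
  then have "closed_in E R (component E A r)"
    using assms closed_in_component[of r A E] unfolding closed_in_def by blast
  then show "component E R r \<subseteq> component E A r" by (rule component_least[OF component_refl])
qed

lemma induces_connected_Un: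
  assumes "induces_connected E A" "induces_connected E B" "adjacent E A B"
  shows "induces_connected E (A \<union> B)"
proof -
  obtain a b where ab: "a \<in> A" "b \<in> B" "{a, b} \<in> E" using assms by (auto simp: adjacent_def)
  show ?thesis
  proof (rule induces_connectedI[of a])
    fix S assume S: "a \<in> S" "closed_in E (A \<union> B) S"
    then have "b \<in> S" using closed_inD[OF S(2,1) _ ab(3)] ab(2) by blast
    moreover have "closed_in E A S" "closed_in E B S" using S(2) by (auto simp: closed_in_def)
    ultimately show "A \<union> B \<subseteq> S"
      using induces_connectedD[OF assms(1) _ S(1) ab(1)] induces_connectedD[OF assms(2) _ _ ab(2), of S]
      by blast
  qed (use ab in auto)
qed

text \<open>Every component of \<open>V - {v}\<close> is attached to \<open>v\<close>, since
  \<open>V\<close> is connected. Removing one of them leaves the others joined through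
  \<open>v\<close>.\<close>

lemma induces_connected_Diff_component:
  assumes "induces_connected E V" "v \<in> V" "s \<in> V" "s \<noteq> v"
  shows "induces_connected E (V - component E (V - {v}) s)"
proof -
  let ?C = "component E (V - {v}) s"
  have s: "s \<in> V - {v}" using assms by auto
  have C: "?C \<subseteq> V - {v}" by (rule component_subset[OF s])
  show ?thesis
  proof (rule induces_connectedI[of v])
    fix S assume S: "v \<in> S" "S \<subseteq> V - ?C" "closed_in E (V - ?C) S"
    \<comment> \<open>The removed component can be left only through \<open>v\<close>, and
      \<open>v\<close> lies in \<open>S\<close>.\<close>
    have "closed_in E V (S \<union> ?C)"
      using S closed_in_component[OF s, of E] unfolding closed_in_def by blast
    then have "V \<subseteq> S \<union> ?C"
      by (rule induces_connectedD[OF assms(1)]) (use S(1) assms(2) in auto)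
    then show "V - ?C \<subseteq> S" by blast
  qed (use assms C in auto)
qed

lemma adjacent_commute: "adjacent E A B \<longleftrightarrow> adjacent E B A"
  unfolding adjacent_def by (metis insert_commute)

lemma induced_edges_induced: "U \<subseteq> V \<Longrightarrow> induced_edges (induced_edges E V) U = induced_edges E U"
  by (auto simp: induced_edges_def)

lemma simple_graph_finite_edges:
  assumes "simple_graph V E"
  shows "finite E"
proof -
  have "E \<subseteq> Pow V" using assms unfolding simple_graph_def by blast
  then show ?thesis using assms finite_subset unfolding simple_graph_def by blast
qed

lemma induces_connected_whole:
  assumes "simple_graph V E"
  shows "induces_connected E V \<longleftrightarrow> connected_graph V E"
proof -
  have "induced_edges E V = E" using assms by (auto simp: simple_graph_def induced_edges_def)
  then show ?thesis by (simp add: induces_connected_def)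
qed

text \<open>A nonempty proper subset without an edge to the rest would be closed, against
  connectedness.\<close>

lemma not_adjacent_outside:
  assumes "induces_connected E V" "A \<subset> V" "A \<noteq> {}"
  shows "adjacent E A (V - A)"
proof (rule ccontr)
  assume "\<not> ?thesis"
  then have "closed_in E V A" by (auto simp: closed_in_def adjacent_def)
  moreover obtain a where "a \<in> A" using assms(3) by blast
  ultimately have "V \<subseteq> A" using induces_connectedD[OF assms(1), of A a] assms(2) by blast
  then show False using assms by blast
qed

section \<open>Tripartitions\<close>

lemma feasible_partition_2:
  assumes "U \<subset> V" "U \<noteq> {}" "induces_connected E U" "induces_connected E (V - U)"
  shows "feasible_partition 2 V (induced_edges E V) {U, V - U}"
proof -
  have "partition_on V {U, V - U}"
    using assms by (auto simp: partition_on_def disjoint_def)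
  moreover have "U \<noteq> V - U" using assms by auto
  ultimately show ?thesis
    using assms by (auto simp: feasible_partition_def induces_connected_def induced_edges_induced)
qed

text \<open>The cardinality 3 makes the three named parts distinct, and distinct members of a
  partition are disjoint. Conversely connected parts are nonempty, so disjoint ones are
  distinct.\<close>

lemma feasible_partition_3:
  "feasible_partition 3 V E {A, B, C} \<longleftrightarrow>
     A \<union> B \<union> C = V \<and> A \<inter> B = {} \<and> A \<inter> C = {} \<and> B \<inter> C = {} \<and>
     induces_connected E A \<and> induces_connected E B \<and> induces_connected E C" (is "?L \<longleftrightarrow> ?R")
proof
  assume L: ?L
  have c: "card {A, B, C} = 3" using L by (simp add: feasible_partition_def)
  have "A \<noteq> B" "A \<noteq> C" "B \<noteq> C"
  proof -
    show "A \<noteq> B" using c by (auto simp: card_insert_if split: if_splits)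
    show "A \<noteq> C" using c by (auto simp: card_insert_if split: if_splits)
    show "B \<noteq> C" using c by (auto simp: card_insert_if split: if_splits)
  qed
  then show ?R using L
    by (auto simp: feasible_partition_def partition_on_def disjoint_def)
next
  assume R: ?R
  then have "A \<noteq> {}" "B \<noteq> {}" "C \<noteq> {}" by (auto simp: induces_connected_iff)
  moreover then have "A \<noteq> B" "A \<noteq> C" "B \<noteq> C" using R by blast+
  ultimately show ?L using R
    by (auto simp: feasible_partition_def partition_on_def disjoint_def)
qed

lemma feasible_partition_3E:
  assumes "feasible_partition 3 V E P"
  obtains A B C where "P = {A, B, C}"
  using assms unfolding feasible_partition_def card_3_iff by blast

lemma sorted_tripartition_exists:
  assumes "feasible_partition 3 V E P"
  obtains A B C where "sorted_tripartition V E P A B C"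
proof -
  obtain X Y Z where P: "P = {X, Y, Z}" using feasible_partition_3E[OF assms] .
  have perm: "P = {X, Z, Y}" "P = {Y, X, Z}" "P = {Y, Z, X}" "P = {Z, X, Y}" "P = {Z, Y, X}"
    using P by auto
  have *: thesis if "P = {A, B, C}" "card A \<le> card B" "card B \<le> card C" for A B C
    using \<open>\<And>A B C. sorted_tripartition V E P A B C \<Longrightarrow> thesis\<close>[of A B C] assms that
    unfolding sorted_tripartition_def by blast
  show thesis
    using *[OF P] *[OF perm(1)] *[OF perm(2)] *[OF perm(3)] *[OF perm(4)] *[OF perm(5)] by linarith
qed

lemma sorted_tripartitionD:
  assumes "sorted_tripartition V E P A B C" "finite V"
  shows "P = {A, B, C}" "A \<union> B \<union> C = V" "A \<inter> B = {}" "A \<inter> C = {}" "B \<inter> C = {}"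
    "induces_connected E A" "induces_connected E B" "induces_connected E C"
    "card A \<le> card B" "card B \<le> card C" "finite A" "finite B" "finite C"
    "card V = card A + card B + card C" "0 < card A" "0 < card B" "0 < card C"
    "A \<noteq> B" "A \<noteq> C" "B \<noteq> C"
proof -
  show P: "P = {A, B, C}" "card A \<le> card B" "card B \<le> card C"
    using assms by (auto simp: sorted_tripartition_def)
  have f: "feasible_partition 3 V E {A, B, C}"
    using assms by (auto simp: sorted_tripartition_def)
  show u: "A \<union> B \<union> C = V" "A \<inter> B = {}" "A \<inter> C = {}" "B \<inter> C = {}"
    and c: "induces_connected E A" "induces_connected E B" "induces_connected E C"
    using f unfolding feasible_partition_3 by auto
  show fin: "finite A" "finite B" "finite C" using u assms(2) by auto
  have "card V = card (A \<union> B) + card C" unfolding u(1)[symmetric]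
    using fin u by (intro card_Un_disjoint) auto
  also have "card (A \<union> B) = card A + card B" using fin u by (intro card_Un_disjoint) auto
  finally show "card V = card A + card B + card C" .
  show "0 < card A" "0 < card B" "0 < card C"
    using c fin by (auto simp: induces_connected_iff card_gt_0_iff)
  have "A \<noteq> {}" "B \<noteq> {}" using c by (auto simp: induces_connected_iff)
  then show "A \<noteq> B" "A \<noteq> C" "B \<noteq> C" using u(2-4) by blast+
qed

lemma partition_size_3: "partition_size {A, B, C} = max (card A) (max (card B) (card C))"
  by (simp add: partition_size_def)

lemma partition_size_sorted:
  "sorted_tripartition V E P A B C \<Longrightarrow> partition_size P = card C"
  by (auto simp: sorted_tripartition_def partition_size_3)

text \<open>Each operation chooses its own sorted labelling. Once the largest part exceeds half of
  the vertices, only a tie between the two small parts leaves a choice, so statements about one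
  labelling carry over to all.\<close>

lemma sorted_tripartition_unique:
  assumes "sorted_tripartition V E P A B C" "sorted_tripartition V E P A' B' C'"
    "finite V" "card V < 2 * card C"
  shows "C' = C" "A' = A \<and> B' = B \<or> A' = B \<and> B' = A"
proof -
  note 1 = sorted_tripartitionD[OF assms(1,3)] and 2 = sorted_tripartitionD[OF assms(2,3)]
  have eq: "{A', B', C'} = {A, B, C}" using 1(1) 2(1) by simp
  have "card C' = card C" using assms partition_size_sorted by metis
  moreover have "card A < card C" "card B < card C" using 1(14-17) assms(4) by linarith+
  moreover have "C' \<in> {A, B, C}" unfolding eq[symmetric] by simp
  ultimately show C: "C' = C" by auto
  have "A' \<in> {A, B, C}" "B' \<in> {A, B, C}" unfolding eq[symmetric] by simp_all
  then show "A' = A \<and> B' = B \<or> A' = B \<and> B' = A" using 2(18-20) C by auto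
qed

lemma merge_stepI:
  assumes "sorted_tripartition V E P A B C" "card V < 2 * card C" "adjacent E A B"
    "feasible_partition 2 C (induced_edges E C) {D, F}"
  shows "merge_step V E P {A \<union> B, D, F}"
proof -
  have "real (card C) > real (card V) / 2" using assms(2) by simp
  then show ?thesis unfolding merge_step_def using assms(1,3,4) by blast
qed

lemma pull_stepI:
  assumes "sorted_tripartition V E P A B C" "card V < 2 * card C"
    "X = A \<and> Y = B \<or> X = B \<and> Y = A" "U \<noteq> {}" "U \<subset> C"
    "induces_connected E U" "induces_connected E (C - U)" "adjacent E U X"
    "card X + card U < card C"
  shows "pull_step V E P {C - U, X \<union> U, Y}"
proof -
  have "real (card C) > real (card V) / 2" using assms(2) by simp
  then show ?thesis unfolding pull_step_def using assms(1,3-9) by blast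
qed

text \<open>A Merge may use any feasible bipartition of the largest part. Cutting off one component
  of \<open>C - {v}\<close> is one, so any two distinct vertices of \<open>C\<close> serve as
  \<open>v\<close> and \<open>s\<close>.\<close>

lemma merge_step_component:
  assumes "sorted_tripartition V E P A B C" "finite V" "card V < 2 * card C"
    "adjacent E A B" "v \<in> C" "s \<in> C" "s \<noteq> v" and D: "D = component E (C - {v}) s"
  shows "merge_step V E P {A \<union> B, D, C - D}"
proof -
  note 1 = sorted_tripartitionD[OF assms(1,2)]
  have s: "s \<in> C - {v}" using assms by auto
  have "D \<subset> C" using component_subset[OF s, of E] D assms(5) by blast
  moreover have "s \<in> D" by (simp add: D)
  moreover have "induces_connected E D" "induces_connected E (C - D)"
    using induces_connected_component[OF s, of E]
      induces_connected_Diff_component[OF 1(8) assms(5,6,7)] D by simp_all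
  ultimately have "feasible_partition 2 C (induced_edges E C) {D, C - D}"
    by (intro feasible_partition_2) auto
  then show ?thesis by (rule merge_stepI[OF assms(1,3,4)])
qed

text \<open>The set pulled is \<open>C - D\<close>. It contains \<open>v\<close> and therefore
  touches \<open>X\<close>, and its size condition, |X| + |C - D| < |C|, is the last hypothesis
  rewritten.\<close>

lemma pull_step_component:
  assumes "sorted_tripartition V E P A B C" "finite V" "card V < 2 * card C"
    "X = A \<and> Y = B \<or> X = B \<and> Y = A" "v \<in> C" "w \<in> X" "{v, w} \<in> E"
    "s \<in> C" "s \<noteq> v" and D: "D = component E (C - {v}) s" and "card X < card D"
  shows "pull_step V E P {D, X \<union> (C - D), Y}"
proof -
  note 1 = sorted_tripartitionD[OF assms(1,2)]
  have s: "s \<in> C - {v}" using assms by auto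
  have DC: "D \<subset> C" using component_subset[OF s, of E] D assms(5) by blast
  then have "C - (C - D) = D" by blast
  have cards: "card (C - D) = card C - card D" "card D \<le> card C"
    using DC 1(13) by (auto intro!: card_Diff_subset card_mono intro: finite_subset)
  have "v \<in> C - D" using assms(5) component_subset[OF s, of E] D by blast
  then have adj: "adjacent E (C - D) X" using assms(6,7) by (auto simp: adjacent_def)
  have con: "induces_connected E (C - D)" "induces_connected E (C - (C - D))"
    unfolding \<open>C - (C - D) = D\<close> using induces_connected_component[OF s, of E]
      induces_connected_Diff_component[OF 1(8) assms(5,8,9)] D by simp_all
  have "s \<in> D" by (simp add: D)
  then have "pull_step V E P {C - (C - D), X \<union> (C - D), Y}"
    using DC cards assms(8,11) \<open>v \<in> C - D\<close>
    by (intro pull_stepI[OF assms(1,3,4) _ _ con adj]) auto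
  then show ?thesis by (simp only: \<open>C - (C - D) = D\<close>)
qed

text \<open>In a Merge, the guard gives |A| + |B| < |C|, and both halves of \<open>C\<close> are
  proper subsets. In a Pull, the two changed parts are smaller by the conditions on
  \<open>U\<close>, and the untouched one by the guard. The decrease gives termination and also the
  linear number of steps in the running time.\<close>

lemma approx3_step_decreasing:
  assumes "approx3_step V E P Q" "finite V"
  shows "feasible_partition 3 V E Q \<and> partition_size Q < partition_size P"
  using assms(1) unfolding approx3_step_def
proof
  assume "merge_step V E P Q"
  then obtain A B C D F where s: "sorted_tripartition V E P A B C"
    and big: "real (card C) > real (card V) / 2" and adj: "adjacent E A B"
    and bip: "feasible_partition 2 C (induced_edges E C) {D, F}" and Q: "Q = {A \<union> B, D, F}"
    unfolding merge_step_def by blast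
  note 1 = sorted_tripartitionD[OF s assms(2)]
  have part: "partition_on C {D, F}" "D \<noteq> F"
    using bip by (auto simp: feasible_partition_def)
  then have DF: "D \<union> F = C" "D \<inter> F = {}" "D \<noteq> {}" "F \<noteq> {}"
    by (auto simp: partition_on_def disjoint_def)
  then have "D \<subseteq> C" "F \<subseteq> C" by auto
  then have "induces_connected E D" "induces_connected E F"
    using bip by (auto simp: feasible_partition_def induces_connected_def induced_edges_induced)
  moreover have "induces_connected E (A \<union> B)" by (rule induces_connected_Un[OF 1(6,7) adj])
  ultimately have "feasible_partition 3 V E Q" unfolding Q feasible_partition_3
    using 1(2-5) DF by blast
  moreover have "card D < card C" "card F < card C"
    using DF 1(13) by (auto intro!: psubset_card_mono)
  moreover have "card (A \<union> B) < card C"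
    using 1(14,17) big card_Un_disjoint[OF 1(11,12,3)] by linarith
  ultimately show ?thesis by (simp add: partition_size_sorted[OF s] Q partition_size_3)
next
  assume "pull_step V E P Q"
  then obtain A B C U X Y where s: "sorted_tripartition V E P A B C"
    and XY: "X = A \<and> Y = B \<or> X = B \<and> Y = A"
    and big: "real (card C) > real (card V) / 2"
    and U: "U \<noteq> {}" "U \<subset> C" "induces_connected E U" "induces_connected E (C - U)"
      "adjacent E U X" "card X + card U < card C"
    and Q: "Q = {C - U, X \<union> U, Y}"
    unfolding pull_step_def by blast
  note 1 = sorted_tripartitionD[OF s assms(2)]
  have "induces_connected E (X \<union> U)"
  proof (rule induces_connected_Un[OF _ U(3)])
    show "induces_connected E X" using 1(6,7) XY by auto
    show "adjacent E X U" using U(5) adjacent_commute[of E X U] by blast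
  qed
  then have "feasible_partition 3 V E Q" unfolding Q feasible_partition_3
    using 1(2-7) U XY by blast
  moreover have "card (C - U) < card C" using U 1(13) by (intro psubset_card_mono) auto
  moreover have "card (X \<union> U) < card C" using card_Un_le[of X U] U by linarith
  moreover have "card Y < card C" using 1(14-17) XY big by auto
  ultimately show ?thesis by (simp add: partition_size_sorted[OF s] Q partition_size_3)
qed

lemma approx3_steps_feasible:
  assumes "(approx3_step V E)\<^sup>*\<^sup>* P Q" "feasible_partition 3 V E P" "finite V"
  shows "feasible_partition 3 V E Q"
  using assms by (induction rule: rtranclp_induct) (auto dest: approx3_step_decreasing)

lemma approx3_terminates:
  assumes "finite V"
  shows "\<not> (\<exists>P. \<forall>i :: nat. approx3_step V E (P i) (P (Suc i)))"
proof
  assume "\<exists>P. \<forall>i :: nat. approx3_step V E (P i) (P (Suc i))"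
  then obtain P where "\<forall>i :: nat. approx3_step V E (P i) (P (Suc i))" ..
  then have "\<forall>i. (P (Suc i), P i) \<in> measure partition_size"
    using approx3_step_decreasing[OF _ assms] by auto
  then show False using wf_iff_no_infinite_down_chain wf_measure by metis
qed

lemma approx3_loop_exists:
  assumes "finite V"
  shows "\<exists>Q. approx3_loop V E P Q"
proof (induction "partition_size P" arbitrary: P rule: less_induct)
  case less
  show ?case
  proof (cases "\<exists>R. approx3_step V E P R")
    case True
    then obtain R where R: "approx3_step V E P R" ..
    then obtain Q where "approx3_loop V E R Q"
      using less approx3_step_decreasing[OF R assms] by blast
    then show ?thesis using R unfolding approx3_loop_def
      by (meson converse_rtranclp_into_rtranclp)
  qed (auto simp: approx3_loop_def)
qed

section \<open>Existence of feasible partitions\<close>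

lemma two_elements:
  assumes "2 \<le> card X"
  obtains v s where "v \<in> X" "s \<in> X" "s \<noteq> v"
proof -
  obtain v where v: "v \<in> X" using assms by fastforce
  have "X - {v} \<noteq> {}"
  proof
    assume "X - {v} = {}"
    then have "X = {v}" using v by blast
    then show False using assms by simp
  qed
  then show thesis using that v by blast
qed

lemma feasible_bipartition_exists:
  assumes "induces_connected E V" "2 \<le> card V"
  obtains D where "D \<subseteq> V" "induces_connected E D" "induces_connected E (V - D)"
proof -
  obtain v s where vs: "v \<in> V" "s \<in> V" "s \<noteq> v" using two_elements[OF assms(2)] .
  then have s: "s \<in> V - {v}" by auto
  show thesis
    using that[of "component E (V - {v}) s"] component_subset[OF s, of E]
      induces_connected_component[OF s] induces_connected_Diff_component[OF assms(1) vs]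
    by blast
qed

text \<open>Two cuts suffice: with three vertices or more, one side of a first bipartition has at
  least two vertices and can be cut again.\<close>

lemma feasible_tripartition_exists:
  assumes "induces_connected E V" "3 \<le> card V"
  obtains P where "feasible_partition 3 V E P"
proof -
  have fin: "finite V" using assms(2) by (metis card.infinite not_numeral_le_zero)
  obtain D where D: "D \<subseteq> V" "induces_connected E D" "induces_connected E (V - D)"
    using feasible_bipartition_exists[OF assms(1)] assms(2) by auto
  have "card D \<le> card V" "card (V - D) = card V - card D"
    using D fin by (auto intro!: card_mono card_Diff_subset intro: finite_subset)
  then have big: "2 \<le> card D \<or> 2 \<le> card (V - D)" using assms(2) by linarith
  obtain X Y where XY: "X \<union> Y = V" "X \<inter> Y = {}" "induces_connected E X" "induces_connected E Y"
    "2 \<le> card X"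
  proof (cases "2 \<le> card D")
    case True
    show thesis by (rule that[of D "V - D"]) (use D True in auto)
  next
    case False
    show thesis by (rule that[of "V - D" D]) (use D False big in auto)
  qed
  obtain F where "F \<subseteq> X" "induces_connected E F" "induces_connected E (X - F)"
    using feasible_bipartition_exists XY by metis
  then have "feasible_partition 3 V E {F, X - F, Y}" unfolding feasible_partition_3
    using XY by blast
  then show thesis by (rule that)
qed

section \<open>Locally optimal tripartitions\<close>

text \<open>A certificate of local optimality: after the deletion of \<open>v\<close> no edge joins
  any two of \<open>A\<close>, \<open>B\<close> and the pieces of \<open>C\<close>. For a connected
  graph and |C| > n/2 such a \<open>v\<close> exists exactly when no step is applicable. The program
  verifies this certificate, and the proof of optimality needs nothing else about the
  tripartition.\<close>

definition stuck_at :: "'a set set \<Rightarrow> 'a set \<Rightarrow> 'a set \<Rightarrow> 'a set \<Rightarrow> 'a \<Rightarrow> bool" where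
  "stuck_at E A B C v \<longleftrightarrow> v \<in> C \<and> \<not> adjacent E A B \<and>
     (\<forall>x\<in>C. \<forall>w\<in>A \<union> B. {x, w} \<in> E \<longrightarrow> x = v) \<and>
     (\<forall>s\<in>C - {v}. card (component E (C - {v}) s) \<le> card A)"

text \<open>A Merge needs an edge between the small parts. In a Pull, \<open>U\<close> touches a
  small part and so contains \<open>v\<close>; what stays behind is connected and misses
  \<open>v\<close>, so it lies in one piece of at most |A| vertices. Then |X| + |U| is at least
  |C|.\<close>

lemma stuck_at_terminal:
  assumes st: "sorted_tripartition V E P A B C" and fin: "finite V" and big: "card V < 2 * card C"
    and "stuck_at E A B C v"
  shows "\<not> approx3_step V E P R"
proof
  note 1 = sorted_tripartitionD[OF st fin]
  have v: "v \<in> C" and na: "\<not> adjacent E A B"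
    and only: "\<And>x w. x \<in> C \<Longrightarrow> w \<in> A \<union> B \<Longrightarrow> {x, w} \<in> E \<Longrightarrow> x = v"
    and small: "\<And>s. s \<in> C - {v} \<Longrightarrow> card (component E (C - {v}) s) \<le> card A"
    using assms(4) unfolding stuck_at_def by blast+
  assume "approx3_step V E P R"
  then show False unfolding approx3_step_def
  proof
    assume "merge_step V E P R"
    then show False unfolding merge_step_def
      using sorted_tripartition_unique(2)[OF st _ fin big] na adjacent_commute by metis
  next
    assume "pull_step V E P R"
    then obtain A' B' C' U X Y where s: "sorted_tripartition V E P A' B' C'"
      and XY: "X = A' \<and> Y = B' \<or> X = B' \<and> Y = A'"
      and U: "U \<noteq> {}" "U \<subset> C'" "induces_connected E U" "induces_connected E (C' - U)"
        "adjacent E U X" "card X + card U < card C'"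
      unfolding pull_step_def by blast
    have [simp]: "C' = C" and "X = A \<or> X = B"
      using sorted_tripartition_unique[OF st s fin big] XY by auto
    then have "v \<in> U" using U(2,5) only unfolding adjacent_def by (metis UnI1 UnI2 psubsetD)
    obtain y where y: "y \<in> C - U" using U by auto
    have "C - U \<subseteq> component E (C - {v}) y"
      using U y \<open>v \<in> U\<close> by (intro induces_connected_subset_component) auto
    moreover have yv: "y \<in> C - {v}" using y \<open>v \<in> U\<close> by auto
    moreover have "finite (component E (C - {v}) y)"
      using component_subset[OF yv, of E] 1(13) finite_subset[of _ C] by blast
    ultimately have "card (C - U) \<le> card A" using small[of y] card_mono by (metis order_trans)
    moreover have "card (C - U) = card C - card U"
      using U(2) 1(13) by (intro card_Diff_subset) (auto intro: finite_subset)
    ultimately show False using U(6) 1(9) \<open>X = A \<or> X = B\<close> by auto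
  qed
qed

text \<open>Drop from \<open>C\<close> the piece around \<open>x\<close> that the deletion of
  \<open>v\<close> produces. The rest is connected through \<open>v\<close> and avoids
  \<open>x\<close>, so it lies in a single component of \<open>C - {x}\<close>; it has at least |C|
  - |A| vertices.\<close>

lemma component_of_other_cut:
  assumes st: "sorted_tripartition V E P A B C" and fin: "finite V" and big: "card V < 2 * card C"
    and "v \<in> C" "x \<in> C" "x \<noteq> v"
    and small: "card (component E (C - {v}) x) \<le> card A"
  shows "card B < card (component E (C - {x}) v)"
proof -
  note 1 = sorted_tripartitionD[OF st fin]
  let ?D = "component E (C - {v}) x"
  have xv: "x \<in> C - {v}" using assms by auto
  have D: "?D \<subseteq> C - {v}" using component_subset[OF xv] .
  have "induces_connected E (C - ?D)"
    by (rule induces_connected_Diff_component[OF 1(8) assms(4,5,6)])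
  then have "C - ?D \<subseteq> component E (C - {x}) v"
  proof (rule induces_connected_subset_component)
    show "v \<in> C - ?D" "C - ?D \<subseteq> C - {x}" using assms(4) D component_refl[of x E "C - {v}"] by auto
  qed
  moreover have "finite (component E (C - {x}) v)"
    using component_subset[of v "C - {x}" E] assms(4,6) 1(13) finite_subset[of _ C] by blast
  ultimately have "card (C - ?D) \<le> card (component E (C - {x}) v)" using card_mono by metis
  moreover have "card (C - ?D) = card C - card ?D"
    using D 1(13) by (intro card_Diff_subset) (auto intro: finite_subset)
  ultimately show ?thesis using small big 1(14-17) by linarith
qed

text \<open>\<open>A\<close> has an edge leaving it by connectedness, and this edge cannot end in
  \<open>B\<close>.\<close>

lemma largest_part_contact:
  assumes st: "sorted_tripartition V E P A B C" and fin: "finite V"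
    and conn: "induces_connected E V" and na: "\<not> adjacent E A B"
  shows "adjacent E C A"
proof -
  note 1 = sorted_tripartitionD[OF st fin]
  have "adjacent E A (V - A)"
  proof (rule not_adjacent_outside[OF conn])
    have "B \<noteq> {}" using 1(16) by auto
    then show "A \<subset> V" using 1(2,3) by blast
    show "A \<noteq> {}" using 1(15) by auto
  qed
  then obtain v w where w: "w \<in> A" "v \<in> V - A" "{w, v} \<in> E" unfolding adjacent_def by blast
  moreover have "v \<notin> B" using na w unfolding adjacent_def by blast
  ultimately have v: "v \<in> C" "w \<in> A" "{v, w} \<in> E"
    using 1(2) by (auto simp: insert_commute)
  then show ?thesis unfolding adjacent_def by blast
qed

lemma small_parts_terminal:
  assumes "sorted_tripartition V E P A B C" "2 * card C \<le> card V"
  shows "\<not> approx3_step V E P R"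
proof
  \<comment> \<open>The guard inside a step speaks of its own labelling, but the size of the largest
    part does not depend on the labelling.\<close>
  have "card C' \<le> card C" if "sorted_tripartition V E P A' B' C'" for A' B' C'
    using partition_size_sorted[OF that] partition_size_sorted[OF assms(1)] by simp
  moreover assume "approx3_step V E P R"
  ultimately show False using assms(2)
    unfolding approx3_step_def merge_step_def pull_step_def by fastforce
qed

text \<open>The vertex \<open>v\<close> is a contact of the smallest part, so the absence of a Pull
  into \<open>A\<close> bounds the pieces by |A| and not merely by |B|. A second contact vertex
  \<open>x\<close> would leave a component larger than |B|, which allows a Pull into whichever of
  \<open>A\<close> and \<open>B\<close> it touches.\<close>

lemma terminal_stuck_at:
  assumes st: "sorted_tripartition V E P A B C" and fin: "finite V" and big: "card V < 2 * card C"
    and conn: "induces_connected E V" and terminal: "\<not> (\<exists>R. approx3_step V E P R)"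
  obtains v where "stuck_at E A B C v"
proof -
  note 1 = sorted_tripartitionD[OF st fin]
  have "2 \<le> card C" using big 1(14-17) by linarith
  then have na: "\<not> adjacent E A B"
    using merge_step_component[OF st fin big _ _ _ _ refl] terminal two_elements
    unfolding approx3_step_def by metis
  obtain v w where v: "v \<in> C" "w \<in> A" "{v, w} \<in> E"
    using largest_part_contact[OF st fin conn na] unfolding adjacent_def by blast
  have nopull: "\<not> pull_step V E P R" for R using terminal approx3_step_def by metis
  have small: "card (component E (C - {v}) s) \<le> card A" if "s \<in> C - {v}" for s
    using pull_step_component[OF st fin big _ v _ _ refl] nopull that by (metis DiffD1 DiffD2 insertI1 leI)
  have only: "x = v" if x: "x \<in> C" "w \<in> A \<union> B" "{x, w} \<in> E" for x w
  proof (rule ccontr)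
    assume "x \<noteq> v"
    then have "card B < card (component E (C - {x}) v)"
      using component_of_other_cut[OF st fin big v(1) x(1)] small x by auto
    then show False
      using pull_step_component[OF st fin big _ x(1) _ x(3) v(1) _ refl] nopull \<open>x \<noteq> v\<close> x(2) 1(9)
      by (metis Un_iff order_le_less_trans)
  qed
  then show thesis using that v(1) na small unfolding stuck_at_def by blast
qed

text \<open>Removing \<open>v\<close> leaves \<open>A\<close>, \<open>B\<close> and pieces no larger than \<open>A\<close>; a part avoiding \<open>v\<close> lies in one
  of them. So the two parts avoiding \<open>v\<close> have at most \<open>card A + card B\<close> vertices together.\<close>

lemma stuck_at_optimal:
  assumes st: "sorted_tripartition V E P A B C" and fin: "finite V"
    and stuck: "stuck_at E A B C v" and feas: "feasible_partition 3 V E Q"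
  shows "card C \<le> partition_size Q"
proof -
  note 1 = sorted_tripartitionD[OF st fin]
  have v: "v \<in> C" and na: "\<not> adjacent E A B"
    and only: "\<And>x w. x \<in> C \<Longrightarrow> w \<in> A \<union> B \<Longrightarrow> {x, w} \<in> E \<Longrightarrow> x = v"
    and small: "\<And>s. s \<in> C - {v} \<Longrightarrow> card (component E (C - {v}) s) \<le> card A"
    using stuck unfolding stuck_at_def by blast+
  have cl: "closed_in E (V - {v}) A" "closed_in E (V - {v}) B"
    using na only 1(2) unfolding closed_in_def adjacent_def
    by (metis (no_types, lifting) Diff_iff Un_iff insert_commute singletonI)+
  have located: "X \<subseteq> A \<or> X \<subseteq> B \<or> (X \<subseteq> C \<and> card X \<le> card A)"
    if X: "induces_connected E X" "X \<subseteq> V - {v}" for X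
  proof -
    have clX: "closed_in E X A" "closed_in E X B" using cl X(2) unfolding closed_in_def by blast+
    show ?thesis
    proof (cases "X \<inter> A = {} \<and> X \<inter> B = {}")
      case True
      then have XC: "X \<subseteq> C - {v}" using X(2) 1(2) by blast
      obtain s where s: "s \<in> X" using X by (auto simp: induces_connected_iff)
      have "X \<subseteq> component E (C - {v}) s"
        by (rule induces_connected_subset_component[OF X(1) s XC])
      moreover have "finite (component E (C - {v}) s)"
        using component_subset[of s "C - {v}" E] s XC 1(13) finite_subset[of _ C] by blast
      ultimately have "card X \<le> card A" using small[of s] s XC card_mono by (metis order_trans subsetD)
      then show ?thesis using XC by blast
    next
      case False
      then show ?thesis
        using induces_connectedD[OF X(1) clX(1)] induces_connectedD[OF X(1) clX(2)] by blast
    qed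
  qed
  have sum: "card C \<le> card Z"
    if XYZ: "X \<union> Y \<union> Z = V" "X \<inter> Y = {}" "X \<inter> Z = {}" "Y \<inter> Z = {}"
      "induces_connected E X" "induces_connected E Y" and vZ: "v \<in> Z" for X Y Z
  proof -
    have fin': "finite X" "finite Y" "finite Z" using XYZ(1) fin by auto
    have "card V = card (X \<union> Y) + card Z" unfolding XYZ(1)[symmetric]
      using fin' XYZ by (intro card_Un_disjoint) auto
    moreover have c: "card (X \<union> Y) = card X + card Y" using fin' XYZ by (intro card_Un_disjoint) auto
    moreover have "card X + card Y \<le> card A + card B"
    proof -
      have X: "X \<subseteq> A \<or> X \<subseteq> B \<or> (X \<subseteq> C \<and> card X \<le> card A)"
        and Y: "Y \<subseteq> A \<or> Y \<subseteq> B \<or> (Y \<subseteq> C \<and> card Y \<le> card A)"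
        using located XYZ vZ by blast+
      \<comment> \<open>Separate bounds fail only if both parts lie in \<open>B\<close>, where each
        may exceed |A|; there disjointness bounds the sum. In the remaining cases one part has at
        most |A| vertices and the other at most |B|.\<close>
      show ?thesis
      proof (cases "X \<union> Y \<subseteq> A \<or> X \<union> Y \<subseteq> B")
        case True
        then show ?thesis
          using card_mono[OF 1(11), of "X \<union> Y"] card_mono[OF 1(12), of "X \<union> Y"] c by linarith
      next
        case False
        have "card Z \<le> card A" if "Z \<subseteq> A \<or> (Z \<subseteq> C \<and> card Z \<le> card A)" for Z
          using that card_mono[OF 1(11)] by blast
        moreover have "card Z \<le> card B" if "Z \<subseteq> B" for Z using that card_mono[OF 1(12)] by blast
        ultimately have "card X \<le> card A \<and> card Y \<le> card B \<or> card X \<le> card B \<and> card Y \<le> card A"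
          using X Y False 1(9) by (meson Un_least order_trans)
        then show ?thesis by linarith
      qed
    qed
    ultimately show ?thesis using 1(14) by linarith
  qed
  obtain X Y Z where Q: "Q = {X, Y, Z}" using feasible_partition_3E[OF feas] .
  then have XYZ: "X \<union> Y \<union> Z = V" "X \<inter> Y = {}" "X \<inter> Z = {}" "Y \<inter> Z = {}"
    "induces_connected E X" "induces_connected E Y" "induces_connected E Z"
    using feas feasible_partition_3 by metis+
  have "v \<in> X \<union> Y \<union> Z" using v 1(2) XYZ(1) by blast
  then have "card C \<le> card X \<or> card C \<le> card Y \<or> card C \<le> card Z"
    using sum[of X Y Z] sum[of X Z Y] sum[of Y Z X] XYZ
    by (metis Int_commute Un_assoc Un_commute Un_iff)
  then show ?thesis unfolding Q partition_size_3 by auto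
qed

section \<open>The optimum value and the approximation ratio\<close>

lemma finite_feasible_partitions:
  assumes "finite V"
  shows "finite {P. feasible_partition k V E P}"
proof (rule finite_subset)
  show "{P. feasible_partition k V E P} \<subseteq> Pow (Pow V)"
    by (auto simp: feasible_partition_def partition_on_def)
qed (use assms in simp)

lemma opt_bgp_attained:
  assumes "finite V" "feasible_partition k V E P"
  obtains Q where "feasible_partition k V E Q" "opt_bgp k V E = partition_size Q"
proof -
  have "opt_bgp k V E \<in> partition_size ` {P. feasible_partition k V E P}"
    unfolding opt_bgp_def using assms finite_feasible_partitions[OF assms(1)] by (intro Min_in) auto
  then show thesis using that by auto
qed

lemma opt_bgp_le:
  assumes "finite V" "feasible_partition k V E P"
  shows "opt_bgp k V E \<le> partition_size P"
  unfolding opt_bgp_def using assms finite_feasible_partitions[OF assms(1)] by (intro Min_le) auto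

lemma card_le_3_partition_size:
  assumes "finite V" "feasible_partition 3 V E P"
  shows "card V \<le> 3 * partition_size P"
proof -
  obtain A B C where "sorted_tripartition V E P A B C" using sorted_tripartition_exists[OF assms(2)] .
  then show ?thesis
    using sorted_tripartitionD(9,10,14)[OF _ assms(1)] partition_size_sorted by fastforce
qed

lemma approx3_output_ratio:
  assumes "simple_graph V E" "connected_graph V E"
    and out: "approx3_output V E {A, B, C}" and srt: "card A \<le> card B" "card B \<le> card C"
  shows "feasible_partition 3 V E {A, B, C}" "real (card C) \<le> 3 / 2 * real (opt_bgp 3 V E)"
proof -
  have fin: "finite V" using assms by (simp add: simple_graph_def)
  have conn: "induces_connected E V" using assms induces_connected_whole by metis
  show f: "feasible_partition 3 V E {A, B, C}"
    using out approx3_steps_feasible fin unfolding approx3_output_def approx3_loop_def by metis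
  then have st: "sorted_tripartition V E {A, B, C} A B C"
    using srt by (simp add: sorted_tripartition_def)
  have terminal: "\<not> (\<exists>R. approx3_step V E {A, B, C} R)"
    using out by (auto simp: approx3_output_def approx3_loop_def)
  obtain Q where Q: "feasible_partition 3 V E Q" "opt_bgp 3 V E = partition_size Q"
    using opt_bgp_attained[OF fin f] .
  show "real (card C) \<le> 3 / 2 * real (opt_bgp 3 V E)"
  proof (cases "card V < 2 * card C")
    case True
    then obtain v where "stuck_at E A B C v" using terminal_stuck_at[OF st fin _ conn terminal] by blast
    then have "card C \<le> opt_bgp 3 V E" using stuck_at_optimal[OF st fin _ Q(1)] Q(2) by simp
    then show ?thesis by simp
  next
    case False
    then show ?thesis using card_le_3_partition_size[OF fin Q(1)] Q(2) by simp
  qed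
qed

section \<open>The path on twelve vertices\<close>

lemma simple_graph_path: "simple_graph {..<n} (path_edges n)"
proof -
  have "{i, Suc i} \<in> {{u, v} |u v. u \<in> {..<n} \<and> v \<in> {..<n} \<and> u \<noteq> v}" if "Suc i < n" for i
    using that by (intro CollectI exI[of _ i] exI[of _ "Suc i"]) auto
  then show ?thesis unfolding simple_graph_def path_edges_def by auto
qed

lemma induces_connected_path:
  assumes "a < b" "b \<le> n"
  shows "induces_connected (path_edges n) {a..<b}"
proof (rule induces_connectedI[of a])
  fix S assume S: "a \<in> S" "closed_in (path_edges n) {a..<b} S"
  have "x \<in> S" if "a \<le> x" "x < b" for x
    using that
  proof (induction x rule: dec_induct)
    case (step x)
    then have "{x, Suc x} \<in> path_edges n" using assms by (auto simp: path_edges_def)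
    then show ?case using step closed_inD[OF S(2)] by simp
  qed (use S in simp)
  then show "{a..<b} \<subseteq> S" by auto
qed (use assms in simp)

lemma feasible_path_12:
  assumes "0 < a" "a < b" "b < 12"
  shows "feasible_partition 3 {..<12} (path_edges 12) {{0..<a}, {a..<b}, {b..<12}}"
  unfolding feasible_partition_3 using assms by (auto intro!: induces_connected_path)

lemma opt_bgp_path_12: "opt_bgp 3 {..<12} (path_edges 12) = 4"
proof -
  have f: "feasible_partition 3 {..<12} (path_edges 12) {{0..<4}, {4..<8}, {8..<12}}"
    by (rule feasible_path_12) auto
  obtain Q where "feasible_partition 3 {..<12} (path_edges 12) Q"
    "opt_bgp 3 {..<12} (path_edges 12) = partition_size Q"
    using opt_bgp_attained[OF _ f] by auto
  \<comment> \<open>Averaging: three parts of at most OPT vertices cover the path.\<close>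
  then have "12 \<le> 3 * opt_bgp 3 {..<12} (path_edges 12)"
    using card_le_3_partition_size by fastforce
  moreover have "opt_bgp 3 {..<12} (path_edges 12) \<le> 4"
    using opt_bgp_le[OF _ f] by (simp add: partition_size_3)
  ultimately show ?thesis by simp
qed

text \<open>The guard is strict and 6 is exactly half of 12, so the loop stops before its first step
  and this initial tripartition is returned unchanged.\<close>

lemma approx3_output_path_12:
  "approx3_output {..<12} (path_edges 12) {{0..<3}, {3..<6}, {6..<12}}"
proof -
  let ?P = "{{0..<3}, {3..<6}, {6..<12}} :: nat set set"
  have f: "feasible_partition 3 {..<12} (path_edges 12) ?P" by (rule feasible_path_12) auto
  have "card C \<le> 6" if "sorted_tripartition {..<12} (path_edges 12) ?P A B C" for A B C
    using partition_size_sorted[OF that] by (simp add: partition_size_3)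
  then have "\<not> approx3_step {..<12} (path_edges 12) ?P R" for R
    unfolding approx3_step_def merge_step_def pull_step_def by fastforce
  then show ?thesis using f unfolding approx3_output_def approx3_loop_def by blast
qed

section \<open>Weakest preconditions with a clock\<close>

text \<open>The clock \<open>a\<close> shows the time at the start of \<open>c\<close>, so postconditions can bound running times.\<close>

definition wp :: "nat \<Rightarrow> com \<Rightarrow> state \<Rightarrow> nat \<Rightarrow> (state \<Rightarrow> nat \<Rightarrow> bool) \<Rightarrow> bool" where
  "wp W c s a Q \<longleftrightarrow> (\<exists>t s'. exec W c s t s' \<and> Q s' (a + t))"

inductive_cases exec_SkipE: "exec W Skip s t s'"
inductive_cases exec_AssignE: "exec W (Assign x e) s t s'"
inductive_cases exec_StoreE: "exec W (Store x i e) s t s'"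
inductive_cases exec_SeqE: "exec W (Seq c1 c2) s t s'"
inductive_cases exec_CondE: "exec W (Cond b c1 c2) s t s'"

lemma wp_Skip [simp]: "wp W Skip s a Q \<longleftrightarrow> Q s (Suc a)"
  unfolding wp_def by (force elim: exec_SkipE intro: exec.Skip)

lemma wp_Assign [simp]:
  "wp W (Assign x e) s a Q \<longleftrightarrow> aval e s \<le> W \<and> Q (s\<lparr>scal := (scal s)(x := aval e s)\<rparr>) (Suc a)"
proof
  assume "wp W (Assign x e) s a Q"
  then show "aval e s \<le> W \<and> Q (s\<lparr>scal := (scal s)(x := aval e s)\<rparr>) (Suc a)"
    unfolding wp_def by (auto elim!: exec_AssignE)
next
  assume *: "aval e s \<le> W \<and> Q (s\<lparr>scal := (scal s)(x := aval e s)\<rparr>) (Suc a)"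
  then have "exec W (Assign x e) s 1 (s\<lparr>scal := (scal s)(x := aval e s)\<rparr>)"
    by (intro exec.Assign) simp
  then show "wp W (Assign x e) s a Q" unfolding wp_def using * by fastforce
qed

lemma wp_Store [simp]:
  "wp W (Store x i e) s a Q \<longleftrightarrow> aval i s \<le> W \<and> aval e s \<le> W \<and>
     Q (s\<lparr>arr := (arr s)(x := (arr s x)(aval i s := aval e s))\<rparr>) (Suc a)" (is "_ \<longleftrightarrow> ?R")
proof
  assume "wp W (Store x i e) s a Q"
  then show ?R unfolding wp_def by (auto elim!: exec_StoreE)
next
  assume *: ?R
  then have "exec W (Store x i e) s 1 (s\<lparr>arr := (arr s)(x := (arr s x)(aval i s := aval e s))\<rparr>)"
    by (intro exec.Store) simp_all
  then show "wp W (Store x i e) s a Q" unfolding wp_def using * by fastforce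
qed

lemma wp_Seq [simp]: "wp W (Seq c1 c2) s a Q \<longleftrightarrow> wp W c1 s a (\<lambda>s' a'. wp W c2 s' a' Q)"
proof
  assume "wp W (Seq c1 c2) s a Q"
  then show "wp W c1 s a (\<lambda>s' a'. wp W c2 s' a' Q)"
    unfolding wp_def by (fastforce elim!: exec_SeqE simp: add.assoc)
next
  assume "wp W c1 s a (\<lambda>s' a'. wp W c2 s' a' Q)"
  then obtain t1 s1 t2 s2 where "exec W c1 s t1 s1" "exec W c2 s1 t2 s2" "Q s2 (a + t1 + t2)"
    unfolding wp_def by blast
  then show "wp W (Seq c1 c2) s a Q" unfolding wp_def using exec.Seq by (metis add.assoc)
qed

lemma wp_Cond [simp]:
  "wp W (Cond b c1 c2) s a Q \<longleftrightarrow>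
     (bval b s \<longrightarrow> wp W c1 s (Suc a) Q) \<and> (\<not> bval b s \<longrightarrow> wp W c2 s (Suc a) Q)" (is "_ \<longleftrightarrow> ?R")
proof
  assume "wp W (Cond b c1 c2) s a Q"
  then show ?R unfolding wp_def by (fastforce elim!: exec_CondE)
next
  assume R: ?R
  show "wp W (Cond b c1 c2) s a Q"
  proof (cases "bval b s")
    case True
    then obtain t s' where t: "exec W c1 s t s'" "Q s' (Suc a + t)" using R unfolding wp_def by blast
    have "exec W (Cond b c1 c2) s (1 + t) s'" by (rule exec.CondTrue[OF True t(1)])
    moreover have "Q s' (a + (1 + t))" using t(2) by simp
    ultimately show ?thesis unfolding wp_def by blast
  next
    case False
    then obtain t s' where t: "exec W c2 s t s'" "Q s' (Suc a + t)" using R unfolding wp_def by blast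
    have "exec W (Cond b c1 c2) s (1 + t) s'" by (rule exec.CondFalse[OF False t(1)])
    moreover have "Q s' (a + (1 + t))" using t(2) by simp
    ultimately show ?thesis unfolding wp_def by blast
  qed
qed

lemma wp_While_unfold:
  assumes "bval b s \<Longrightarrow> wp W c s (Suc a) (\<lambda>s' a'. wp W (While b c) s' a' Q)"
    "\<not> bval b s \<Longrightarrow> Q s (Suc a)"
  shows "wp W (While b c) s a Q"
proof (cases "bval b s")
  case True
  then obtain t1 s1 t2 s2 where e: "exec W c s t1 s1" "exec W (While b c) s1 t2 s2"
    and Q: "Q s2 (Suc a + t1 + t2)"
    using assms(1) unfolding wp_def by blast
  have "exec W (While b c) s (1 + t1 + t2) s2" by (rule exec.WhileTrue[OF True e])
  moreover have "Q s2 (a + (1 + t1 + t2))" using Q by (simp add: ac_simps)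
  ultimately show ?thesis unfolding wp_def by blast
next
  case False
  then have "exec W (While b c) s 1 s" by (rule exec.WhileFalse)
  moreover have "Q s (a + 1)" using assms(2) False by simp
  ultimately show ?thesis unfolding wp_def by blast
qed

primrec svars :: "com \<Rightarrow> string set" where
  "svars Skip = {}"
| "svars (Assign x e) = {x}"
| "svars (Store x i e) = {}"
| "svars (Seq c1 c2) = svars c1 \<union> svars c2"
| "svars (Cond b c1 c2) = svars c1 \<union> svars c2"
| "svars (While b c) = svars c"

primrec avars :: "com \<Rightarrow> string set" where
  "avars Skip = {}"
| "avars (Assign x e) = {}"
| "avars (Store x i e) = {x}"
| "avars (Seq c1 c2) = avars c1 \<union> avars c2"
| "avars (Cond b c1 c2) = avars c1 \<union> avars c2"
| "avars (While b c) = avars c"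

text \<open>What a command leaves alone is read off its syntax. Invariants therefore mention only
  what changes, and all other registers and arrays are recovered from the frame.\<close>

definition frame :: "com \<Rightarrow> state \<Rightarrow> state \<Rightarrow> bool" where
  "frame c s s' \<longleftrightarrow>
     (\<forall>x. x \<notin> svars c \<longrightarrow> scal s' x = scal s x) \<and> (\<forall>x. x \<notin> avars c \<longrightarrow> arr s' x = arr s x)"

lemma frame_scal: "frame c s s' \<Longrightarrow> x \<notin> svars c \<Longrightarrow> scal s' x = scal s x"
  and frame_arr: "frame c s s' \<Longrightarrow> x \<notin> avars c \<Longrightarrow> arr s' x = arr s x"
  by (auto simp: frame_def)

lemma frame_refl: "frame c s s"
  by (simp add: frame_def)

lemma frame_trans:
  "frame c s s' \<Longrightarrow> frame d s' s'' \<Longrightarrow> svars c \<subseteq> svars d \<Longrightarrow> avars c \<subseteq> avars d \<Longrightarrow> frame d s s''"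
  "frame d s s' \<Longrightarrow> frame c s' s'' \<Longrightarrow> svars c \<subseteq> svars d \<Longrightarrow> avars c \<subseteq> avars d \<Longrightarrow> frame d s s''"
  by (auto simp: frame_def subset_iff)

lemma frame_exec: "exec W c s t s' \<Longrightarrow> frame c s s'"
  by (induction rule: exec.induct) (auto simp: frame_def)

lemma wp_conseq:
  assumes "wp W c s a Q" "\<And>s' a'. frame c s s' \<Longrightarrow> Q s' a' \<Longrightarrow> R s' a'"
  shows "wp W c s a R"
  using assms frame_exec unfolding wp_def by blast

text \<open>Every obligation receives the frame relating the current state to the state before the
  loop. Termination rests on \<open>\<mu>\<close>, whereas time bounds are ordinary conjuncts of the
  invariant about the clock.\<close>

lemma wp_While:
  fixes \<mu> :: "state \<Rightarrow> nat"
  assumes start: "I s a"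
    and step: "\<And>s1 a1. I s1 a1 \<Longrightarrow> frame c s s1 \<Longrightarrow> bval b s1 \<Longrightarrow>
      wp W c s1 (Suc a1) (\<lambda>s2 a2. I s2 a2 \<and> \<mu> s2 < \<mu> s1)"
    and post: "\<And>s1 a1. I s1 a1 \<Longrightarrow> frame c s s1 \<Longrightarrow> \<not> bval b s1 \<Longrightarrow> Q s1 (Suc a1)"
  shows "wp W (While b c) s a Q"
proof -
  have "I s1 a1 \<Longrightarrow> frame c s s1 \<Longrightarrow> wp W (While b c) s1 a1 Q" for s1 a1
  proof (induction "\<mu> s1" arbitrary: s1 a1 rule: less_induct)
    case less
    show ?case
    proof (rule wp_While_unfold)
      assume "bval b s1"
      from step[OF less(2,3) this] show "wp W c s1 (Suc a1) (\<lambda>s' a'. wp W (While b c) s' a' Q)"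
        by (rule wp_conseq) (use less frame_trans(1)[OF less(3)] in blast)
    qed (use post less in blast)
  qed
  then show ?thesis using start frame_refl by blast
qed

section \<open>Loops over all vertices and over an adjacency list\<close>

definition for_loop :: "string \<Rightarrow> com \<Rightarrow> com" where
  "for_loop x c = Seq (Assign x (Lit 0))
     (While (Less (Var x) (Var ''n'')) (Seq c (Assign x (Add (Var x) (Lit 1)))))"

lemma vars_for_loop [simp]:
  "svars (for_loop x c) = insert x (svars c)" "avars (for_loop x c) = avars c"
  by (auto simp: for_loop_def)

text \<open>The invariant takes the round number as an argument and must not depend on the counter
  register, so that incrementing the counter preserves it. The two \<open>Suc\<close> in
  \<open>step\<close> pay for the test before the body and the increment after it. The bound
  \<open>n \<le> W\<close> is there because the counter itself reaches \<open>n\<close>.\<close>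

lemma wp_for_loop:
  assumes n: "scal s ''n'' = n" "n \<le> W" and x: "x \<noteq> ''n''" "x \<notin> svars c" "''n'' \<notin> svars c"
    and indep: "\<And>i s a k. I i s a \<Longrightarrow> I i (s\<lparr>scal := (scal s)(x := k)\<rparr>) a"
    and start: "I 0 s (Suc a)"
    and step: "\<And>i s1 a1. i < n \<Longrightarrow> scal s1 x = i \<Longrightarrow> frame (for_loop x c) s s1 \<Longrightarrow> I i s1 a1 \<Longrightarrow>
      wp W c s1 (Suc a1) (\<lambda>s2 a2. I (Suc i) s2 (Suc a2))"
    and post: "\<And>s1 a1. frame (for_loop x c) s s1 \<Longrightarrow> I n s1 a1 \<Longrightarrow> Q s1 (Suc a1)"
  shows "wp W (for_loop x c) s a Q"
proof -
  let ?s = "s\<lparr>scal := (scal s)(x := 0)\<rparr>"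
  let ?J = "\<lambda>s1 a1. scal s1 x \<le> n \<and> I (scal s1 x) s1 a1"
  have fr: "frame (for_loop x c) s s1" if "frame (Seq c (Assign x (Add (Var x) (Lit 1)))) ?s s1" for s1
    using that by (auto simp: frame_def)
  have n1: "scal s1 ''n'' = n" if "frame (for_loop x c) s s1" for s1
    using frame_scal[OF that, of "''n''"] n x by simp
  have "wp W (While (Less (Var x) (Var ''n'')) (Seq c (Assign x (Add (Var x) (Lit 1))))) ?s (Suc a) Q"
  proof (rule wp_While[where I = ?J and \<mu> = "\<lambda>s1. n - scal s1 x"])
    show "?J ?s (Suc a)" using indep[OF start] by simp
    fix s1 a1
    assume J: "?J s1 a1" and f: "frame (Seq c (Assign x (Add (Var x) (Lit 1)))) ?s s1"
    note f' = fr[OF f]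
    {
      assume "bval (Less (Var x) (Var ''n'')) s1"
      then have i: "scal s1 x < n" using n1[OF f'] by simp
      from step[OF i refl f' conjunct2[OF J]]
      show "wp W (Seq c (Assign x (Add (Var x) (Lit 1)))) s1 (Suc a1)
        (\<lambda>s2 a2. ?J s2 a2 \<and> n - scal s2 x < n - scal s1 x)"
        unfolding wp_Seq
      proof (rule wp_conseq)
        fix s2 a2 assume "frame c s1 s2" and I: "I (Suc (scal s1 x)) s2 (Suc a2)"
        then have [simp]: "scal s2 x = scal s1 x" using frame_scal x by metis
        show "wp W (Assign x (Add (Var x) (Lit 1))) s2 a2
          (\<lambda>s2 a2. ?J s2 a2 \<and> n - scal s2 x < n - scal s1 x)"
          using i n indep[OF I] by simp
      qed
    }
    {
      assume "\<not> bval (Less (Var x) (Var ''n'')) s1"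
      then have "scal s1 x = n" using n1[OF f'] J by simp
      then show "Q s1 (Suc a1)" using post[OF f'] J by simp
    }
  qed
  then show ?thesis unfolding for_loop_def using n by simp
qed

definition nbr_loop :: "com \<Rightarrow> com" where
  "nbr_loop c = Seq (Assign ''j'' (Read ''off'' (Var ''u'')))
     (Seq (Assign ''e'' (Read ''off'' (Add (Var ''u'') (Lit 1))))
       (While (Less (Var ''j'') (Var ''e''))
         (Seq (Assign ''w'' (Read ''nbr'' (Var ''j'')))
           (Seq c (Assign ''j'' (Add (Var ''j'') (Lit 1)))))))"

lemma vars_nbr_loop [simp]:
  "svars (nbr_loop c) = {''j'', ''e'', ''w''} \<union> svars c" "avars (nbr_loop c) = avars c"
  by (auto simp: nbr_loop_def)

definition nb :: "nat set set \<Rightarrow> nat \<Rightarrow> nat set" where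
  "nb E v = {u. {v, u} \<in> E}"

text \<open>The cost measure of a graph search, up to a constant: one unit for a vertex and one for
  each entry of its adjacency list. It is additive over disjoint sets, so the costs of searching
  different components add up to a linear bound.\<close>

definition vol :: "nat set set \<Rightarrow> nat set \<Rightarrow> nat" where
  "vol E X = (\<Sum>v\<in>X. 1 + card (nb E v))"

text \<open>The word bound covers every stored number: counters and queue positions reach
  \<open>n\<close>, offsets reach \<open>2 * card E\<close>, and labels reach 3.\<close>

locale stored_graph =
  fixes n :: nat and E :: "nat set set" and W :: nat
  assumes simple: "simple_graph {..<n} E" and W: "n + 2 * card E + 4 \<le> W"
begin

lemma nb_less: "y \<in> nb E v \<Longrightarrow> y < n" "y \<in> nb E v \<Longrightarrow> v < n"
  using simple by (auto simp: nb_def simple_graph_def doubleton_eq_iff dest!: subsetD)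

lemma nb_subset: "nb E v \<subseteq> {..<n}"
  using nb_less by blast

lemma finite_nb [simp]: "finite (nb E v)"
  using nb_subset finite_subset by blast

text \<open>Handshake bound: the pairs (v, u) with u a neighbour of v are among the orientations of
  the edges, and an edge has at most two orientations.\<close>

lemma sum_card_nb: "(\<Sum>v<n. card (nb E v)) \<le> 2 * card E"
proof -
  have fin: "finite E" using simple by (rule simple_graph_finite_edges)
  define P where "P e = {p. fst p \<noteq> snd p \<and> e = {fst p, snd p}}" for e :: "nat set"
  have P: "finite (P e) \<and> card (P e) \<le> 2" for e
  proof (cases "\<exists>p. p \<in> P e")
    case True
    then obtain u v where "e = {u, v}" unfolding P_def by blast
    then have sub: "P e \<subseteq> {(u, v), (v, u)}" unfolding P_def by (auto simp: doubleton_eq_iff)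
    have "card {x, y} \<le> 2" for x y :: "nat \<times> nat" by (cases "x = y") auto
    moreover have "finite (P e)" by (rule finite_subset[OF sub]) simp
    moreover have "card (P e) \<le> card {(u, v), (v, u)}" by (rule card_mono[OF _ sub]) simp
    ultimately show ?thesis using order_trans by blast
  next
    case False
    then have "P e = {}" by blast
    then show ?thesis by simp
  qed
  have "(\<Sum>v<n. card (nb E v)) = card (SIGMA v:{..<n}. nb E v)" by simp
  also have "\<dots> \<le> card (\<Union>e\<in>E. P e)"
  proof (rule card_mono)
    show "finite (\<Union>e\<in>E. P e)" using fin P by (intro finite_UN_I) auto
    have "u \<noteq> v" if "{u, v} \<in> E" for u v
      using that simple by (auto simp: simple_graph_def doubleton_eq_iff dest!: subsetD)
    then show "(SIGMA v:{..<n}. nb E v) \<subseteq> (\<Union>e\<in>E. P e)" by (auto simp: nb_def P_def)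
  qed
  also have "\<dots> \<le> (\<Sum>e\<in>E. card (P e))" by (rule card_UN_le[OF fin])
  also have "\<dots> \<le> (\<Sum>e\<in>E. 2)" using P by (intro sum_mono) auto
  finally show ?thesis by simp
qed

lemma vol_le: "vol E {..<n} \<le> n + 2 * card E"
  using sum_card_nb unfolding vol_def sum.distrib by simp

text \<open>The bijection in \<open>stores_graph\<close> forces each list to have as many cells as
  the vertex has neighbours. Offsets are thus partial degree sums, which is why they fit into a
  word.\<close>

lemma stored_offsets:
  assumes s: "stores_graph n E s"
  shows "v \<le> n \<Longrightarrow> arr s ''off'' v = (\<Sum>u<v. card (nb E u))"
proof (induction v)
  case (Suc v)
  have "v < n" using Suc.prems by simp
  then have "arr s ''off'' v \<le> arr s ''off'' (Suc v)"
    and "bij_betw (arr s ''nbr'') {arr s ''off'' v ..< arr s ''off'' (Suc v)} (nb E v)"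
    using s unfolding stores_graph_def nb_def by blast+
  then have "arr s ''off'' (Suc v) = arr s ''off'' v + card (nb E v)"
    using bij_betw_same_card by fastforce
  then show ?case using Suc by simp
qed (use s in \<open>simp add: stores_graph_def\<close>)

lemma stored_offsets_le:
  assumes "stores_graph n E s" "v \<le> n"
  shows "arr s ''off'' v \<le> W"
proof -
  have "(\<Sum>u<v. card (nb E u)) \<le> (\<Sum>u<n. card (nb E u))" using assms by (intro sum_mono2) auto
  then show ?thesis using stored_offsets[OF assms] sum_card_nb W by linarith
qed

lemma stores_graph_frame:
  assumes "stores_graph n E s" "frame c s s'" "''n'' \<notin> svars c" "''off'' \<notin> avars c" "''nbr'' \<notin> avars c"
  shows "stores_graph n E s'"
  using assms(1) frame_scal[OF assms(2,3)] frame_arr[OF assms(2,4)] frame_arr[OF assms(2,5)]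
  unfolding stores_graph_def by simp

text \<open>The order of a list is arbitrary, so the invariant is indexed by the set
  \<open>D\<close> of neighbours already treated. Lists have no repetitions, which gives
  \<open>y \<notin> D\<close> and lets \<open>card D\<close> count the rounds in time bounds. Clock
  offsets: 2 for fetching the list limits, 2 for the test and the fetch of \<open>w\<close>, 1 for
  the increment.\<close>

lemma wp_nbr_loop:
  assumes s: "stores_graph n E s" and v: "scal s ''u'' = v" "v < n"
    and nomod: "''j'' \<notin> svars c" "''e'' \<notin> svars c" "''off'' \<notin> avars c" "''nbr'' \<notin> avars c"
    and indep: "\<And>D s a k x. x = ''j'' \<or> x = ''e'' \<or> x = ''w'' \<Longrightarrow> I D s a \<Longrightarrow>
      I D (s\<lparr>scal := (scal s)(x := k)\<rparr>) a"
    and start: "I {} s (a + 2)"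
    and step: "\<And>D y s1 a1. D \<subseteq> nb E v \<Longrightarrow> y \<in> nb E v \<Longrightarrow> y \<notin> D \<Longrightarrow> scal s1 ''w'' = y \<Longrightarrow>
      frame (nbr_loop c) s s1 \<Longrightarrow> I D s1 a1 \<Longrightarrow>
      wp W c s1 (a1 + 2) (\<lambda>s2 a2. I (insert y D) s2 (a2 + 1))"
    and post: "\<And>s1 a1. frame (nbr_loop c) s s1 \<Longrightarrow> I (nb E v) s1 a1 \<Longrightarrow> Q s1 (a1 + 1)"
  shows "wp W (nbr_loop c) s a Q"
proof -
  let ?lo = "arr s ''off'' v" and ?hi = "arr s ''off'' (Suc v)" and ?f = "arr s ''nbr''"
  let ?d = "Seq (Assign ''w'' (Read ''nbr'' (Var ''j''))) (Seq c (Assign ''j'' (Add (Var ''j'') (Lit 1))))"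
  let ?s = "s\<lparr>scal := (scal s)(''j'' := ?lo, ''e'' := ?hi)\<rparr>"
  let ?J = "\<lambda>s1 a1. ?lo \<le> scal s1 ''j'' \<and> scal s1 ''j'' \<le> ?hi \<and> scal s1 ''e'' = ?hi \<and>
    I (?f ` {?lo ..< scal s1 ''j''}) s1 a1"
  have bij: "bij_betw ?f {?lo ..< ?hi} (nb E v)" and lo: "?lo \<le> ?hi"
    using s v(2) by (auto simp: stores_graph_def nb_def)
  have W': "?lo \<le> W" "?hi \<le> W" using stored_offsets_le[OF s] v by auto
  have fr: "frame (nbr_loop c) s s1" if "frame ?d ?s s1" for s1
    using that by (auto simp: frame_def)
  have "wp W (While (Less (Var ''j'') (Var ''e'')) ?d) ?s (a + 2) Q"
  proof (rule wp_While[where I = ?J and \<mu> = "\<lambda>s1. ?hi - scal s1 ''j''"])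
    have "I {} (s\<lparr>scal := (scal s)(''j'' := ?lo)\<rparr>) (a + 2)" by (rule indep[OF _ start]) simp
    then have "I {} (s\<lparr>scal := (scal s)(''j'' := ?lo)\<rparr>\<lparr>scal :=
      (scal (s\<lparr>scal := (scal s)(''j'' := ?lo)\<rparr>))(''e'' := ?hi)\<rparr>) (a + 2)" by (rule indep[rotated]) simp
    then show "?J ?s (a + 2)" using lo by simp
  next
    fix s1 a1
    assume J: "?J s1 a1" and f: "frame ?d ?s s1"
    note f' = fr[OF f]
    {
      assume "bval (Less (Var ''j'') (Var ''e'')) s1"
      then have j: "scal s1 ''j'' < ?hi" using J by simp
      let ?y = "?f (scal s1 ''j'')" and ?D = "?f ` {?lo ..< scal s1 ''j''}"
      let ?s1 = "s1\<lparr>scal := (scal s1)(''w'' := ?y)\<rparr>"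
      have nbr: "arr s1 ''nbr'' = ?f" using frame_arr[OF f', of "''nbr''"] nomod by simp
      have jm: "scal s1 ''j'' \<in> {?lo ..< ?hi}" using j J by simp
      have y: "?y \<in> nb E v" using bij_betwE[OF bij] jm by blast
      have D: "?D \<subseteq> nb E v" using bij_betwE[OF bij] j by auto
      have inj: "inj_on ?f {?lo ..< ?hi}" using bij by (rule bij_betw_imp_inj_on)
      have yD: "?y \<notin> ?D"
      proof
        assume "?y \<in> ?D"
        then obtain i where "i \<in> {?lo ..< scal s1 ''j''}" "?f (scal s1 ''j'') = ?f i" by auto
        then show False using inj_onD[OF inj, of "scal s1 ''j''" i] j jm by auto
      qed
      have Dins: "?f ` {?lo ..< Suc (scal s1 ''j'')} = insert ?y ?D"
        using J by (auto simp: less_Suc_eq)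
      have yW: "?y \<le> W" using nb_less(1)[OF y] W by simp
      have "frame (nbr_loop c) s ?s1" using f' by (auto simp: frame_def)
      moreover have "I ?D ?s1 a1" using J by (intro indep) auto
      ultimately have "wp W c ?s1 (a1 + 2) (\<lambda>s2 a2. I (insert ?y ?D) s2 (a2 + 1))"
        using step[OF D y yD, of ?s1 a1] by simp
      then have "wp W c ?s1 (a1 + 2) (\<lambda>s2 a2. wp W (Assign ''j'' (Add (Var ''j'') (Lit 1))) s2 a2
        (\<lambda>s2 a2. ?J s2 a2 \<and> ?hi - scal s2 ''j'' < ?hi - scal s1 ''j''))"
      proof (rule wp_conseq)
        fix s2 a2 assume "frame c ?s1 s2" and I: "I (insert ?y ?D) s2 (a2 + 1)"
        then have "scal s2 ''j'' = scal s1 ''j''" "scal s2 ''e'' = scal s1 ''e''"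
          using frame_scal[of c ?s1 s2] nomod by auto
        then show "wp W (Assign ''j'' (Add (Var ''j'') (Lit 1))) s2 a2
          (\<lambda>s2 a2. ?J s2 a2 \<and> ?hi - scal s2 ''j'' < ?hi - scal s1 ''j'')"
          using j J W' Dins indep[OF _ I, of "''j''"] by auto
      qed
      then show "wp W ?d s1 (Suc a1) (\<lambda>s2 a2. ?J s2 a2 \<and> ?hi - scal s2 ''j'' < ?hi - scal s1 ''j'')"
        using yW nbr by simp
    }
    {
      assume "\<not> bval (Less (Var ''j'') (Var ''e'')) s1"
      then have "scal s1 ''j'' = ?hi" using J by simp
      then have "I (nb E v) s1 a1" using J bij by (simp add: bij_betw_def)
      then show "Q s1 (Suc a1)" using post[OF f'] by simp
    }
  qed
  then show ?thesis unfolding nbr_loop_def using v W' by simp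
qed

end

lemma component_eq:
  assumes "r \<in> A" "z \<in> component E A r"
  shows "component E A z = component E A r"
proof
  show "component E A z \<subseteq> component E A r"
    by (rule component_least[OF assms(2) closed_in_component[OF assms(1)]])
  show "component E A r \<subseteq> component E A z"
    by (rule induces_connected_subset_component[OF induces_connected_component[OF assms(1)]
      assms(2) component_subset[OF assms(1)]])
qed

lemma vol_Un:
  assumes "finite X" "finite Y" "X \<inter> Y = {}"
  shows "vol E (X \<union> Y) = vol E X + vol E Y"
  unfolding vol_def using assms by (rule sum.union_disjoint)

lemma vol_mono: "finite Y \<Longrightarrow> X \<subseteq> Y \<Longrightarrow> vol E X \<le> vol E Y"
  unfolding vol_def by (intro sum_mono2) auto

lemma vol_insert: "finite X \<Longrightarrow> v \<notin> X \<Longrightarrow> vol E (insert v X) = vol E X + 1 + card (nb E v)"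
  by (simp add: vol_def)

lemma image_fun_upd_lessThan:
  "(f(k := y)) ` {..<Suc k} = insert y (f ` {..<k :: nat})"
  by (auto simp: lessThan_Suc)

lemma inj_on_fun_upd_lessThan:
  "inj_on f {..<k :: nat} \<Longrightarrow> y \<notin> f ` {..<k} \<Longrightarrow> inj_on (f(k := y)) {..<Suc k}"
  by (auto simp: lessThan_Suc inj_on_def)

definition eq_test :: "aexp \<Rightarrow> aexp \<Rightarrow> bexp" where
  "eq_test a b = And (Not (Less a b)) (Not (Less b a))"

lemma bval_eq_test [simp]: "bval (eq_test a b) s \<longleftrightarrow> aval a s = aval b s"
  by (auto simp: eq_test_def)

section \<open>Searching a component\<close>

text \<open>Breadth-first search. A positive \<open>mark\<close> means both that a vertex belongs to
  the searched set and that it has not been found yet; erasing the mark on entry to the queue makes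
  each vertex enter once. At the end \<open>t\<close> is the size of the component.\<close>

definition visit :: com where
  "visit = Cond (Less (Lit 0) (Read ''mark'' (Var ''w'')))
     (Seq (Store ''mark'' (Var ''w'') (Lit 0))
       (Seq (Store ''q'' (Var ''t'') (Var ''w'')) (Assign ''t'' (Add (Var ''t'') (Lit 1)))))
     Skip"

definition flood :: com where
  "flood = Seq (Store ''mark'' (Var ''r'') (Lit 0))
     (Seq (Store ''q'' (Lit 0) (Var ''r''))
       (Seq (Assign ''h'' (Lit 0))
         (Seq (Assign ''t'' (Lit 1))
           (While (Less (Var ''h'') (Var ''t''))
             (Seq (Assign ''u'' (Read ''q'' (Var ''h'')))
               (Seq (Assign ''h'' (Add (Var ''h'') (Lit 1))) (nbr_loop visit)))))))"

lemma vars_visit [simp]: "svars visit = {''t''}" "avars visit = {''mark'', ''q''}"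
  by (auto simp: visit_def)

lemma vars_flood [simp]:
  "svars flood = {''h'', ''t'', ''u'', ''j'', ''e'', ''w''}" "avars flood = {''mark'', ''q''}"
  by (auto simp: flood_def)

definition queued :: "state \<Rightarrow> nat set" where
  "queued s = arr s ''q'' ` {..<scal s ''t''}"

definition flooding :: "nat set \<Rightarrow> nat \<Rightarrow> (nat \<Rightarrow> nat) \<Rightarrow> state \<Rightarrow> bool" where
  "flooding C x m s \<longleftrightarrow> inj_on (arr s ''q'') {..<scal s ''t''} \<and> x \<in> queued s \<and> queued s \<subseteq> C \<and>
     arr s ''mark'' = (\<lambda>y. if y \<in> queued s then 0 else m y)"

lemma flooding_upd [simp]:
  "x' \<noteq> ''t'' \<Longrightarrow> queued (s\<lparr>scal := (scal s)(x' := k)\<rparr>) = queued s"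
  "x' \<noteq> ''t'' \<Longrightarrow> flooding C x m (s\<lparr>scal := (scal s)(x' := k)\<rparr>) = flooding C x m s"
  by (simp_all add: flooding_def queued_def)

lemma queued_mono:
  assumes "scal s ''t'' \<le> scal s' ''t''" "\<forall>i < scal s ''t''. arr s' ''q'' i = arr s ''q'' i"
  shows "queued s \<subseteq> queued s'"
proof
  fix y assume "y \<in> queued s"
  then obtain i where i: "i < scal s ''t''" "y = arr s ''q'' i" by (auto simp: queued_def)
  then have "y = arr s' ''q'' i" "i < scal s' ''t''" using assms by auto
  then show "y \<in> queued s'" by (simp add: queued_def)
qed

context stored_graph
begin

lemma visit_step:
  assumes fl: "flooding C x m s" and C: "C \<subseteq> {..<n}"
    and y: "scal s ''w'' = y" "y < n" "0 < m y \<Longrightarrow> y \<in> C"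
  shows "wp W visit s a (\<lambda>s' a'. flooding C x m s' \<and> (0 < m y \<longrightarrow> y \<in> queued s') \<and>
    scal s ''t'' \<le> scal s' ''t'' \<and> (\<forall>i < scal s ''t''. arr s' ''q'' i = arr s ''q'' i) \<and> a' \<le> a + 4)"
proof (cases "0 < arr s ''mark'' y")
  case True
  let ?t = "scal s ''t''" and ?q = "arr s ''q''"
  have yQ: "y \<notin> queued s" "0 < m y" using True fl by (auto simp: flooding_def split: if_splits)
  let ?s = "s\<lparr>arr := (arr s)(''mark'' := (arr s ''mark'')(y := 0), ''q'' := ?q(?t := y)),
    scal := (scal s)(''t'' := Suc ?t)\<rparr>"
  have Q: "queued ?s = insert y (queued s)"
  proof -
    have "arr ?s ''q'' = ?q(?t := y)" "scal ?s ''t'' = Suc ?t" by simp_all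
    then show ?thesis unfolding queued_def by (simp only: image_fun_upd_lessThan)
  qed
  have inj: "inj_on (?q(?t := y)) {..<Suc ?t}"
    using fl yQ unfolding flooding_def queued_def by (intro inj_on_fun_upd_lessThan) auto
  \<comment> \<open>Queue entries are distinct vertices, so the tail never passes \<open>n\<close>
    and fits into a word.\<close>
  have "?t = card (queued s)" using fl by (simp add: flooding_def queued_def card_image)
  also have "\<dots> \<le> card {..<n}" using fl C by (intro card_mono) (auto simp: flooding_def)
  finally have t: "?t \<le> n" by simp
  have "flooding C x m ?s"
    unfolding flooding_def Q using fl inj y yQ by (auto simp: flooding_def)
  then show ?thesis using True y t W Q unfolding visit_def by (simp add: fun_upd_twist)
next
  case False
  then have "y \<in> queued s" if "0 < m y" using that fl by (auto simp: flooding_def split: if_splits)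
  then show ?thesis using False y fl unfolding visit_def by simp
qed

text \<open>All marked neighbours of vertices before the head are already queued. When head and tail
  meet, the queued set is closed in \<open>A\<close>, contains \<open>x\<close> and lies in its
  component, so it is the component.\<close>

lemma wp_flood:
  assumes s: "stores_graph n E s" and x: "scal s ''r'' = x" "x \<in> A"
    and A: "A = {y. y < n \<and> 0 < arr s ''mark'' y}"
  shows "wp W flood s a (\<lambda>s' a'.
    arr s' ''mark'' = (\<lambda>y. if y \<in> component E A x then 0 else arr s ''mark'' y) \<and>
    scal s' ''t'' = card (component E A x) \<and> a' \<le> a + 10 + 10 * vol E (component E A x))"
proof -
  let ?C = "component E A x" and ?m = "arr s ''mark''"
  have CA: "?C \<subseteq> A" by (rule component_subset[OF x(2)])
  have Cn: "?C \<subseteq> {..<n}" using CA A by auto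
  have xn: "x < n" using x A by auto
  have finC: "finite ?C" using Cn finite_subset by blast
  note cl = closed_in_component[OF x(2), of E]
  let ?s = "s\<lparr>arr := (arr s)(''mark'' := ?m(x := 0), ''q'' := (arr s ''q'')(0 := x)),
    scal := (scal s)(''h'' := 0, ''t'' := Suc 0)\<rparr>"
  \<comment> \<open>Handling a vertex of degree d takes at most 6 + 7 d units: two assignments, the
    tests, the loop limits, and 7 per list entry. This is rounded up to 10 per unit of volume of the
    vertices already taken from the queue.\<close>
  let ?I = "\<lambda>s1 a1. flooding ?C x ?m s1 \<and> scal s1 ''h'' \<le> scal s1 ''t'' \<and>
    (\<forall>i<scal s1 ''h''. nb E (arr s1 ''q'' i) \<inter> A \<subseteq> queued s1) \<and>
    a1 \<le> a + 4 + 10 * vol E (arr s1 ''q'' ` {..<scal s1 ''h''})"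
  let ?d = "Seq (Assign ''u'' (Read ''q'' (Var ''h'')))
               (Seq (Assign ''h'' (Add (Var ''h'') (Lit 1))) (nbr_loop visit))"
  have tn: "scal s1 ''t'' \<le> n" if "flooding ?C x ?m s1" for s1
  proof -
    have "scal s1 ''t'' = card (queued s1)" using that by (simp add: flooding_def queued_def card_image)
    also have "\<dots> \<le> card {..<n}" using that Cn by (intro card_mono) (auto simp: flooding_def)
    finally show ?thesis by simp
  qed
  have "wp W (While (Less (Var ''h'') (Var ''t'')) ?d) ?s (Suc (Suc (Suc (Suc a))))
    (\<lambda>s' a'. arr s' ''mark'' = (\<lambda>y. if y \<in> ?C then 0 else ?m y) \<and>
      scal s' ''t'' = card ?C \<and> a' \<le> a + 10 + 10 * vol E ?C)"
  proof (rule wp_While[where I = ?I and \<mu> = "\<lambda>s1. n - scal s1 ''h''"])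
    show "?I ?s (Suc (Suc (Suc (Suc a))))" by (auto simp: flooding_def queued_def vol_def lessThan_Suc)
  next
    fix s1 a1
    assume I: "?I s1 a1" and f: "frame ?d ?s s1" and b: "bval (Less (Var ''h'') (Var ''t'')) s1"
    let ?h = "scal s1 ''h''" and ?q = "arr s1 ''q''"
    let ?v = "?q ?h"
    let ?s1 = "s1\<lparr>scal := (scal s1)(''u'' := ?v, ''h'' := Suc ?h)\<rparr>"
    have h: "?h < scal s1 ''t''" using b by simp
    have fl: "flooding ?C x ?m s1" using I by blast
    have hn: "?h < n" using h tn[OF fl] by simp
    have vC: "?v \<in> ?C" using fl h by (auto simp: flooding_def queued_def)
    have vn: "?v < n" using vC Cn by auto
    have sg: "stores_graph n E ?s1"
      using s frame_scal[OF f, of "''n''"] frame_arr[OF f, of "''off''"] frame_arr[OF f, of "''nbr''"]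
      by (simp add: stores_graph_def)
    let ?J = "\<lambda>D s2 a2. flooding ?C x ?m s2 \<and> scal s1 ''t'' \<le> scal s2 ''t'' \<and>
      (\<forall>i < scal s1 ''t''. arr s2 ''q'' i = ?q i) \<and> D \<inter> A \<subseteq> queued s2 \<and> a2 \<le> a1 + 5 + 7 * card D"
    have "wp W (nbr_loop visit) ?s1 (a1 + 3) (\<lambda>s2 a2. ?I s2 a2 \<and> n - scal s2 ''h'' < n - ?h)"
    proof (rule wp_nbr_loop[OF sg, where I = ?J and v = ?v])
      show "?J {} ?s1 (a1 + 3 + 2)" using fl by (simp add: flooding_def queued_def)
    next
      fix D y s2 a2
      assume D: "D \<subseteq> nb E ?v" "y \<in> nb E ?v" "y \<notin> D" and w: "scal s2 ''w'' = y" and J: "?J D s2 a2"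
      have yn: "y < n" using nb_less D by blast
      have yC: "y \<in> ?C" if "0 < ?m y"
        using closed_inD[OF cl vC, of y] that A yn D(2) by (auto simp: nb_def)
      have cD: "card (insert y D) = Suc (card D)"
        using D finite_subset[OF D(1)] by simp
      show "wp W visit s2 (a2 + 2) (\<lambda>s3 a3. ?J (insert y D) s3 (a3 + 1))"
      proof (rule wp_conseq)
        show "wp W visit s2 (a2 + 2) (\<lambda>s' a'. flooding ?C x ?m s' \<and> (0 < ?m y \<longrightarrow> y \<in> queued s') \<and>
          scal s2 ''t'' \<le> scal s' ''t'' \<and> (\<forall>i < scal s2 ''t''. arr s' ''q'' i = arr s2 ''q'' i) \<and>
          a' \<le> (a2 + 2) + 4)"
          by (rule visit_step[OF conjunct1[OF J] Cn w yn yC])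
      next
        fix s3 a3
        assume 3: "flooding ?C x ?m s3 \<and> (0 < ?m y \<longrightarrow> y \<in> queued s3) \<and>
          scal s2 ''t'' \<le> scal s3 ''t'' \<and> (\<forall>i < scal s2 ''t''. arr s3 ''q'' i = arr s2 ''q'' i) \<and>
          a3 \<le> (a2 + 2) + 4"
        have "queued s2 \<subseteq> queued s3" using 3 by (intro queued_mono) blast+
        moreover have "D \<inter> A \<subseteq> queued s2" using J by blast
        moreover have "y \<in> queued s3" if "y \<in> A" using that 3 A by simp
        ultimately have "insert y D \<inter> A \<subseteq> queued s3" by blast
        then show "?J (insert y D) s3 (a3 + 1)" using J 3 cD by simp
      qed
    next
      fix s2 a2
      assume f2: "frame (nbr_loop visit) ?s1 s2" and J: "?J (nb E ?v) s2 a2"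
      have h2: "scal s2 ''h'' = Suc ?h" using frame_scal[OF f2, of "''h''"] by simp
      have q2: "arr s2 ''q'' i = ?q i" if "i < Suc ?h" for i using that h J by simp
      have sub: "queued s1 \<subseteq> queued s2" using J by (intro queued_mono) blast+
      have "nb E (arr s2 ''q'' i) \<inter> A \<subseteq> queued s2" if "i < Suc ?h" for i
      proof (cases "i = ?h")
        case True
        then show ?thesis using J q2[OF that] by simp
      next
        case False
        then have "nb E (?q i) \<inter> A \<subseteq> queued s1" using I that by simp
        then show ?thesis using sub q2[OF that] by auto
      qed
      moreover have "arr s2 ''q'' ` {..<Suc ?h} = insert ?v (?q ` {..<?h})"
        using q2 by (auto simp: lessThan_Suc)
      moreover have "?v \<notin> ?q ` {..<?h}"
      proof
        assume "?v \<in> ?q ` {..<?h}"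
        then obtain i where "i < ?h" "?q i = ?v" by auto
        then show False using fl h inj_onD[of ?q "{..<scal s1 ''t''}" i ?h] by (auto simp: flooding_def)
      qed
      ultimately show "?I s2 (a2 + 1) \<and> n - scal s2 ''h'' < n - ?h"
        using I J h h2 hn by (simp add: vol_insert)
    qed (use vn in auto)
    then show "wp W ?d s1 (Suc a1) (\<lambda>s2 a2. ?I s2 a2 \<and> n - scal s2 ''h'' < n - ?h)"
      using vn hn W by (simp add: numeral_3_eq_3)
  next
    fix s1 a1
    assume I: "?I s1 a1" and b: "\<not> bval (Less (Var ''h'') (Var ''t'')) s1"
    then have ht: "scal s1 ''h'' = scal s1 ''t''" by simp
    have fl: "flooding ?C x ?m s1" using I by blast
    have "closed_in E A (queued s1)"
      using I ht unfolding closed_in_def queued_def nb_def by auto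
    then have "?C \<subseteq> queued s1" using fl by (intro component_least) (auto simp: flooding_def)
    then have Q: "queued s1 = ?C" using fl by (auto simp: flooding_def)
    then have "arr s1 ''q'' ` {..<scal s1 ''h''} = ?C" by (simp add: ht queued_def)
    moreover have "scal s1 ''t'' = card ?C"
      using fl unfolding Q[symmetric] by (simp add: flooding_def queued_def card_image)
    ultimately show "arr s1 ''mark'' = (\<lambda>y. if y \<in> ?C then 0 else ?m y) \<and>
      scal s1 ''t'' = card ?C \<and> Suc a1 \<le> a + 10 + 10 * vol E ?C"
      using I fl Q by (simp add: flooding_def)
  qed
  then show ?thesis unfolding flood_def using x xn W by (simp add: fun_upd_twist)
qed

end

section \<open>Splitting, sorting and scanning\<close>

definition part_class :: "nat \<Rightarrow> state \<Rightarrow> nat \<Rightarrow> nat set" where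
  "part_class n s l = {y. y < n \<and> arr s ''part'' y = l}"

lemma stored_parts_classes: "stored_parts n s = {part_class n s 1, part_class n s 2, part_class n s 3}"
  by (simp add: stored_parts_def part_class_def)

lemma finite_part_class [simp]: "finite (part_class n s l)"
  by (simp add: part_class_def)

lemma part_class_subset: "part_class n s l \<subseteq> {..<n}"
  by (auto simp: part_class_def)

text \<open>The registers \<open>L\<close>, \<open>A\<close>, \<open>B\<close> hold the labels of the largest, the smallest and the middle part.
  A split takes two vertices \<open>v\<close>, \<open>s\<close> of the part \<open>L\<close>: the component of \<open>s\<close> after the removal of \<open>v\<close>
  keeps the label \<open>L\<close>, the rest of the part gets the label in \<open>i\<close>. Merge, Pull and the
  construction of the initial tripartition all use it.\<close>

definition mark_loop :: com where
  "mark_loop = for_loop ''x''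
     (Cond (And (eq_test (Read ''part'' (Var ''x'')) (Var ''L'')) (Not (eq_test (Var ''x'') (Var ''v''))))
       (Store ''mark'' (Var ''x'') (Lit 1)) (Store ''mark'' (Var ''x'') (Lit 0)))"

text \<open>The flood erases the marks of the component of \<open>s\<close>, so the marks that
  survive are those of the vertices to be relabelled. Only \<open>v\<close> is missing, since it was
  never marked; the final store treats it.\<close>

definition split_part :: com where
  "split_part = Seq mark_loop (Seq (Assign ''r'' (Var ''s'')) (Seq flood
     (Seq (for_loop ''x'' (Cond (Less (Lit 0) (Read ''mark'' (Var ''x'')))
         (Store ''part'' (Var ''x'') (Var ''i'')) Skip))
       (Store ''part'' (Var ''v'') (Var ''i'')))))"

text \<open>Each hit moves the previous one from \<open>v\<close> to \<open>s\<close>. After two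
  hits the initial zeros are gone and the registers hold the last two vertices of the part.\<close>

definition pick :: com where
  "pick = Seq (Assign ''v'' (Lit 0)) (Seq (Assign ''s'' (Lit 0))
     (for_loop ''x'' (Cond (eq_test (Read ''part'' (Var ''x'')) (Var ''L''))
       (Seq (Assign ''s'' (Var ''v'')) (Assign ''v'' (Var ''x''))) Skip)))"

definition swap_if_less :: "string \<Rightarrow> string \<Rightarrow> com" where
  "swap_if_less x y = Cond (Less (Read ''cnt'' (Var x)) (Read ''cnt'' (Var y)))
     (Seq (Assign ''z'' (Var x)) (Seq (Assign x (Var y)) (Assign y (Var ''z'')))) Skip"

definition count_parts :: com where
  "count_parts = Seq (Store ''cnt'' (Lit 1) (Lit 0)) (Seq (Store ''cnt'' (Lit 2) (Lit 0))
     (Seq (Store ''cnt'' (Lit 3) (Lit 0))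
       (for_loop ''x'' (Store ''cnt'' (Read ''part'' (Var ''x''))
         (Add (Read ''cnt'' (Read ''part'' (Var ''x''))) (Lit 1))))))"

definition sort_parts :: com where
  "sort_parts = Seq count_parts
    (Seq (Assign ''L'' (Lit 1)) (Seq (Assign ''A'' (Lit 2)) (Seq (Assign ''B'' (Lit 3))
      (Seq (swap_if_less ''L'' ''A'') (Seq (swap_if_less ''L'' ''B'') (swap_if_less ''B'' ''A''))))))"

definition edge_loop :: "com \<Rightarrow> com" where
  "edge_loop c = for_loop ''u'' (nbr_loop c)"

lemma vars_mark_loop [simp]: "svars mark_loop = {''x''}" "avars mark_loop = {''mark''}"
  by (auto simp: mark_loop_def)

lemma vars_split_part [simp]:
  "svars split_part = {''x'', ''r'', ''h'', ''t'', ''u'', ''j'', ''e'', ''w''}"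
  "avars split_part = {''mark'', ''q'', ''part''}"
  by (auto simp: split_part_def)

lemma vars_pick [simp]: "svars pick = {''v'', ''s'', ''x''}" "avars pick = {}"
  by (auto simp: pick_def)

lemma vars_count_parts [simp]: "svars count_parts = {''x''}" "avars count_parts = {''cnt''}"
  by (auto simp: count_parts_def)

lemma vars_sort_parts [simp]:
  "svars sort_parts = {''x'', ''L'', ''A'', ''B'', ''z''}" "avars sort_parts = {''cnt''}"
  by (auto simp: sort_parts_def swap_if_less_def)

lemma vars_edge_loop [simp]:
  "svars (edge_loop c) = {''u'', ''j'', ''e'', ''w''} \<union> svars c" "avars (edge_loop c) = avars c"
  by (auto simp: edge_loop_def)

section \<open>Correctness and cost of marking, splitting, picking and sorting\<close>

context stored_graph
begin

lemma wp_mark_loop: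
  assumes s: "stores_graph n E s"
  shows "wp W mark_loop s a (\<lambda>s' a'.
    (\<forall>y<n. arr s' ''mark'' y = (if arr s ''part'' y = scal s ''L'' \<and> y \<noteq> scal s ''v'' then 1 else 0)) \<and>
    a' \<le> a + 2 + 4 * n)"
  unfolding mark_loop_def
proof (rule wp_for_loop[where n = n and I = "\<lambda>i s1 a1.
    (\<forall>y<i. arr s1 ''mark'' y = (if arr s ''part'' y = scal s ''L'' \<and> y \<noteq> scal s ''v'' then 1 else 0)) \<and>
    a1 \<le> a + 1 + 4 * i"])
  show "scal s ''n'' = n" using s by (simp add: stores_graph_def)
  show "n \<le> W" using W by simp
next
  fix i s1 a1
  assume i: "i < n" "scal s1 ''x'' = i"
    and f: "frame (for_loop ''x'' (Cond (And (eq_test (Read ''part'' (Var ''x'')) (Var ''L'')) (Not (eq_test (Var ''x'') (Var ''v''))))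
       (Store ''mark'' (Var ''x'') (Lit 1)) (Store ''mark'' (Var ''x'') (Lit 0)))) s s1"
    and I: "(\<forall>y<i. arr s1 ''mark'' y = (if arr s ''part'' y = scal s ''L'' \<and> y \<noteq> scal s ''v'' then 1 else 0)) \<and>
    a1 \<le> a + 1 + 4 * i"
  have "arr s1 ''part'' = arr s ''part''" "scal s1 ''L'' = scal s ''L''" "scal s1 ''v'' = scal s ''v''"
    using frame_arr[OF f, of "''part''"] frame_scal[OF f, of "''L''"] frame_scal[OF f, of "''v''"] by simp_all
  then show "wp W (Cond (And (eq_test (Read ''part'' (Var ''x'')) (Var ''L'')) (Not (eq_test (Var ''x'') (Var ''v''))))
       (Store ''mark'' (Var ''x'') (Lit 1)) (Store ''mark'' (Var ''x'') (Lit 0))) s1 (Suc a1)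
    (\<lambda>s2 a2. (\<forall>y<Suc i. arr s2 ''mark'' y = (if arr s ''part'' y = scal s ''L'' \<and> y \<noteq> scal s ''v'' then 1 else 0)) \<and>
    Suc a2 \<le> a + 1 + 4 * Suc i)"
    using i I W by (auto simp: less_Suc_eq)
qed auto

lemma wp_split_part:
  assumes s: "stores_graph n E s" and L: "scal s ''L'' = L" and v: "scal s ''v'' \<in> part_class n s L"
    and x: "scal s ''s'' \<in> part_class n s L" "scal s ''s'' \<noteq> scal s ''v''" and i: "scal s ''i'' \<le> W"
    and C: "C = component E (part_class n s L - {scal s ''v''}) (scal s ''s'')"
  shows "wp W split_part s a (\<lambda>s' a'.
    (\<forall>y<n. arr s' ''part'' y = (if y \<in> part_class n s L - C then scal s ''i'' else arr s ''part'' y)) \<and>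
    a' \<le> a + 20 + 20 * (n + 2 * card E))"
proof -
  let ?v = "scal s ''v''" and ?x = "scal s ''s''" and ?i = "scal s ''i''"
  let ?X = "part_class n s L - {?v}"
  have xX: "?x \<in> ?X" using x by simp
  have CX: "C \<subseteq> ?X" unfolding C by (rule component_subset[OF xX])
  have vol: "vol E C \<le> n + 2 * card E"
  proof -
    have "C \<subseteq> {..<n}" using CX part_class_subset by blast
    then have "vol E C \<le> vol E {..<n}" by (intro vol_mono) auto
    then show ?thesis using vol_le by simp
  qed
  have vn: "?v < n" "?x < n" using v x by (auto simp: part_class_def)
  show ?thesis unfolding split_part_def wp_Seq
  proof (rule wp_conseq[OF wp_mark_loop[OF s]])
    fix s1 a1
    assume f1: "frame mark_loop s s1" and
      1: "(\<forall>y<n. arr s1 ''mark'' y = (if arr s ''part'' y = scal s ''L'' \<and> y \<noteq> scal s ''v'' then 1 else 0)) \<and>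
        a1 \<le> a + 2 + 4 * n"
    have [simp]: "scal s1 ''s'' = ?x" using frame_scal[OF f1, of "''s''"] by simp
    let ?s1 = "s1\<lparr>scal := (scal s1)(''r'' := ?x)\<rparr>"
    have X: "?X = {y. y < n \<and> 0 < arr ?s1 ''mark'' y}"
      using 1 L by (auto simp: part_class_def split: if_splits)
    have "stores_graph n E s1" by (rule stores_graph_frame[OF s f1]) auto
    then have s1: "stores_graph n E ?s1" by (simp add: stores_graph_def)
    let ?d = "Seq (for_loop ''x'' (Cond (Less (Lit 0) (Read ''mark'' (Var ''x'')))
         (Store ''part'' (Var ''x'') (Var ''i'')) Skip)) (Store ''part'' (Var ''v'') (Var ''i''))"
    let ?R = "\<lambda>s' a'. (\<forall>y<n. arr s' ''part'' y = (if y \<in> part_class n s L - C then ?i else arr s ''part'' y)) \<and>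
      a' \<le> a + 20 + 20 * (n + 2 * card E)"
    have "wp W flood ?s1 (Suc a1) (\<lambda>s2 a2. wp W ?d s2 a2 ?R)"
    proof (rule wp_conseq[OF wp_flood[OF s1 _ xX X]])
      show "scal ?s1 ''r'' = ?x" by simp
    next
      fix s2 a2
      assume f2: "frame flood ?s1 s2" and
        2: "arr s2 ''mark'' = (\<lambda>y. if y \<in> component E ?X ?x then 0 else arr ?s1 ''mark'' y) \<and>
          scal s2 ''t'' = card (component E ?X ?x) \<and> a2 \<le> (Suc a1) + 10 + 10 * vol E (component E ?X ?x)"
      have part: "arr s2 ''part'' = arr s ''part''"
        using frame_arr[OF f2, of "''part''"] frame_arr[OF f1, of "''part''"] by simp
      have iv: "scal s2 ''i'' = ?i" "scal s2 ''v'' = ?v" "scal s2 ''n'' = n"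
        using frame_scal[OF f2, of "''i''"] frame_scal[OF f1, of "''i''"]
          frame_scal[OF f2, of "''v''"] frame_scal[OF f1, of "''v''"]
          frame_scal[OF f2, of "''n''"] frame_scal[OF f1, of "''n''"] s
        by (simp_all add: stores_graph_def)
      have mark: "0 < arr s2 ''mark'' y \<longleftrightarrow> y \<in> ?X - C" if "y < n" for y
        using that 2 X C by auto
      show "wp W ?d s2 a2 ?R" unfolding wp_Seq
      proof (rule wp_for_loop[where n = n and I = "\<lambda>i s3 a3.
          (\<forall>y<n. arr s3 ''part'' y = (if y < i \<and> y \<in> ?X - C then ?i else arr s ''part'' y)) \<and>
          a3 \<le> a2 + 1 + 4 * i"])
        show "scal s2 ''n'' = n" using iv by simp
        show "n \<le> W" using W by simp
      next
        fix k s3 a3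
        assume k: "k < n" "scal s3 ''x'' = k"
        and f: "frame (for_loop ''x'' (Cond (Less (Lit 0) (Read ''mark'' (Var ''x'')))
          (Store ''part'' (Var ''x'') (Var ''i'')) Skip)) s2 s3"
        and I: "(\<forall>y<n. arr s3 ''part'' y = (if y < k \<and> y \<in> ?X - C then ?i else arr s ''part'' y)) \<and>
          a3 \<le> a2 + 1 + 4 * k"
        have m: "arr s3 ''mark'' = arr s2 ''mark''" "scal s3 ''i'' = ?i"
          using frame_arr[OF f, of "''mark''"] frame_scal[OF f, of "''i''"] iv by simp_all
        show "wp W (Cond (Less (Lit 0) (Read ''mark'' (Var ''x''))) (Store ''part'' (Var ''x'') (Var ''i'')) Skip)
           s3 (Suc a3) (\<lambda>s4 a4. (\<forall>y<n. arr s4 ''part'' y =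
              (if y < Suc k \<and> y \<in> ?X - C then ?i else arr s ''part'' y)) \<and> Suc a4 \<le> a2 + 1 + 4 * Suc k)"
        proof (cases "k \<in> ?X - C")
          case True
          then show ?thesis using mark[OF k(1)] m k I W i by (auto simp: less_Suc_eq)
        next
          case False
          then have "\<And>y. (y < Suc k \<and> y \<in> ?X - C) = (y < k \<and> y \<in> ?X - C)" by (auto simp: less_Suc_eq)
          moreover have "\<not> 0 < arr s3 ''mark'' k" using mark[OF k(1)] m False by simp
          ultimately show ?thesis using k(2) I by simp
        qed
      next
        fix s3 a3
        assume f: "frame (for_loop ''x'' (Cond (Less (Lit 0) (Read ''mark'' (Var ''x'')))
          (Store ''part'' (Var ''x'') (Var ''i'')) Skip)) s2 s3"
        and I: "(\<forall>y<n. arr s3 ''part'' y = (if y < n \<and> y \<in> ?X - C then ?i else arr s ''part'' y)) \<and>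
          a3 \<le> a2 + 1 + 4 * n"
        have m: "scal s3 ''v'' = ?v" "scal s3 ''i'' = ?i"
          using frame_scal[OF f, of "''v''"] frame_scal[OF f, of "''i''"] iv by simp_all
        have "?v \<notin> C" using CX by blast
        then have "(\<forall>y<n. ((arr s3 ''part'')(?v := ?i)) y =
            (if y \<in> part_class n s L - C then ?i else arr s ''part'' y))"
          using I v by auto
        moreover have "Suc (Suc a3) \<le> a + 20 + 20 * (n + 2 * card E)"
        proof -
          have "a2 \<le> Suc a1 + 10 + 10 * vol E C" using 2 unfolding C by simp
          moreover have "a3 \<le> a2 + 1 + 4 * n" using I by simp
          moreover have "a1 \<le> a + 2 + 4 * n" using 1 by simp
          ultimately show ?thesis using vol by simp
        qed
        ultimately show "wp W (Store ''part'' (Var ''v'') (Var ''i'')) s3 (Suc a3) ?R"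
          using m vn i W by simp
      qed (use part in auto)
    qed
    then show "wp W (Assign ''r'' (Var ''s'')) s1 a1 (\<lambda>s' a'. wp W flood s' a' (\<lambda>s2 a2. wp W (for_loop ''x'' (Cond (Less (Lit 0) (Read ''mark'' (Var ''x'')))
         (Store ''part'' (Var ''x'') (Var ''i'')) Skip)) s2 a2 (\<lambda>s' a'. wp W (Store ''part'' (Var ''v'') (Var ''i'')) s' a' ?R)))"
      using vn W by simp
  qed
qed

lemma wp_pick:
  assumes s: "stores_graph n E s" and big: "2 \<le> card (part_class n s (scal s ''L''))"
  shows "wp W pick s a (\<lambda>s' a'. scal s' ''v'' \<in> part_class n s (scal s ''L'') \<and>
    scal s' ''s'' \<in> part_class n s (scal s ''L'') \<and> scal s' ''s'' \<noteq> scal s' ''v'' \<and> a' \<le> a + 10 + 5 * n)"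
proof -
  let ?L = "scal s ''L''"
  let ?X = "\<lambda>i. {y. y < i \<and> arr s ''part'' y = ?L}"
  let ?s = "s\<lparr>scal := (scal s)(''v'' := 0, ''s'' := 0)\<rparr>"
  let ?c = "Cond (eq_test (Read ''part'' (Var ''x'')) (Var ''L''))
       (Seq (Assign ''s'' (Var ''v'')) (Assign ''v'' (Var ''x''))) Skip"
  have "wp W (for_loop ''x'' ?c) ?s (a + 2) (\<lambda>s' a'. scal s' ''v'' \<in> part_class n s ?L \<and>
    scal s' ''s'' \<in> part_class n s ?L \<and> scal s' ''s'' \<noteq> scal s' ''v'' \<and> a' \<le> a + 10 + 5 * n)"
  proof (rule wp_for_loop[where n = n and I = "\<lambda>i s1 a1. scal s1 ''v'' \<le> n \<and>
      (?X i \<noteq> {} \<longrightarrow> scal s1 ''v'' \<in> ?X i) \<and>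
      (2 \<le> card (?X i) \<longrightarrow> scal s1 ''s'' \<in> ?X i \<and> scal s1 ''s'' \<noteq> scal s1 ''v'') \<and> a1 \<le> a + 3 + 5 * i"])
    show "scal ?s ''n'' = n" using s by (simp add: stores_graph_def)
    show "n \<le> W" using W by simp
  next
    fix i s1 a1
    assume i: "i < n" "scal s1 ''x'' = i" and f: "frame (for_loop ''x'' ?c) ?s s1"
      and I: "scal s1 ''v'' \<le> n \<and>
      (?X i \<noteq> {} \<longrightarrow> scal s1 ''v'' \<in> ?X i) \<and>
      (2 \<le> card (?X i) \<longrightarrow> scal s1 ''s'' \<in> ?X i \<and> scal s1 ''s'' \<noteq> scal s1 ''v'') \<and> a1 \<le> a + 3 + 5 * i"
    have m: "arr s1 ''part'' = arr s ''part''" "scal s1 ''L'' = ?L"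
      using frame_arr[OF f, of "''part''"] frame_scal[OF f, of "''L''"] by simp_all
    show "wp W ?c s1 (Suc a1) (\<lambda>s1 a1. scal s1 ''v'' \<le> n \<and>
      (?X (Suc i) \<noteq> {} \<longrightarrow> scal s1 ''v'' \<in> ?X (Suc i)) \<and>
      (2 \<le> card (?X (Suc i)) \<longrightarrow> scal s1 ''s'' \<in> ?X (Suc i) \<and> scal s1 ''s'' \<noteq> scal s1 ''v'') \<and>
      Suc a1 \<le> a + 3 + 5 * Suc i)"
    proof (cases "arr s ''part'' i = ?L")
      case True
      then have X: "?X (Suc i) = insert i (?X i)" by (auto simp: less_Suc_eq)
      have "scal s1 ''v'' \<in> ?X i" if "2 \<le> card (?X (Suc i))"
      proof -
        have "?X i \<noteq> {}"
        proof
          assume "?X i = {}"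
          then show False using that unfolding X by (simp only: card.insert card.empty) simp
        qed
        then show ?thesis using I by blast
      qed
      then have "2 \<le> card (?X (Suc i)) \<longrightarrow> scal s1 ''v'' < i \<and> arr s ''part'' (scal s1 ''v'') = ?L" by blast
      then show ?thesis using True i m I W by auto
    next
      case False
      then have "?X (Suc i) = ?X i" by (auto simp: less_Suc_eq)
      then show ?thesis using False i m I by simp
    qed
  next
    fix s1 a1
    assume I: "scal s1 ''v'' \<le> n \<and>
      (?X n \<noteq> {} \<longrightarrow> scal s1 ''v'' \<in> ?X n) \<and>
      (2 \<le> card (?X n) \<longrightarrow> scal s1 ''s'' \<in> ?X n \<and> scal s1 ''s'' \<noteq> scal s1 ''v'') \<and> a1 \<le> a + 3 + 5 * n"
    have X: "?X n = part_class n s ?L" by (simp add: part_class_def)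
    have "part_class n s ?L \<noteq> {}" using big by auto
    then show "scal s1 ''v'' \<in> part_class n s ?L \<and>
      scal s1 ''s'' \<in> part_class n s ?L \<and> scal s1 ''s'' \<noteq> scal s1 ''v'' \<and> Suc a1 \<le> a + 10 + 5 * n"
      using I big unfolding X by simp
  qed (auto simp: conj_imp_eq_imp_imp)
  then show ?thesis unfolding pick_def by (simp add: numeral_2_eq_2)
qed

lemma wp_count_parts:
  assumes s: "stores_graph n E s" and p: "\<And>y. y < n \<Longrightarrow> arr s ''part'' y \<in> {1, 2, 3}"
  shows "wp W count_parts s a (\<lambda>s' a'.
    (\<forall>l\<in>{1, 2, 3}. arr s' ''cnt'' l = card (part_class n s l)) \<and> a' \<le> a + 10 + 5 * n)"
proof -
  let ?c = "Store ''cnt'' (Read ''part'' (Var ''x''))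
         (Add (Read ''cnt'' (Read ''part'' (Var ''x''))) (Lit 1))"
  let ?s = "s\<lparr>arr := (arr s)(''cnt'' := (arr s ''cnt'')(1 := 0, 2 := 0, 3 := 0))\<rparr>"
  let ?X = "\<lambda>i l. {y. y < i \<and> arr s ''part'' y = l}"
  have "wp W (for_loop ''x'' ?c) ?s (Suc (Suc (Suc a))) (\<lambda>s' a'.
    (\<forall>l\<in>{1, 2, 3}. arr s' ''cnt'' l = card (part_class n s l)) \<and> a' \<le> a + 10 + 5 * n)"
  proof (rule wp_for_loop[where n = n and I = "\<lambda>i s1 a1.
      (\<forall>l\<in>{1, 2, 3}. arr s1 ''cnt'' l = card (?X i l)) \<and> a1 \<le> a + 5 + 5 * i"])
    show "scal ?s ''n'' = n" using s by (simp add: stores_graph_def)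
    show "n \<le> W" using W by simp
  next
    fix i s1 a1
    assume i: "i < n" "scal s1 ''x'' = i" and f: "frame (for_loop ''x'' ?c) ?s s1"
      and I: "(\<forall>l\<in>{1, 2, 3}. arr s1 ''cnt'' l = card (?X i l)) \<and> a1 \<le> a + 5 + 5 * i"
    have m: "arr s1 ''part'' = arr s ''part''"
      using frame_arr[OF f, of "''part''"] by simp
    let ?p = "arr s ''part'' i"
    have X: "card (?X (Suc i) l) = (if l = ?p then Suc (card (?X i l)) else card (?X i l))" for l
    proof (cases "l = ?p")
      case True
      then have "?X (Suc i) l = insert i (?X i l)" by (auto simp: less_Suc_eq)
      then show ?thesis using True by simp
    next
      case False
      then have "?X (Suc i) l = ?X i l" by (auto simp: less_Suc_eq)
      then show ?thesis using False by simp
    qed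
    have "card (?X i ?p) \<le> card {..<i}" by (intro card_mono) auto
    then have "arr s1 ''cnt'' ?p \<le> i" using I p[OF i(1)] by auto
    moreover have "?p \<le> 3" using p[OF i(1)] by auto
    moreover have "((arr s1 ''cnt'')(?p := Suc (arr s1 ''cnt'' ?p))) l = card (?X (Suc i) l)"
      if "l \<in> {1, 2, 3}" for l
    proof -
      have "arr s1 ''cnt'' l = card (?X i l)" using I that by blast
      then show ?thesis unfolding X by (cases "l = ?p") simp_all
    qed
    ultimately show "wp W ?c s1 (Suc a1) (\<lambda>s1 a1.
      (\<forall>l\<in>{1, 2, 3}. arr s1 ''cnt'' l = card (?X (Suc i) l)) \<and> Suc a1 \<le> a + 5 + 5 * Suc i)"
      unfolding wp_Store using i m conjunct2[OF I] W
      by (intro conjI ballI) (simp_all del: insert_iff)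
  next
    fix s1 a1
    assume I: "(\<forall>l\<in>{1, 2, 3}. arr s1 ''cnt'' l = card (?X n l)) \<and> a1 \<le> a + 5 + 5 * n"
    then show "(\<forall>l\<in>{1, 2, 3}. arr s1 ''cnt'' l = card (part_class n s l)) \<and> Suc a1 \<le> a + 10 + 5 * n"
      unfolding part_class_def by auto
  qed auto
  then show ?thesis unfolding count_parts_def using W by (simp add: numeral_eq_Suc)
qed

text \<open>Stated for arbitrary labels in {1, 2, 3} and not for tripartitions: the initialization
  sorts after its first cut, when one class is still empty.\<close>

lemma wp_sort_parts:
  assumes s: "stores_graph n E s" and p: "\<And>y. y < n \<Longrightarrow> arr s ''part'' y \<in> {1, 2, 3}"
  shows "wp W sort_parts s a (\<lambda>s' a'.
    (\<forall>l\<in>{1, 2, 3}. arr s' ''cnt'' l = card (part_class n s l)) \<and>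
    {scal s' ''A'', scal s' ''B'', scal s' ''L''} = {1, 2, 3} \<and>
    card (part_class n s (scal s' ''A'')) \<le> card (part_class n s (scal s' ''B'')) \<and>
    card (part_class n s (scal s' ''B'')) \<le> card (part_class n s (scal s' ''L'')) \<and>
    a' \<le> a + 30 + 5 * n)"
  unfolding sort_parts_def wp_Seq
proof (rule wp_conseq[OF wp_count_parts[OF s p]])
  fix s1 :: state and a1
  assume 1: "(\<forall>l\<in>{1, 2, 3}. arr s1 ''cnt'' l = card (part_class n s l)) \<and> a1 \<le> a + 10 + 5 * n"
  have W3: "3 \<le> W" using W by simp
  then have W2: "2 \<le> W" "1 \<le> W" "Suc 0 \<le> W" by simp_all
  have c: "arr s1 ''cnt'' (Suc 0) = card (part_class n s (Suc 0))"
    "arr s1 ''cnt'' 2 = card (part_class n s 2)" "arr s1 ''cnt'' 3 = card (part_class n s 3)"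
    using 1 by auto
  show "wp W (Assign ''L'' (Lit 1)) s1 a1 (\<lambda>s' a'. wp W (Assign ''A'' (Lit 2)) s' a'
    (\<lambda>s' a'. wp W (Assign ''B'' (Lit 3)) s' a' (\<lambda>s' a'. wp W (swap_if_less ''L'' ''A'') s' a'
    (\<lambda>s' a'. wp W (swap_if_less ''L'' ''B'') s' a' (\<lambda>s' a'. wp W (swap_if_less ''B'' ''A'') s' a'
    (\<lambda>s' a'.
    (\<forall>l\<in>{1, 2, 3}. arr s' ''cnt'' l = card (part_class n s l)) \<and>
    {scal s' ''A'', scal s' ''B'', scal s' ''L''} = {1, 2, 3} \<and>
    card (part_class n s (scal s' ''A'')) \<le> card (part_class n s (scal s' ''B'')) \<and>
    card (part_class n s (scal s' ''B'')) \<le> card (part_class n s (scal s' ''L'')) \<and>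
    a' \<le> a + 30 + 5 * n))))))"
    using 1 W3 W2 by (auto simp: swap_if_less_def c)
qed

text \<open>The invariant is indexed by the set of ordered pairs scanned so far; every edge is met
  in both directions, so the body may test endpoints asymmetrically. Loop control costs 5 per vertex
  and 3 per pair on top of \<open>k\<close>, which \<open>k + 5\<close> per unit of volume
  covers.\<close>

lemma wp_edge_loop:
  assumes s: "stores_graph n E s"
    and nomod: "{''u'', ''n'', ''j'', ''e''} \<inter> svars c = {}" "{''off'', ''nbr''} \<inter> avars c = {}"
    and indep: "\<And>D s k x. x \<in> {''u'', ''j'', ''e'', ''w''} \<Longrightarrow> I D s \<Longrightarrow>
      I D (s\<lparr>scal := (scal s)(x := k)\<rparr>)"
    and start: "I {} s"
    and step: "\<And>D u w s1 a1. w \<in> nb E u \<Longrightarrow> scal s1 ''u'' = u \<Longrightarrow> scal s1 ''w'' = w \<Longrightarrow>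
      frame (edge_loop c) s s1 \<Longrightarrow> I D s1 \<Longrightarrow>
      wp W c s1 a1 (\<lambda>s2 a2. I (insert (u, w) D) s2 \<and> a2 \<le> a1 + k)"
    and post: "\<And>s1 a1. frame (edge_loop c) s s1 \<Longrightarrow> I {(u, w). w \<in> nb E u} s1 \<Longrightarrow>
      a1 \<le> a + 2 + (k + 5) * (n + 2 * card E) \<Longrightarrow> Q s1 a1"
  shows "wp W (edge_loop c) s a Q"
  unfolding edge_loop_def
proof (rule wp_for_loop[where n = n and I = "\<lambda>i s1 a1. I {(u, w). u < i \<and> w \<in> nb E u} s1 \<and>
    a1 \<le> a + 1 + (k + 5) * vol E {..<i}"])
  show "scal s ''n'' = n" using s by (simp add: stores_graph_def)
  show "n \<le> W" using W by simp
next
  fix i s1 a1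
  assume i: "i < n" "scal s1 ''u'' = i" and f: "frame (for_loop ''u'' (nbr_loop c)) s s1"
    and I: "I {(u, w). u < i \<and> w \<in> nb E u} s1 \<and> a1 \<le> a + 1 + (k + 5) * vol E {..<i}"
  have s1: "stores_graph n E s1" using nomod by (intro stores_graph_frame[OF s f]) auto
  let ?D = "{(u, w). u < i \<and> w \<in> nb E u}"
  show "wp W (nbr_loop c) s1 (Suc a1) (\<lambda>s2 a2. I {(u, w). u < Suc i \<and> w \<in> nb E u} s2 \<and>
    Suc a2 \<le> a + 1 + (k + 5) * vol E {..<Suc i})"
  proof (rule wp_nbr_loop[OF s1 i(2,1), where I = "\<lambda>D s2 a2. I (?D \<union> {i} \<times> D) s2 \<and>
      a2 \<le> a1 + 3 + (k + 3) * card D"])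
    show "I (?D \<union> {i} \<times> {}) s1 \<and> Suc a1 + 2 \<le> a1 + 3 + (k + 3) * card {}" using I by simp
  next
    fix D y s2 a2
    assume D: "D \<subseteq> nb E i" "y \<in> nb E i" "y \<notin> D" and w: "scal s2 ''w'' = y"
      and f2: "frame (nbr_loop c) s1 s2" and J: "I (?D \<union> {i} \<times> D) s2 \<and> a2 \<le> a1 + 3 + (k + 3) * card D"
    have u: "scal s2 ''u'' = i" using frame_scal[OF f2, of "''u''"] nomod i by simp
    have fe: "frame (edge_loop c) s s2" unfolding edge_loop_def
      by (rule frame_trans(2)[OF f f2]) auto
    have cD: "card (insert y D) = Suc (card D)" using D finite_subset[OF D(1)] by simp
    have ins: "insert (i, y) (?D \<union> {i} \<times> D) = ?D \<union> {i} \<times> insert y D" by auto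
    show "wp W c s2 (a2 + 2) (\<lambda>s3 a3. I (?D \<union> {i} \<times> insert y D) s3 \<and>
      a3 + 1 \<le> a1 + 3 + (k + 3) * card (insert y D))"
    proof (rule wp_conseq[OF step[OF D(2) u w fe conjunct1[OF J]]])
      fix s3 a3
      assume 3: "I (insert (i, y) (?D \<union> {i} \<times> D)) s3 \<and> a3 \<le> a2 + 2 + k"
      have "a3 + 1 \<le> a1 + 3 + (k + 3) * card (insert y D)" using 3 J by (simp add: cD)
      then show "I (?D \<union> {i} \<times> insert y D) s3 \<and> a3 + 1 \<le> a1 + 3 + (k + 3) * card (insert y D)"
        using 3 unfolding ins by blast
    qed
  next
    fix s2 a2
    assume J: "I (?D \<union> {i} \<times> nb E i) s2 \<and> a2 \<le> a1 + 3 + (k + 3) * card (nb E i)"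
    have D: "?D \<union> {i} \<times> nb E i = {(u, w). u < Suc i \<and> w \<in> nb E u}" by (auto simp: less_Suc_eq)
    have "vol E {..<Suc i} = vol E {..<i} + (1 + card (nb E i))"
      by (simp add: lessThan_Suc vol_insert)
    then have "(k + 5) * vol E {..<Suc i} = (k + 5) * vol E {..<i} + (k + 5) + (k + 5) * card (nb E i)"
      by (simp only: distrib_left mult_1_right add.assoc)
    moreover have "(k + 3) * card (nb E i) \<le> (k + 5) * card (nb E i)" by simp
    ultimately have "Suc (a2 + 1) \<le> a + 1 + (k + 5) * vol E {..<Suc i}"
      using conjunct2[OF I] conjunct2[OF J] by linarith
    then show "I {(u, w). u < Suc i \<and> w \<in> nb E u} s2 \<and>
        Suc (a2 + 1) \<le> a + 1 + (k + 5) * vol E {..<Suc i}"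
      using conjunct1[OF J] unfolding D by blast
  qed (use nomod indep in auto)
next
  fix s1 a1
  assume f: "frame (for_loop ''u'' (nbr_loop c)) s s1"
    and I: "I {(u, w). u < n \<and> w \<in> nb E u} s1 \<and> a1 \<le> a + 1 + (k + 5) * vol E {..<n}"
  have "{(u, w). u < n \<and> w \<in> nb E u} = {(u, w). w \<in> nb E u}" using nb_less by auto
  then have "I {(u, w). w \<in> nb E u} s1" using I by simp
  moreover have "(k + 5) * vol E {..<n} \<le> (k + 5) * (n + 2 * card E)" using vol_le by (rule mult_le_mono2)
  then have "Suc a1 \<le> a + 2 + (k + 5) * (n + 2 * card E)" using conjunct2[OF I] by linarith
  ultimately show "Q s1 (Suc a1)" using f by (intro post) (simp_all add: edge_loop_def)
qed (use nomod indep start in \<open>auto simp: vol_def\<close>)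

end

section \<open>Scans that look for a step\<close>

definition find_contact :: com where
  "find_contact = Seq (Assign ''m'' (Lit 0)) (Seq (Assign ''v'' (Lit 0)) (edge_loop
    (Cond (And (eq_test (Read ''part'' (Var ''u'')) (Var ''A'')) (eq_test (Read ''part'' (Var ''w'')) (Var ''B'')))
      (Assign ''m'' (Lit 1))
      (Cond (And (eq_test (Read ''part'' (Var ''u'')) (Var ''L'')) (eq_test (Read ''part'' (Var ''w'')) (Var ''A'')))
        (Assign ''v'' (Var ''u'')) Skip))))"

text \<open>The old cut vertex goes to \<open>s\<close> and has two uses there: it is excluded from
  the scan, and it is the root of the component to be kept when the largest part is cut at the new
  \<open>v\<close>. A hit thus leaves exactly the data that \<open>split_part\<close>
  expects.\<close>

definition find_exit :: com where
  "find_exit = Seq (Assign ''s'' (Var ''v'')) (edge_loop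
    (Cond (And (And (eq_test (Read ''part'' (Var ''u'')) (Var ''L'')) (Not (eq_test (Var ''u'') (Var ''s''))))
        (Not (eq_test (Read ''part'' (Var ''w'')) (Var ''L''))))
      (Seq (Assign ''v'' (Var ''u'')) (Seq (Assign ''i'' (Read ''part'' (Var ''w''))) (Assign ''f'' (Lit 1))))
      Skip))"

text \<open>A flood starts at every vertex still marked, that is, once per component. The scan goes
  on after a hit, so \<open>s\<close> ends up as the root of the last large component.\<close>

definition find_piece :: com where
  "find_piece = Seq (Assign ''f'' (Lit 0)) (Seq mark_loop (for_loop ''y''
    (Cond (Less (Lit 0) (Read ''mark'' (Var ''y'')))
      (Seq (Assign ''r'' (Var ''y'')) (Seq flood
        (Cond (Less (Read ''cnt'' (Var ''A'')) (Var ''t''))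
          (Seq (Assign ''s'' (Var ''y'')) (Assign ''f'' (Lit 1))) Skip)))
      Skip)))"

lemma vars_find_contact [simp]:
  "svars find_contact = {''m'', ''v'', ''u'', ''j'', ''e'', ''w''}" "avars find_contact = {}"
  by (auto simp: find_contact_def)

lemma vars_find_exit [simp]:
  "svars find_exit = {''s'', ''v'', ''i'', ''f'', ''u'', ''j'', ''e'', ''w''}" "avars find_exit = {}"
  by (auto simp: find_exit_def)

lemma vars_find_piece [simp]:
  "svars find_piece = {''f'', ''s'', ''r'', ''x'', ''y'', ''h'', ''t'', ''u'', ''j'', ''e'', ''w''}"
  "avars find_piece = {''mark'', ''q''}"
  by (auto simp: find_piece_def)

context stored_graph
begin

text \<open>One scan settles whether a Merge is possible and provides the cut vertex for the other
  case. By \<open>A \<noteq> L\<close> the two tests exclude each other, so the first branch never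
  hides a contact of the largest part.\<close>

lemma wp_find_contact:
  assumes s: "stores_graph n E s" and AL: "scal s ''A'' = A" "scal s ''B'' = B" "scal s ''L'' = L" "A \<noteq> L"
  shows "wp W find_contact s a (\<lambda>s' a'.
    (0 < scal s' ''m'' \<longleftrightarrow> adjacent E (part_class n s A) (part_class n s B)) \<and>
    (adjacent E (part_class n s L) (part_class n s A) \<longrightarrow>
      scal s' ''v'' \<in> part_class n s L \<and> (\<exists>w\<in>part_class n s A. {scal s' ''v'', w} \<in> E)) \<and>
    a' \<le> a + 4 + 10 * (n + 2 * card E))"
proof -
  let ?c = "Cond (And (eq_test (Read ''part'' (Var ''u'')) (Var ''A'')) (eq_test (Read ''part'' (Var ''w'')) (Var ''B'')))
      (Assign ''m'' (Lit 1))
      (Cond (And (eq_test (Read ''part'' (Var ''u'')) (Var ''L'')) (eq_test (Read ''part'' (Var ''w'')) (Var ''A'')))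
        (Assign ''v'' (Var ''u'')) Skip)"
  let ?s = "s\<lparr>scal := (scal s)(''m'' := 0, ''v'' := 0)\<rparr>"
  let ?p = "arr s ''part''"
  let ?I = "\<lambda>D s1. (0 < scal s1 ''m'' \<longleftrightarrow> (\<exists>(u, w)\<in>D. ?p u = A \<and> ?p w = B)) \<and>
    ((\<exists>(u, w)\<in>D. ?p u = L \<and> ?p w = A) \<longrightarrow> ?p (scal s1 ''v'') = L \<and> (\<exists>w\<in>nb E (scal s1 ''v''). ?p w = A))"
  have "wp W (edge_loop ?c) ?s (Suc (Suc a)) (\<lambda>s' a'.
    (0 < scal s' ''m'' \<longleftrightarrow> adjacent E (part_class n s A) (part_class n s B)) \<and>
    (adjacent E (part_class n s L) (part_class n s A) \<longrightarrow>
      scal s' ''v'' \<in> part_class n s L \<and> (\<exists>w\<in>part_class n s A. {scal s' ''v'', w} \<in> E)) \<and>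
    a' \<le> a + 4 + 10 * (n + 2 * card E))"
  proof (rule wp_edge_loop[where I = ?I and k = 3])
    show "stores_graph n E ?s" using s by (simp add: stores_graph_def)
  next
    fix D u w s1 a1
    assume w: "w \<in> nb E u" "scal s1 ''u'' = u" "scal s1 ''w'' = w"
      and f: "frame (edge_loop ?c) ?s s1" and I: "?I D s1"
    have m: "arr s1 ''part'' = ?p" "scal s1 ''A'' = A" "scal s1 ''B'' = B" "scal s1 ''L'' = L"
      using frame_arr[OF f, of "''part''"] frame_scal[OF f, of "''A''"]
        frame_scal[OF f, of "''B''"] frame_scal[OF f, of "''L''"] AL by simp_all
    have "u \<le> W" "1 \<le> W" using nb_less(2)[OF w(1)] W by auto
    then show "wp W ?c s1 a1 (\<lambda>s2 a2. ?I (insert (u, w) D) s2 \<and> a2 \<le> a1 + 3)"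
      using I w m AL(4) by auto
  next
    fix s1 a1
    assume I: "?I {(u, w). w \<in> nb E u} s1" and a: "a1 \<le> Suc (Suc a) + 2 + (3 + 5) * (n + 2 * card E)"
    have adj: "adjacent E (part_class n s X) (part_class n s Y) \<longleftrightarrow>
      (\<exists>(u, w)\<in>{(u, w). w \<in> nb E u}. ?p u = X \<and> ?p w = Y)" for X Y
    proof
      assume "adjacent E (part_class n s X) (part_class n s Y)"
      then show "\<exists>(u, w)\<in>{(u, w). w \<in> nb E u}. ?p u = X \<and> ?p w = Y"
        unfolding adjacent_def part_class_def nb_def by blast
    next
      assume "\<exists>(u, w)\<in>{(u, w). w \<in> nb E u}. ?p u = X \<and> ?p w = Y"
      then obtain u w where uw: "w \<in> nb E u" "?p u = X" "?p w = Y" by blast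
      then have "u \<in> part_class n s X" "w \<in> part_class n s Y" "{u, w} \<in> E"
        using nb_less[OF uw(1)] by (simp_all add: part_class_def nb_def)
      then show "adjacent E (part_class n s X) (part_class n s Y)" unfolding adjacent_def by blast
    qed
    have "v \<in> part_class n s L \<and> (\<exists>w\<in>part_class n s A. {v, w} \<in> E)"
      if pv: "?p v = L" "\<exists>w\<in>nb E v. ?p w = A" for v
    proof -
      obtain w where w: "w \<in> nb E v" "?p w = A" using pv(2) by blast
      have "w \<in> part_class n s A" "{v, w} \<in> E" "v \<in> part_class n s L"
        using w nb_less[OF w(1)] pv(1) by (simp_all add: part_class_def nb_def)
      then show ?thesis by blast
    qed
    then show "(0 < scal s1 ''m'' \<longleftrightarrow> adjacent E (part_class n s A) (part_class n s B)) \<and>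
      (adjacent E (part_class n s L) (part_class n s A) \<longrightarrow>
        scal s1 ''v'' \<in> part_class n s L \<and> (\<exists>w\<in>part_class n s A. {scal s1 ''v'', w} \<in> E)) \<and>
      a1 \<le> a + 4 + 10 * (n + 2 * card E)"
      using I a unfolding adj by simp
  qed auto
  then show ?thesis unfolding find_contact_def by simp
qed

lemma wp_find_exit:
  assumes s: "stores_graph n E s" and p: "\<And>y. y < n \<Longrightarrow> arr s ''part'' y \<le> W"
    and L: "scal s ''L'' = L" and v: "scal s ''v'' = v" "v < n" and f0: "scal s ''f'' = 0"
  shows "wp W find_exit s a (\<lambda>s' a'.
    (scal s' ''f'' = 0 \<longrightarrow> (\<forall>u\<in>part_class n s L. \<forall>w\<in>nb E u. w \<notin> part_class n s L \<longrightarrow> u = v)) \<and>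
    (0 < scal s' ''f'' \<longrightarrow> scal s' ''v'' \<in> part_class n s L \<and> scal s' ''v'' \<noteq> v \<and> scal s' ''s'' = v \<and>
      scal s' ''i'' \<noteq> L \<and> (\<exists>w\<in>part_class n s (scal s' ''i''). {scal s' ''v'', w} \<in> E)) \<and>
    a' \<le> a + 4 + 10 * (n + 2 * card E))"
proof -
  let ?c = "Cond (And (And (eq_test (Read ''part'' (Var ''u'')) (Var ''L'')) (Not (eq_test (Var ''u'') (Var ''s''))))
        (Not (eq_test (Read ''part'' (Var ''w'')) (Var ''L''))))
      (Seq (Assign ''v'' (Var ''u'')) (Seq (Assign ''i'' (Read ''part'' (Var ''w''))) (Assign ''f'' (Lit 1))))
      Skip"
  let ?s = "s\<lparr>scal := (scal s)(''s'' := v)\<rparr>"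
  let ?p = "arr s ''part''"
  let ?I = "\<lambda>D s1. (scal s1 ''f'' = 0 \<longrightarrow> (\<forall>(u, w)\<in>D. ?p u = L \<and> ?p w \<noteq> L \<longrightarrow> u = v)) \<and>
    scal s1 ''s'' = v \<and>
    (0 < scal s1 ''f'' \<longrightarrow> ?p (scal s1 ''v'') = L \<and> scal s1 ''v'' \<noteq> v \<and> scal s1 ''i'' \<noteq> L \<and>
      (\<exists>w\<in>nb E (scal s1 ''v''). ?p w = scal s1 ''i''))"
  have "wp W (edge_loop ?c) ?s (Suc a) (\<lambda>s' a'.
    (scal s' ''f'' = 0 \<longrightarrow> (\<forall>u\<in>part_class n s L. \<forall>w\<in>nb E u. w \<notin> part_class n s L \<longrightarrow> u = v)) \<and>
    (0 < scal s' ''f'' \<longrightarrow> scal s' ''v'' \<in> part_class n s L \<and> scal s' ''v'' \<noteq> v \<and> scal s' ''s'' = v \<and>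
      scal s' ''i'' \<noteq> L \<and> (\<exists>w\<in>part_class n s (scal s' ''i''). {scal s' ''v'', w} \<in> E)) \<and>
    a' \<le> a + 4 + 10 * (n + 2 * card E))"
  proof (rule wp_edge_loop[where I = ?I and k = 4])
    show "stores_graph n E ?s" using s by (simp add: stores_graph_def)
  next
    fix D u w s1 a1
    assume w: "w \<in> nb E u" "scal s1 ''u'' = u" "scal s1 ''w'' = w"
      and f: "frame (edge_loop ?c) ?s s1" and I: "?I D s1"
    have m: "arr s1 ''part'' = ?p" "scal s1 ''L'' = L"
      using frame_arr[OF f, of "''part''"] frame_scal[OF f, of "''L''"] L by simp_all
    have "u \<le> W" "1 \<le> W" "?p w \<le> W" using nb_less(2)[OF w(1)] p[OF nb_less(1)[OF w(1)]] W by auto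
    then show "wp W ?c s1 a1 (\<lambda>s2 a2. ?I (insert (u, w) D) s2 \<and> a2 \<le> a1 + 4)"
      using I w m by auto
  next
    fix s1 a1
    assume I: "?I {(u, w). w \<in> nb E u} s1" and a: "a1 \<le> Suc a + 2 + (4 + 5) * (n + 2 * card E)"
    have 1: "u = v" if "scal s1 ''f'' = 0" "u \<in> part_class n s L" "w \<in> nb E u" "w \<notin> part_class n s L" for u w
      using I that nb_less(1)[OF that(3)] by (auto simp: part_class_def)
    have 2: "scal s1 ''v'' \<in> part_class n s L \<and> (\<exists>w\<in>part_class n s (scal s1 ''i''). {scal s1 ''v'', w} \<in> E)"
      if f: "0 < scal s1 ''f''"
    proof -
      obtain w where w: "w \<in> nb E (scal s1 ''v'')" "?p w = scal s1 ''i''" using I f by blast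
      have "w \<in> part_class n s (scal s1 ''i'')" "{scal s1 ''v'', w} \<in> E" "scal s1 ''v'' \<in> part_class n s L"
        using w nb_less[OF w(1)] I f by (simp_all add: part_class_def nb_def)
      then show ?thesis by blast
    qed
    have "a1 \<le> a + 4 + 10 * (n + 2 * card E)" using a by simp
    then show "(scal s1 ''f'' = 0 \<longrightarrow> (\<forall>u\<in>part_class n s L. \<forall>w\<in>nb E u. w \<notin> part_class n s L \<longrightarrow> u = v)) \<and>
      (0 < scal s1 ''f'' \<longrightarrow> scal s1 ''v'' \<in> part_class n s L \<and> scal s1 ''v'' \<noteq> v \<and> scal s1 ''s'' = v \<and>
        scal s1 ''i'' \<noteq> L \<and> (\<exists>w\<in>part_class n s (scal s1 ''i''). {scal s1 ''v'', w} \<in> E)) \<and>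
      a1 \<le> a + 4 + 10 * (n + 2 * card E)"
      using I 1 2 by blast
  qed (use f0 in auto)
  then show ?thesis unfolding find_exit_def using v W by simp
qed

text \<open>The marked rest \<open>?R\<close> stays a union of components of \<open>X\<close>, so
  each flood measures a true component of \<open>X\<close>. These are disjoint, and the cost of all
  floods is linear in the volume of \<open>X\<close>.\<close>

lemma wp_find_piece:
  assumes s: "stores_graph n E s" and X: "X = part_class n s (scal s ''L'') - {scal s ''v''}"
  shows "wp W find_piece s a (\<lambda>s' a'.
    (scal s' ''f'' = 0 \<longrightarrow> (\<forall>z\<in>X. card (component E X z) \<le> arr s ''cnt'' (scal s ''A''))) \<and>
    (0 < scal s' ''f'' \<longrightarrow> scal s' ''s'' \<in> X \<and>
      arr s ''cnt'' (scal s ''A'') < card (component E X (scal s' ''s''))) \<and>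
    a' \<le> a + 10 + 40 * (n + 2 * card E))"
proof -
  let ?k = "arr s ''cnt'' (scal s ''A'')"
  let ?s = "s\<lparr>scal := (scal s)(''f'' := 0)\<rparr>"
  let ?c = "Cond (Less (Lit 0) (Read ''mark'' (Var ''y'')))
      (Seq (Assign ''r'' (Var ''y'')) (Seq flood
        (Cond (Less (Read ''cnt'' (Var ''A'')) (Var ''t''))
          (Seq (Assign ''s'' (Var ''y'')) (Assign ''f'' (Lit 1))) Skip)))
      Skip"
  let ?Q = "\<lambda>s' a'. (scal s' ''f'' = 0 \<longrightarrow> (\<forall>z\<in>X. card (component E X z) \<le> ?k)) \<and>
    (0 < scal s' ''f'' \<longrightarrow> scal s' ''s'' \<in> X \<and> ?k < card (component E X (scal s' ''s''))) \<and>
    a' \<le> a + 10 + 40 * (n + 2 * card E)"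
  have Xn: "X \<subseteq> {..<n}" unfolding X using part_class_subset by blast
  have finX: "finite X" using Xn finite_subset by blast
  have s0: "stores_graph n E ?s" using s by (simp add: stores_graph_def)
  have "wp W mark_loop ?s (Suc a) (\<lambda>s1 a1. wp W (for_loop ''y'' ?c) s1 a1 ?Q)"
  proof (rule wp_conseq[OF wp_mark_loop[OF s0]])
    fix s1 a1
    assume f1: "frame mark_loop ?s s1" and 1: "(\<forall>y<n. arr s1 ''mark'' y =
      (if arr ?s ''part'' y = scal ?s ''L'' \<and> y \<noteq> scal ?s ''v'' then 1 else 0)) \<and> a1 \<le> Suc a + 2 + 4 * n"
    let ?R = "\<lambda>s2. {y. y < n \<and> 0 < arr s2 ''mark'' y}"
    let ?good = "\<lambda>s2. (scal s2 ''f'' = 0 \<longrightarrow> (\<forall>z\<in>X - ?R s2. card (component E X z) \<le> ?k)) \<and>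
      (0 < scal s2 ''f'' \<longrightarrow> scal s2 ''s'' \<in> X \<and> ?k < card (component E X (scal s2 ''s'')))"
    \<comment> \<open>A flood of \<open>?C\<close> and its bookkeeping take at most 17 + 10 vol(C)
      units. As vol(C) is at least 1, the charge of 30 per unit of erased volume pays for this
      including the constant.\<close>
    let ?I = "\<lambda>i s2 a2. ?good s2 \<and> ?R s2 \<subseteq> X \<and> closed_in E X (?R s2) \<and> (\<forall>y\<in>?R s2. i \<le> y) \<and>
      a2 \<le> a1 + 1 + 4 * i + 30 * vol E (X - ?R s2)"
    have s1: "stores_graph n E s1" by (rule stores_graph_frame[OF s0 f1]) auto
    have R1: "?R s1 = X" using 1 X by (auto simp: part_class_def split: if_splits)
    have k1: "arr s1 ''cnt'' (scal s1 ''A'') = ?k" and f0: "scal s1 ''f'' = 0"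
      using frame_arr[OF f1, of "''cnt''"] frame_scal[OF f1, of "''A''"] frame_scal[OF f1, of "''f''"]
      by simp_all
    show "wp W (for_loop ''y'' ?c) s1 a1 ?Q"
    proof (rule wp_for_loop[where n = n and I = ?I])
      show "scal s1 ''n'' = n" using s1 by (simp add: stores_graph_def)
      show "n \<le> W" using W by simp
      show "?I 0 s1 (Suc a1)" unfolding R1 using f0 by (simp add: closed_in_def)
    next
      fix i s2 a2
      assume i: "i < n" "scal s2 ''y'' = i" and f2: "frame (for_loop ''y'' ?c) s1 s2" and I: "?I i s2 a2"
      have s2: "stores_graph n E s2" by (rule stores_graph_frame[OF s1 f2]) auto
      have k2: "arr s2 ''cnt'' (scal s2 ''A'') = ?k"
        using frame_arr[OF f2, of "''cnt''"] frame_scal[OF f2, of "''A''"] k1 by simp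
      let ?R2 = "?R s2"
      show "wp W ?c s2 (Suc a2) (\<lambda>s3 a3. ?I (Suc i) s3 (Suc a3))"
      proof (cases "0 < arr s2 ''mark'' i")
        case False
        have "\<forall>y\<in>?R2. Suc i \<le> y"
        proof
          fix y assume y: "y \<in> ?R2"
          then have "i \<le> y" using I by blast
          moreover have "y \<noteq> i" using y False by auto
          ultimately show "Suc i \<le> y" by simp
        qed
        then show ?thesis using False i I by simp
      next
        case True
        then have iR: "i \<in> ?R2" using i by simp
        have RX: "?R2 \<subseteq> X" and clR: "closed_in E X ?R2" using I by blast+
        have iX: "i \<in> X" using iR RX by blast
        let ?C = "component E ?R2 i"
        have C: "?C = component E X i" by (rule component_closed_eq[OF clR RX iR])
        have CR: "?C \<subseteq> ?R2" by (rule component_subset[OF iR])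
        have finC: "finite ?C" by (rule finite_subset[OF subset_trans[OF CR RX] finX])
        let ?s2 = "s2\<lparr>scal := (scal s2)(''r'' := i)\<rparr>"
        have s2': "stores_graph n E ?s2" using s2 by (simp add: stores_graph_def)
        have "wp W flood ?s2 (Suc (Suc (Suc a2))) (\<lambda>s3 a3.
          wp W (Cond (Less (Read ''cnt'' (Var ''A'')) (Var ''t''))
            (Seq (Assign ''s'' (Var ''y'')) (Assign ''f'' (Lit 1))) Skip) s3 a3
            (\<lambda>s3 a3. ?I (Suc i) s3 (Suc a3)))"
        proof (rule wp_conseq[OF wp_flood[OF s2' _ iR]])
          show "scal ?s2 ''r'' = i" by simp
          show "?R2 = {y. y < n \<and> 0 < arr ?s2 ''mark'' y}" by simp
        next
          fix s3 a3
          assume f3: "frame flood ?s2 s3" and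
            3: "arr s3 ''mark'' = (\<lambda>y. if y \<in> ?C then 0 else arr ?s2 ''mark'' y) \<and>
              scal s3 ''t'' = card ?C \<and> a3 \<le> Suc (Suc (Suc a2)) + 10 + 10 * vol E ?C"
          have k3: "arr s3 ''cnt'' (scal s3 ''A'') = ?k"
            using frame_arr[OF f3, of "''cnt''"] frame_scal[OF f3, of "''A''"] k2 by simp
          have v3: "scal s3 ''y'' = i" "scal s3 ''f'' = scal s2 ''f''" "scal s3 ''s'' = scal s2 ''s''"
            using frame_scal[OF f3, of "''y''"] frame_scal[OF f3, of "''f''"]
              frame_scal[OF f3, of "''s''"] i by simp_all
          have "arr ?s2 ''mark'' = arr s2 ''mark''" by simp
          then have "arr s3 ''mark'' = (\<lambda>y. if y \<in> ?C then 0 else arr s2 ''mark'' y)"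
            using conjunct1[OF 3] by (simp only:)
          then have R3: "?R s3 = ?R2 - ?C" by (simp only:) auto
          have XR: "X - (?R2 - ?C) = (X - ?R2) \<union> ?C" using CR RX by blast
          have vol: "vol E (X - (?R2 - ?C)) = vol E (X - ?R2) + vol E ?C"
            unfolding XR
          proof (rule vol_Un)
            show "(X - ?R2) \<inter> ?C = {}" using CR by blast
          qed (use finX finC in simp_all)
          have "vol E {i} \<le> vol E ?C" using finC by (intro vol_mono) simp_all
          then have vC: "1 \<le> vol E ?C" by (simp add: vol_def)
          have cl3: "closed_in E X (?R2 - ?C)"
            unfolding closed_in_def
          proof (intro ballI impI)
            fix y z assume y: "y \<in> ?R2 - ?C" and z: "z \<in> X" "{y, z} \<in> E"
            have "z \<in> ?R2" using closed_inD[OF clR _ z] y by blast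
            moreover have "z \<notin> ?C"
            proof
              assume zC: "z \<in> ?C"
              have "{z, y} \<in> E" using z(2) by (simp add: insert_commute)
              then have "y \<in> ?C" using closed_inD[OF closed_in_component[OF iR] zC] y by blast
              then show False using y by blast
            qed
            ultimately show "z \<in> ?R2 - ?C" by blast
          qed
          have later: "\<forall>y\<in>?R2 - ?C. Suc i \<le> y"
          proof
            fix y assume y: "y \<in> ?R2 - ?C"
            then have "i \<le> y" using I by blast
            moreover have "y \<noteq> i" using y component_refl[of i E ?R2] by blast
            ultimately show "Suc i \<le> y" by simp
          qed
          have time: "Suc (Suc (Suc (Suc a3))) \<le> a1 + 1 + 4 * Suc i + 30 * vol E (X - (?R2 - ?C))"
          proof -
            have "a3 \<le> a2 + 13 + 10 * vol E ?C" using 3 by simp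
            moreover have "a2 \<le> a1 + 1 + 4 * i + 30 * vol E (X - ?R2)" using I by blast
            ultimately show ?thesis unfolding vol using vC by simp
          qed
          have rest: "?R2 - ?C \<subseteq> X" using RX by blast
          have small: "card (component E X z) = card ?C" if "z \<in> ?C" for z
            using component_eq[OF iX, of z E] that C by simp
          show "wp W (Cond (Less (Read ''cnt'' (Var ''A'')) (Var ''t''))
            (Seq (Assign ''s'' (Var ''y'')) (Assign ''f'' (Lit 1))) Skip) s3 a3
            (\<lambda>s3 a3. ?I (Suc i) s3 (Suc a3))"
          proof (cases "?k < card ?C")
            case True
            let ?s3 = "s3\<lparr>scal := (scal s3)(''s'' := i, ''f'' := 1)\<rparr>"
            have R3': "?R ?s3 = ?R2 - ?C" using R3 by simp
            have "?I (Suc i) ?s3 (Suc (Suc (Suc (Suc a3))))"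
              unfolding R3' using True iX C rest cl3 later time by simp
            then show ?thesis using True 3 k3 v3 i W by simp
          next
            case False
            have "?good s3" unfolding R3 XR v3 using I False small by auto
            then have "?I (Suc i) s3 (Suc (Suc (Suc a3)))"
              unfolding R3 using rest cl3 later time by simp
            then show ?thesis using False 3 k3 by simp
          qed
        qed
        then show ?thesis using True i W by simp
      qed
    next
      fix s2 a2
      assume I: "?I n s2 a2"
      \<comment> \<open>A vertex still marked would have a number both below \<open>n\<close> and at
        least \<open>n\<close>.\<close>
      have R: "?R s2 = {}" using I by fastforce
      have "vol E X \<le> vol E {..<n}" using Xn by (intro vol_mono) auto
      then have "Suc a2 \<le> a + 10 + 40 * (n + 2 * card E)"
        using I 1 vol_le unfolding R by simp
      then show "?Q s2 (Suc a2)" using I unfolding R by simp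
    qed auto
  qed
  then show ?thesis unfolding find_piece_def by simp
qed

end

section \<open>The local search as a program\<close>

text \<open>The register \<open>m\<close> tells whether the two small parts are adjacent, \<open>f\<close> whether a step was
  found. If the removal of one vertex \<open>v\<close> of the largest part that touches the part \<open>A\<close> leaves
  no component bigger than \<open>A\<close>, then every other contact vertex of the largest part allows a
  Pull (\<open>component_of_other_cut\<close>). This is why linear time suffices per step.\<close>

definition search :: com where
  "search = Seq find_contact (Cond (Less (Lit 0) (Var ''m''))
     (Seq (for_loop ''x'' (Cond (eq_test (Read ''part'' (Var ''x'')) (Var ''B''))
         (Store ''part'' (Var ''x'') (Var ''A'')) Skip))
       (Seq pick (Assign ''i'' (Var ''B''))))
     (Seq (Assign ''i'' (Var ''A''))
       (Seq find_piece (Cond (Less (Lit 0) (Var ''f'')) Skip find_exit))))"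

definition improve :: com where
  "improve = Seq search (Cond (Less (Lit 0) (Var ''f'')) (Seq split_part sort_parts) Skip)"

text \<open>A positive \<open>f\<close> says that no search has failed yet. It has to be positive on
  entry, because the Merge branch of \<open>search\<close> reports success simply by leaving it as
  it is. The guard compares twice the largest size with \<open>n\<close>, as the machine cannot
  divide.\<close>

definition approx3_main :: com where
  "approx3_main = Seq sort_parts (Seq (Assign ''f'' (Lit 1))
     (While (And (Less (Lit 0) (Var ''f''))
         (Less (Var ''n'') (Add (Read ''cnt'' (Var ''L'')) (Read ''cnt'' (Var ''L'')))))
       improve))"

text \<open>The first cut, at vertex 0, keeps the component of vertex 1 under label 1 and gives
  label 2 to the rest. Sorting then puts the empty label 3 into \<open>A\<close>, so it is free to
  name the rest in the cut of the larger part.\<close>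

definition approx3_init :: com where
  "approx3_init = Seq (for_loop ''x'' (Store ''part'' (Var ''x'') (Lit 1)))
     (Seq (Assign ''L'' (Lit 1)) (Seq (Assign ''i'' (Lit 2)) (Seq (Assign ''v'' (Lit 0))
       (Seq (Assign ''s'' (Lit 1)) (Seq split_part (Seq sort_parts
         (Seq (Assign ''i'' (Var ''A'')) (Seq pick split_part))))))))"

lemma vars_search [simp]:
  "svars search = {''m'', ''v'', ''u'', ''j'', ''e'', ''w'', ''x'', ''s'', ''i'', ''f'', ''r'', ''y'', ''h'', ''t''}"
  "avars search = {''part'', ''mark'', ''q''}"
  by (auto simp: search_def)

lemma vars_approx3_init [simp]:
  "svars approx3_init = {''L'', ''i'', ''v'', ''s'', ''z''} \<union> svars split_part \<union> svars sort_parts"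
  "avars approx3_init = avars split_part \<union> avars sort_parts"
  by (auto simp: approx3_init_def)

lemma label_permutation:
  assumes "{A, B, L} = {1, 2, 3 :: nat}"
  shows "A \<noteq> B" "A \<noteq> L" "B \<noteq> L"
proof -
  have "card {A, B, L} = 3" unfolding assms by simp
  then show "A \<noteq> B" "A \<noteq> L" "B \<noteq> L" by (auto simp: card_insert_if split: if_splits)
qed

lemma stored_parts_labels:
  assumes "{A, B, L} = {1, 2, 3}"
  shows "stored_parts n s = {part_class n s A, part_class n s B, part_class n s L}"
proof -
  have "stored_parts n s = part_class n s ` {A, B, L}" unfolding assms stored_parts_classes by simp
  then show ?thesis by simp
qed

text \<open>The union in the second claim serves both operations: for a Pull the class
  \<open>i\<close> is the part that receives \<open>U\<close>, for a Merge it is empty and becomes a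
  new part.\<close>

lemma part_class_split:
  assumes "\<forall>y<n. arr s' ''part'' y = (if y \<in> part_class n s L - C then i else arr s ''part'' y)"
    "C \<subseteq> part_class n s L" "i \<noteq> L"
  shows "part_class n s' L = C" "part_class n s' i = part_class n s i \<union> (part_class n s L - C)"
    "l \<noteq> L \<Longrightarrow> l \<noteq> i \<Longrightarrow> part_class n s' l = part_class n s l"
proof -
  have s': "y \<in> part_class n s' l \<longleftrightarrow>
      y < n \<and> (if y \<in> part_class n s L - C then i else arr s ''part'' y) = l" for y l
  proof (cases "y < n")
    case True
    then have "arr s' ''part'' y = (if y \<in> part_class n s L - C then i else arr s ''part'' y)"
      using assms(1) by blast
    then show ?thesis using True by (simp only: part_class_def mem_Collect_eq)
  qed (simp add: part_class_def)
  have s: "y \<in> part_class n s l \<longleftrightarrow> y < n \<and> arr s ''part'' y = l" for y l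
    by (simp add: part_class_def)
  have C: "y < n" "arr s ''part'' y = L" if "y \<in> C" for y
    using subsetD[OF assms(2) that] by (simp_all add: s)
  show "part_class n s' L = C"
    unfolding set_eq_iff s' Diff_iff s using C assms(3) by auto
  show "part_class n s' i = part_class n s i \<union> (part_class n s L - C)"
    unfolding set_eq_iff s' Un_iff Diff_iff s using assms(3) by auto
  show "part_class n s' l = part_class n s l" if "l \<noteq> L" "l \<noteq> i"
    unfolding set_eq_iff s' Diff_iff s using that by auto
qed

lemma part_class_upd [simp]: "part_class n (s\<lparr>scal := g\<rparr>) = part_class n s"
  by (simp add: part_class_def fun_eq_iff)

lemma stored_parts_upd [simp]: "stored_parts n (s\<lparr>scal := g\<rparr>) = stored_parts n s"
  by (simp add: stored_parts_classes)

lemma part_class_cong: "arr s' ''part'' = arr s ''part'' \<Longrightarrow> part_class n s' = part_class n s"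
  by (simp add: part_class_def fun_eq_iff)

section \<open>Correctness and running time of the local search\<close>

context stored_graph
begin

definition sorted_state :: "state \<Rightarrow> bool" where
  "sorted_state s \<longleftrightarrow> stores_graph n E s \<and> {scal s ''A'', scal s ''B'', scal s ''L''} = {1, 2, 3} \<and>
     (\<forall>l\<in>{1, 2, 3}. arr s ''cnt'' l = card (part_class n s l)) \<and>
     sorted_tripartition {..<n} E (stored_parts n s) (part_class n s (scal s ''A''))
       (part_class n s (scal s ''B'')) (part_class n s (scal s ''L''))"

lemma wp_sort_parts_feasible:
  assumes s: "stores_graph n E s" and feas: "feasible_partition 3 {..<n} E (stored_parts n s)"
  shows "wp W sort_parts s a (\<lambda>s' a'. sorted_state s' \<and> stored_parts n s' = stored_parts n s \<and>
    a' \<le> a + 30 + 5 * n)"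
proof (rule wp_conseq[OF wp_sort_parts[OF s]])
  fix y assume "y < n"
  moreover have "\<Union> (stored_parts n s) = {..<n}"
    using feas by (simp add: feasible_partition_def partition_on_def)
  ultimately show "arr s ''part'' y \<in> {1, 2, 3}"
    unfolding stored_parts_classes part_class_def by auto
next
  fix s' :: state and a'
  assume f: "frame sort_parts s s'" and Q: "(\<forall>l\<in>{1, 2, 3}. arr s' ''cnt'' l = card (part_class n s l)) \<and>
    {scal s' ''A'', scal s' ''B'', scal s' ''L''} = {1, 2, 3} \<and>
    card (part_class n s (scal s' ''A'')) \<le> card (part_class n s (scal s' ''B'')) \<and>
    card (part_class n s (scal s' ''B'')) \<le> card (part_class n s (scal s' ''L'')) \<and>
    a' \<le> a + 30 + 5 * n"
  have pc: "part_class n s' = part_class n s"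
    using frame_arr[OF f, of "''part''"] by (intro part_class_cong) simp
  then have sp: "stored_parts n s' = stored_parts n s" unfolding stored_parts_classes by simp
  have lab: "stored_parts n s = {part_class n s (scal s' ''A''), part_class n s (scal s' ''B''),
      part_class n s (scal s' ''L'')}"
    using Q by (intro stored_parts_labels) blast
  have "stores_graph n E s'" by (rule stores_graph_frame[OF s f]) auto
  moreover have "sorted_tripartition {..<n} E (stored_parts n s') (part_class n s' (scal s' ''A''))
       (part_class n s' (scal s' ''B'')) (part_class n s' (scal s' ''L''))"
    unfolding sorted_tripartition_def sp pc using lab feas Q by blast
  ultimately have "sorted_state s'" unfolding sorted_state_def using Q pc by simp
  then show "sorted_state s' \<and> stored_parts n s' = stored_parts n s \<and> a' \<le> a + 30 + 5 * n"
    using sp Q by blast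
qed

lemma wp_relabel:
  assumes s: "stores_graph n E s" and ab: "scal s ''A'' = A" "scal s ''B'' = B" "A \<le> W" "A \<noteq> B"
  shows "wp W (for_loop ''x'' (Cond (eq_test (Read ''part'' (Var ''x'')) (Var ''B''))
         (Store ''part'' (Var ''x'') (Var ''A'')) Skip)) s a
    (\<lambda>s' a'. part_class n s' A = part_class n s A \<union> part_class n s B \<and> part_class n s' B = {} \<and>
      (\<forall>l. l \<noteq> A \<and> l \<noteq> B \<longrightarrow> part_class n s' l = part_class n s l) \<and> a' \<le> a + 2 + 4 * n)"
proof (rule wp_for_loop[where n = n and I = "\<lambda>i s1 a1. (\<forall>y<n. arr s1 ''part'' y =
      (if y < i \<and> arr s ''part'' y = B then A else arr s ''part'' y)) \<and> a1 \<le> a + 1 + 4 * i"])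
  show "scal s ''n'' = n" using s by (simp add: stores_graph_def)
  show "n \<le> W" using W by simp
next
  let ?c = "Cond (eq_test (Read ''part'' (Var ''x'')) (Var ''B'')) (Store ''part'' (Var ''x'') (Var ''A'')) Skip"
  fix i and s1 :: state and a1
  assume i: "i < n" "scal s1 ''x'' = i" and f: "frame (for_loop ''x'' ?c) s s1"
    and I: "(\<forall>y<n. arr s1 ''part'' y =
      (if y < i \<and> arr s ''part'' y = B then A else arr s ''part'' y)) \<and> a1 \<le> a + 1 + 4 * i"
  have m: "scal s1 ''A'' = A" "scal s1 ''B'' = B"
    using frame_scal[OF f, of "''A''"] frame_scal[OF f, of "''B''"] ab by simp_all
  have pi: "arr s1 ''part'' i = arr s ''part'' i" using I i by simp
  show "wp W ?c s1 (Suc a1) (\<lambda>s1 a1. (\<forall>y<n. arr s1 ''part'' y =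
      (if y < Suc i \<and> arr s ''part'' y = B then A else arr s ''part'' y)) \<and> Suc a1 \<le> a + 1 + 4 * Suc i)"
    using i I m pi ab W by (auto simp: less_Suc_eq)
next
  fix s1 :: state and a1
  assume "(\<forall>y<n. arr s1 ''part'' y =
      (if y < n \<and> arr s ''part'' y = B then A else arr s ''part'' y)) \<and> a1 \<le> a + 1 + 4 * n"
  then show "part_class n s1 A = part_class n s A \<union> part_class n s B \<and> part_class n s1 B = {} \<and>
      (\<forall>l. l \<noteq> A \<and> l \<noteq> B \<longrightarrow> part_class n s1 l = part_class n s l) \<and> Suc a1 \<le> a + 2 + 4 * n"
    using ab(4) by (auto simp: part_class_def)
qed auto

text \<open>After a successful search only the split is missing. In the Merge case the stored
  classes are not a tripartition at that point, since class \<open>B\<close> is empty; this is why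
  the result is described label by label.\<close>

lemma wp_search:
  assumes st: "sorted_state s" and conn: "connected_graph {..<n} E"
    and labels: "scal s ''A'' = A" "scal s ''B'' = B" "scal s ''L'' = L"
    and big: "n < 2 * card (part_class n s L)" and f0: "0 < scal s ''f''"
  shows "wp W search s a (\<lambda>s' a'.
    (if 0 < scal s' ''f'' then
      scal s' ''v'' \<in> part_class n s L \<and> scal s' ''s'' \<in> part_class n s L \<and> scal s' ''s'' \<noteq> scal s' ''v'' \<and>
      part_class n s' L = part_class n s L \<and>
      (adjacent E (part_class n s A) (part_class n s B) \<and> scal s' ''i'' = B \<and>
         part_class n s' A = part_class n s A \<union> part_class n s B \<and> part_class n s' B = {} \<or>
       (scal s' ''i'' = A \<or> scal s' ''i'' = B) \<and> part_class n s' = part_class n s \<and>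
         (\<exists>w\<in>part_class n s (scal s' ''i''). {scal s' ''v'', w} \<in> E) \<and>
         card (part_class n s (scal s' ''i'')) <
           card (component E (part_class n s L - {scal s' ''v''}) (scal s' ''s'')))
     else part_class n s' = part_class n s \<and>
      (\<exists>v. stuck_at E (part_class n s A) (part_class n s B) (part_class n s L) v)) \<and>
    a' \<le> a + 30 + 70 * (n + 2 * card E))" (is "wp W search s a ?Q")
proof -
  let ?A = "part_class n s A" and ?B = "part_class n s B" and ?L = "part_class n s L"
  have s: "stores_graph n E s" and perm: "{A, B, L} = {1, 2, 3}"
    and cnt: "\<forall>l\<in>{1, 2, 3}. arr s ''cnt'' l = card (part_class n s l)"
    and tri: "sorted_tripartition {..<n} E (stored_parts n s) ?A ?B ?L"
    using st labels by (simp_all add: sorted_state_def)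
  note ne = label_permutation[OF perm]
  have fin: "finite {..<n}" by simp
  note 1 = sorted_tripartitionD[OF tri fin]
  have big': "card {..<n} < 2 * card ?L" using big by simp
  have ABL: "A \<in> {1, 2, 3}" "B \<in> {1, 2, 3}" "L \<in> {1, 2, 3}" unfolding perm[symmetric] by simp_all
  then have leW: "A \<le> W" "B \<le> W" "L \<le> W" using W by auto
  have cA: "arr s ''cnt'' A = card ?A" using cnt ABL by blast
  have part: "arr s ''part'' y \<in> {A, B, L}" if "y < n" for y
  proof -
    have "y \<in> ?A \<union> ?B \<union> ?L" using 1(2) that by simp
    then show ?thesis by (auto simp: part_class_def)
  qed
  have connV: "induces_connected E {..<n}" using induces_connected_whole[OF simple] conn by simp
  show ?thesis unfolding search_def wp_Seq
  proof (rule wp_conseq[OF wp_find_contact[OF s labels ne(2)]])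
    fix s1 :: state and a1
    assume f1: "frame find_contact s s1" and
      Q1: "(0 < scal s1 ''m'' \<longleftrightarrow> adjacent E ?A ?B) \<and>
        (adjacent E ?L ?A \<longrightarrow> scal s1 ''v'' \<in> ?L \<and> (\<exists>w\<in>?A. {scal s1 ''v'', w} \<in> E)) \<and>
        a1 \<le> a + 4 + 10 * (n + 2 * card E)"
    have s1: "stores_graph n E s1" by (rule stores_graph_frame[OF s f1]) auto
    have m1: "scal s1 ''A'' = A" "scal s1 ''B'' = B" "scal s1 ''L'' = L" "scal s1 ''f'' = scal s ''f''"
      "arr s1 ''cnt'' = arr s ''cnt''" "arr s1 ''part'' = arr s ''part''"
      using frame_scal[OF f1, of "''A''"] frame_scal[OF f1, of "''B''"] frame_scal[OF f1, of "''L''"]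
        frame_scal[OF f1, of "''f''"] frame_arr[OF f1, of "''cnt''"] frame_arr[OF f1, of "''part''"] labels
      by simp_all
    have pc1: "part_class n s1 = part_class n s" by (rule part_class_cong[OF m1(6)])
    let ?relabel = "for_loop ''x'' (Cond (eq_test (Read ''part'' (Var ''x'')) (Var ''B''))
         (Store ''part'' (Var ''x'') (Var ''A'')) Skip)"
    let ?c1 = "Seq ?relabel (Seq pick (Assign ''i'' (Var ''B'')))"
    let ?c2 = "Seq (Assign ''i'' (Var ''A'')) (Seq find_piece (Cond (Less (Lit 0) (Var ''f'')) Skip find_exit))"
    \<comment> \<open>Giving the whole middle part the label \<open>A\<close> forms the union of the
      small parts and frees the label \<open>B\<close> for one half of the largest part.\<close>
    have merge: "wp W ?c1 s1 (Suc a1) ?Q" if adj: "adjacent E ?A ?B"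
      unfolding wp_Seq
    proof (rule wp_conseq[OF wp_relabel[OF s1 m1(1,2) leW(1) ne(1)]])
      fix s2 :: state and a2
      assume f2: "frame ?relabel s1 s2" and
        Q2: "part_class n s2 A = part_class n s1 A \<union> part_class n s1 B \<and> part_class n s2 B = {} \<and>
          (\<forall>l. l \<noteq> A \<and> l \<noteq> B \<longrightarrow> part_class n s2 l = part_class n s1 l) \<and> a2 \<le> (Suc a1) + 2 + 4 * n"
      have s2: "stores_graph n E s2" by (rule stores_graph_frame[OF s1 f2]) auto
      have m2: "scal s2 ''B'' = B" "scal s2 ''L'' = L" "scal s2 ''f'' = scal s ''f''"
        using frame_scal[OF f2, of "''B''"] frame_scal[OF f2, of "''L''"]
          frame_scal[OF f2, of "''f''"] m1 by simp_all
      have L2: "part_class n s2 L = ?L" using Q2 ne pc1 by metis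
      have "2 \<le> card ?L" using big 1(14-17) by simp
      then have "2 \<le> card (part_class n s2 (scal s2 ''L''))" unfolding m2 L2 .
      from wp_pick[OF s2 this]
      show "wp W pick s2 a2 (\<lambda>s3 a3. wp W (Assign ''i'' (Var ''B'')) s3 a3 ?Q)"
      proof (rule wp_conseq)
        fix s3 :: state and a3
        assume f3: "frame pick s2 s3" and
          Q3: "scal s3 ''v'' \<in> part_class n s2 (scal s2 ''L'') \<and> scal s3 ''s'' \<in> part_class n s2 (scal s2 ''L'') \<and>
            scal s3 ''s'' \<noteq> scal s3 ''v'' \<and> a3 \<le> a2 + 10 + 5 * n"
        have m3: "scal s3 ''B'' = B" "scal s3 ''f'' = scal s ''f''"
          using frame_scal[OF f3, of "''B''"] frame_scal[OF f3, of "''f''"] m2 by simp_all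
        have "arr s3 ''part'' = arr s2 ''part''" using frame_arr[OF f3, of "''part''"] by simp
        then have pc3: "part_class n s3 = part_class n s2" by (rule part_class_cong)
        have time: "Suc a3 \<le> a + 30 + 70 * (n + 2 * card E)"
          using Q1 Q2 Q3 by simp
        show "wp W (Assign ''i'' (Var ''B'')) s3 a3 ?Q"
          using Q3 Q2 adj L2 m2 m3 f0 pc1 pc3 time leW by simp
      qed
    qed
    have pull: "wp W ?c2 s1 (Suc a1) ?Q" if na: "\<not> adjacent E ?A ?B"
    proof -
      let ?v = "scal s1 ''v''"
      have "adjacent E ?L ?A" by (rule largest_part_contact[OF tri fin connV na])
      then have v: "?v \<in> ?L" "\<exists>w\<in>?A. {?v, w} \<in> E" using Q1 by blast+
      let ?X = "?L - {?v}"
      let ?s1 = "s1\<lparr>scal := (scal s1)(''i'' := A)\<rparr>"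
      have s1': "stores_graph n E ?s1" using s1 by (simp add: stores_graph_def)
      have pc1': "part_class n ?s1 = part_class n s" using m1(6) by (intro part_class_cong) simp
      have X: "?X = part_class n ?s1 (scal ?s1 ''L'') - {scal ?s1 ''v''}" unfolding pc1' using m1 by simp
      have k: "arr ?s1 ''cnt'' (scal ?s1 ''A'') = card ?A" using m1 cA by simp
      have "wp W find_piece ?s1 (Suc (Suc a1)) (\<lambda>s2 a2. wp W (Cond (Less (Lit 0) (Var ''f'')) Skip find_exit) s2 a2 ?Q)"
      proof (rule wp_conseq[OF wp_find_piece[OF s1' X, unfolded k]])
        fix s2 :: state and a2
        assume f2: "frame find_piece ?s1 s2" and
          Q2: "(scal s2 ''f'' = 0 \<longrightarrow> (\<forall>z\<in>?X. card (component E ?X z) \<le> card ?A)) \<and>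
            (0 < scal s2 ''f'' \<longrightarrow> scal s2 ''s'' \<in> ?X \<and> card ?A < card (component E ?X (scal s2 ''s''))) \<and>
            a2 \<le> Suc (Suc a1) + 10 + 40 * (n + 2 * card E)"
        have s2: "stores_graph n E s2" by (rule stores_graph_frame[OF s1' f2]) auto
        have m2: "scal s2 ''L'' = L" "scal s2 ''i'' = A" "scal s2 ''v'' = ?v"
          "arr s2 ''part'' = arr s ''part''"
          using frame_scal[OF f2, of "''L''"] frame_scal[OF f2, of "''i''"]
            frame_scal[OF f2, of "''v''"] frame_arr[OF f2, of "''part''"] m1 by simp_all
        have pc2: "part_class n s2 = part_class n s" by (rule part_class_cong[OF m2(4)])
        have "wp W find_exit s2 (Suc a2) ?Q" if f: "scal s2 ''f'' = 0"
        proof -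
          have small: "\<forall>z\<in>?X. card (component E ?X z) \<le> card ?A" using Q2 f by blast
          have vn: "?v < n" using v(1) by (simp add: part_class_def)
          have pW: "arr s2 ''part'' y \<le> W" if "y < n" for y
            using part[OF that] leW unfolding m2 by auto
          show ?thesis
          proof (rule wp_conseq[OF wp_find_exit[OF s2 pW m2(1) m2(3) vn f], unfolded pc2])
            fix s3 :: state and a3
            assume f3: "frame find_exit s2 s3" and
              Q3: "(scal s3 ''f'' = 0 \<longrightarrow> (\<forall>u\<in>?L. \<forall>w\<in>nb E u. w \<notin> ?L \<longrightarrow> u = ?v)) \<and>
                (0 < scal s3 ''f'' \<longrightarrow> scal s3 ''v'' \<in> ?L \<and> scal s3 ''v'' \<noteq> ?v \<and> scal s3 ''s'' = ?v \<and>
                  scal s3 ''i'' \<noteq> L \<and> (\<exists>w\<in>part_class n s (scal s3 ''i''). {scal s3 ''v'', w} \<in> E)) \<and>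
                a3 \<le> Suc a2 + 4 + 10 * (n + 2 * card E)"
            have "arr s3 ''part'' = arr s ''part''" using frame_arr[OF f3, of "''part''"] m2 by simp
            then have pc3: "part_class n s3 = part_class n s" by (rule part_class_cong)
            have time: "a3 \<le> a + 30 + 70 * (n + 2 * card E)" using Q1 Q2 Q3 by simp
            show "?Q s3 a3"
            proof (cases "0 < scal s3 ''f''")
              case True
              let ?u = "scal s3 ''v''" and ?i = "scal s3 ''i''"
              have u: "?u \<in> ?L" "?u \<noteq> ?v" "scal s3 ''s'' = ?v" "?i \<noteq> L"
                and ex: "\<exists>w\<in>part_class n s ?i. {?u, w} \<in> E" using Q3 True by blast+
              obtain w where "w \<in> part_class n s ?i" using ex by blast
              then have i: "?i = A \<or> ?i = B" using part[of w] u(4) by (auto simp: part_class_def)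
              \<comment> \<open>No further flood is run for the new cut vertex: the smallness of the
                pieces at the old one already yields this bound, and it suffices for both possible
                values of \<open>?i\<close>.\<close>
              have "card ?B < card (component E (?L - {?u}) ?v)"
                using small u by (intro component_of_other_cut[OF tri fin big' v(1) u(1,2)]) blast
              then have "card (part_class n s ?i) < card (component E (?L - {?u}) ?v)"
                using i 1(9) by auto
              then show ?thesis unfolding pc3 using True u i ex v time by simp
            next
              case False
              have "stuck_at E ?A ?B ?L ?v"
                unfolding stuck_at_def
              proof (intro conjI)
                show "\<forall>x\<in>?L. \<forall>w\<in>?A \<union> ?B. {x, w} \<in> E \<longrightarrow> x = ?v"
                proof (intro ballI impI)
                  fix x w assume "x \<in> ?L" "w \<in> ?A \<union> ?B" "{x, w} \<in> E"
                  moreover from this have "w \<notin> ?L" using 1(4,5) by blast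
                  ultimately show "x = ?v" using Q3 False unfolding nb_def by blast
                qed
              qed (use v na small in simp_all)
              then show ?thesis unfolding pc3 using False time by auto
            qed
          qed
        qed
        moreover have "?Q s2 (Suc (Suc a2))" if f: "0 < scal s2 ''f''"
          unfolding pc2 using Q1 Q2 f v m2 by simp
        ultimately show "wp W (Cond (Less (Lit 0) (Var ''f'')) Skip find_exit) s2 a2 ?Q"
          by simp
      qed
      then show ?thesis using m1 leW by simp
    qed
    show "wp W (Cond (Less (Lit 0) (Var ''m'')) ?c1 ?c2) s1 a1 ?Q"
      unfolding wp_Cond using merge pull Q1 by (simp del: wp_Seq)
  qed
qed

text \<open>Both kinds of steps end in the same \<open>split_part\<close>; only the prior
  relabelling differs. A failed search preserves the size of the largest part, which the caller
  needs for its measure.\<close>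

lemma wp_improve:
  assumes st: "sorted_state s" and conn: "connected_graph {..<n} E"
    and big: "n < 2 * card (part_class n s (scal s ''L''))" and f0: "0 < scal s ''f''"
  shows "wp W improve s a (\<lambda>s' a'. sorted_state s' \<and>
    (if 0 < scal s' ''f'' then approx3_step {..<n} E (stored_parts n s) (stored_parts n s')
     else stored_parts n s' = stored_parts n s \<and>
       card (part_class n s' (scal s' ''L'')) = card (part_class n s (scal s ''L'')) \<and>
       \<not> (\<exists>R. approx3_step {..<n} E (stored_parts n s) R)) \<and>
    a' \<le> a + 100 + 100 * (n + 2 * card E))" (is "wp W improve s a ?Q")
proof -
  define A B L where "A = scal s ''A''" and "B = scal s ''B''" and "L = scal s ''L''"
  let ?A = "part_class n s A" and ?B = "part_class n s B" and ?L = "part_class n s L"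
  have s: "stores_graph n E s" and perm: "{A, B, L} = {1, 2, 3}"
    and tri: "sorted_tripartition {..<n} E (stored_parts n s) ?A ?B ?L"
    using st unfolding sorted_state_def A_def B_def L_def by simp_all
  note ne = label_permutation[OF perm]
  have fin: "finite {..<n}" by simp
  note 1 = sorted_tripartitionD[OF tri fin]
  have big': "card {..<n} < 2 * card ?L" using big unfolding L_def by simp
  have "A \<in> {1, 2, 3}" "B \<in> {1, 2, 3}" unfolding perm[symmetric] by simp_all
  then have leW: "A \<le> W" "B \<le> W" using W by auto
  show ?thesis unfolding improve_def wp_Seq
  proof (rule wp_conseq[OF wp_search[OF st conn A_def[symmetric] B_def[symmetric] L_def[symmetric]
      big[folded L_def] f0]])
    fix s1 :: state and a1
    assume f1: "frame search s s1" and
      Q1: "(if 0 < scal s1 ''f'' then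
      scal s1 ''v'' \<in> ?L \<and> scal s1 ''s'' \<in> ?L \<and> scal s1 ''s'' \<noteq> scal s1 ''v'' \<and>
      part_class n s1 L = ?L \<and>
      (adjacent E ?A ?B \<and> scal s1 ''i'' = B \<and>
         part_class n s1 A = ?A \<union> ?B \<and> part_class n s1 B = {} \<or>
       (scal s1 ''i'' = A \<or> scal s1 ''i'' = B) \<and> part_class n s1 = part_class n s \<and>
         (\<exists>w\<in>part_class n s (scal s1 ''i''). {scal s1 ''v'', w} \<in> E) \<and>
         card (part_class n s (scal s1 ''i'')) <
           card (component E (?L - {scal s1 ''v''}) (scal s1 ''s'')))
     else part_class n s1 = part_class n s \<and> (\<exists>v. stuck_at E ?A ?B ?L v)) \<and>
    a1 \<le> a + 30 + 70 * (n + 2 * card E)"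
    have s1: "stores_graph n E s1" by (rule stores_graph_frame[OF s f1]) auto
    have m1: "scal s1 ''A'' = A" "scal s1 ''B'' = B" "scal s1 ''L'' = L" "arr s1 ''cnt'' = arr s ''cnt''"
      using frame_scal[OF f1, of "''A''"] frame_scal[OF f1, of "''B''"] frame_scal[OF f1, of "''L''"]
        frame_arr[OF f1, of "''cnt''"] by (simp_all add: A_def B_def L_def)
    show "wp W (Cond (Less (Lit 0) (Var ''f'')) (Seq split_part sort_parts) Skip) s1 a1 ?Q"
    proof (cases "0 < scal s1 ''f''")
      case False
      then have pc: "part_class n s1 = part_class n s" and stuck: "\<exists>v. stuck_at E ?A ?B ?L v"
        and time: "a1 \<le> a + 30 + 70 * (n + 2 * card E)" using Q1 by simp_all
      have sp: "stored_parts n s1 = stored_parts n s" unfolding stored_parts_classes pc by simp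
      have "sorted_state s1" using st s1 m1 unfolding sorted_state_def sp pc
        by (simp add: A_def B_def L_def)
      moreover have "\<not> (\<exists>R. approx3_step {..<n} E (stored_parts n s) R)"
        using stuck stuck_at_terminal[OF tri fin big'] by blast
      ultimately show ?thesis using False sp pc m1 time by (simp add: L_def)
    next
      case True
      let ?v = "scal s1 ''v''" and ?x = "scal s1 ''s''" and ?i = "scal s1 ''i''"
      let ?D = "component E (?L - {?v}) ?x"
      have vx: "?v \<in> ?L" "?x \<in> ?L" "?x \<noteq> ?v" and L1: "part_class n s1 L = ?L"
        and alt: "adjacent E ?A ?B \<and> ?i = B \<and> part_class n s1 A = ?A \<union> ?B \<and> part_class n s1 B = {} \<or>
         (?i = A \<or> ?i = B) \<and> part_class n s1 = part_class n s \<and>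
         (\<exists>w\<in>part_class n s ?i. {?v, w} \<in> E) \<and> card (part_class n s ?i) < card ?D"
        and time: "a1 \<le> a + 30 + 70 * (n + 2 * card E)"
        using Q1 True by simp_all
      have i: "?i = A \<or> ?i = B" using alt by blast
      have DL: "?D \<subseteq> ?L" using component_subset[of ?x "?L - {?v}" E] vx by blast
      have iL: "?i \<noteq> L" "?i \<le> W" using i ne leW by auto
      have "wp W split_part s1 (Suc a1) (\<lambda>s2 a2. wp W sort_parts s2 a2 ?Q)"
      proof (rule wp_conseq[OF wp_split_part[OF s1 m1(3)]])
        show "scal s1 ''v'' \<in> part_class n s1 L" "scal s1 ''s'' \<in> part_class n s1 L" using vx L1 by simp_all
        show "scal s1 ''s'' \<noteq> scal s1 ''v''" by (rule vx)
        show "scal s1 ''i'' \<le> W" by (rule iL)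
        show "?D = component E (part_class n s1 L - {scal s1 ''v''}) (scal s1 ''s'')" unfolding L1 ..
      next
        fix s2 :: state and a2
        assume f2: "frame split_part s1 s2" and
          Q2: "(\<forall>y<n. arr s2 ''part'' y = (if y \<in> part_class n s1 L - ?D then ?i else arr s1 ''part'' y)) \<and>
            a2 \<le> Suc a1 + 20 + 20 * (n + 2 * card E)"
        have s2: "stores_graph n E s2" by (rule stores_graph_frame[OF s1 f2]) auto
        have f2': "scal s2 ''f'' = scal s1 ''f''" using frame_scal[OF f2, of "''f''"] by simp
        note pc2 = part_class_split[OF conjunct1[OF Q2] _ iL(1), unfolded L1, OF DL]
        have sp2: "stored_parts n s2 = {part_class n s2 A, part_class n s2 B, part_class n s2 L}"
          by (rule stored_parts_labels[OF perm])
        have step: "approx3_step {..<n} E (stored_parts n s) (stored_parts n s2)"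
          using alt
        proof
          assume *: "adjacent E ?A ?B \<and> ?i = B \<and> part_class n s1 A = ?A \<union> ?B \<and> part_class n s1 B = {}"
          then have "part_class n s2 A = ?A \<union> ?B" "part_class n s2 B = ?L - ?D"
            using pc2(2) pc2(3)[of A] ne by auto
          then have "stored_parts n s2 = {?A \<union> ?B, ?D, ?L - ?D}"
            unfolding sp2 pc2(1) by blast
          moreover have "merge_step {..<n} E (stored_parts n s) {?A \<union> ?B, ?D, ?L - ?D}"
            using * by (intro merge_step_component[OF tri fin big' _ vx refl]) blast
          ultimately show ?thesis unfolding approx3_step_def by simp
        next
          assume *: "(?i = A \<or> ?i = B) \<and> part_class n s1 = part_class n s \<and>
            (\<exists>w\<in>part_class n s ?i. {?v, w} \<in> E) \<and> card (part_class n s ?i) < card ?D"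
          then obtain w where w: "w \<in> part_class n s ?i" "{?v, w} \<in> E" and pc1: "part_class n s1 = part_class n s"
            and bigD: "card (part_class n s ?i) < card ?D" by blast
          define Y where "Y = (if ?i = A then ?B else ?A)"
          have XY: "part_class n s ?i = ?A \<and> Y = ?B \<or> part_class n s ?i = ?B \<and> Y = ?A"
            using i unfolding Y_def by auto
          have "pull_step {..<n} E (stored_parts n s) {?D, part_class n s ?i \<union> (?L - ?D), Y}"
            by (rule pull_step_component[OF tri fin big' XY vx(1) w vx(2,3) refl bigD])
          moreover have "stored_parts n s2 = {?D, part_class n s ?i \<union> (?L - ?D), Y}"
          proof (cases "?i = A")
            case True
            then have "part_class n s2 A = ?A \<union> (?L - ?D)" "part_class n s2 B = ?B"
              using pc2(2) pc2(3)[of B] ne pc1 by auto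
            then show ?thesis unfolding sp2 pc2(1) using True by (auto simp: Y_def)
          next
            case False
            then have "part_class n s2 B = ?B \<union> (?L - ?D)" "part_class n s2 A = ?A"
              using pc2(2) pc2(3)[of A] ne pc1 i by auto
            then show ?thesis unfolding sp2 pc2(1) using False i by (auto simp: Y_def)
          qed
          ultimately show ?thesis unfolding approx3_step_def by simp
        qed
        have feas: "feasible_partition 3 {..<n} E (stored_parts n s2)"
          using approx3_step_decreasing[OF step fin] by blast
        show "wp W sort_parts s2 a2 ?Q"
        proof (rule wp_conseq[OF wp_sort_parts_feasible[OF s2 feas]])
          fix s3 :: state and a3
          assume f3: "frame sort_parts s2 s3" and
            Q3: "sorted_state s3 \<and> stored_parts n s3 = stored_parts n s2 \<and> a3 \<le> a2 + 30 + 5 * n"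
          have "0 < scal s3 ''f''" using frame_scal[OF f3, of "''f''"] f2' True by simp
          moreover have "a3 \<le> a + 100 + 100 * (n + 2 * card E)" using Q3 Q2 time by simp
          ultimately show "?Q s3 a3" using Q3 step by simp
        qed
      qed
      then show ?thesis using True by simp
    qed
  qed
qed

text \<open>The potential is the size of the largest part plus 1 while \<open>f\<close> is positive.
  A successful round lowers the first summand, the one failing round the second, so there are at
  most \<open>n + 1\<close> rounds. The invariant pays \<open>?K\<close> in advance for each unit of
  the remaining potential.\<close>

lemma wp_approx3_main:
  assumes s: "stores_graph n E s" and conn: "connected_graph {..<n} E"
    and feas: "feasible_partition 3 {..<n} E (stored_parts n s)"
  shows "wp W approx3_main s a (\<lambda>s' a'. approx3_loop {..<n} E (stored_parts n s) (stored_parts n s') \<and>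
    a' \<le> a + 40 + 5 * n + (102 + 100 * (n + 2 * card E)) * (n + 1))" (is "wp W approx3_main s a ?Q")
proof -
  let ?K = "102 + 100 * (n + 2 * card E)"
  let ?b = "And (Less (Lit 0) (Var ''f'')) (Less (Var ''n'') (Add (Read ''cnt'' (Var ''L'')) (Read ''cnt'' (Var ''L''))))"
  let ?largest = "\<lambda>s :: state. card (part_class n s (scal s ''L''))"
  have fin: "finite {..<n}" by simp
  have sorted: "stores_graph n E s1" "arr s1 ''cnt'' (scal s1 ''L'') = ?largest s1"
    "sorted_tripartition {..<n} E (stored_parts n s1) (part_class n s1 (scal s1 ''A''))
       (part_class n s1 (scal s1 ''B'')) (part_class n s1 (scal s1 ''L''))" "scal s1 ''n'' = n"
    if "sorted_state s1" for s1 :: state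
  proof -
    show g: "stores_graph n E s1" using that unfolding sorted_state_def by blast
    then show "scal s1 ''n'' = n" by (simp add: stores_graph_def)
    have "{scal s1 ''A'', scal s1 ''B'', scal s1 ''L''} = {1, 2, 3}"
      and c: "\<forall>l\<in>{1, 2, 3}. arr s1 ''cnt'' l = card (part_class n s1 l)"
      using that unfolding sorted_state_def by blast+
    then have "scal s1 ''L'' \<in> {1, 2, 3}" by blast
    then show "arr s1 ''cnt'' (scal s1 ''L'') = ?largest s1" using c by blast
  qed (use that in \<open>simp add: sorted_state_def\<close>)
  show ?thesis unfolding approx3_main_def wp_Seq
  proof (rule wp_conseq[OF wp_sort_parts_feasible[OF s feas]])
    fix s1 :: state and a1
    assume Q1: "sorted_state s1 \<and> stored_parts n s1 = stored_parts n s \<and> a1 \<le> a + 30 + 5 * n"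
    let ?s1 = "s1\<lparr>scal := (scal s1)(''f'' := 1)\<rparr>"
    have st1: "sorted_state ?s1"
      using conjunct1[OF Q1] by (simp add: sorted_state_def stores_graph_def)
    have par1: "stored_parts n ?s1 = stored_parts n s" using Q1 by simp
    let ?J = "\<lambda>s2. if 0 < scal s2 ''f'' then 1 else 0 :: nat"
    let ?I = "\<lambda>s2 a2. sorted_state s2 \<and> (approx3_step {..<n} E)\<^sup>*\<^sup>* (stored_parts n s) (stored_parts n s2) \<and>
      (scal s2 ''f'' = 0 \<longrightarrow> \<not> (\<exists>R. approx3_step {..<n} E (stored_parts n s2) R)) \<and>
      a2 + ?K * (?largest s2 + ?J s2) \<le> Suc a1 + ?K * (n + 1)"
    have "wp W (While ?b improve) ?s1 (Suc a1) ?Q"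
    proof (rule wp_While[where I = ?I and \<mu> = "\<lambda>s2. ?largest s2 + ?J s2"])
      have "?largest ?s1 \<le> card {..<n}" by (intro card_mono) (auto simp: part_class_def)
      then have "?largest ?s1 + ?J ?s1 \<le> n + 1" by simp
      then have "?K * (?largest ?s1 + ?J ?s1) \<le> ?K * (n + 1)" by (rule mult_le_mono2)
      then show "?I ?s1 (Suc a1)" using st1 par1 by simp
    next
      fix s2 :: state and a2
      assume I: "?I s2 a2" and b: "bval ?b s2"
      note srt = sorted[OF conjunct1[OF I]]
      have f: "0 < scal s2 ''f''" and big: "n < 2 * ?largest s2" using b srt by simp_all
      show "wp W improve s2 (Suc a2) (\<lambda>s3 a3. ?I s3 a3 \<and> ?largest s3 + ?J s3 < ?largest s2 + ?J s2)"
      proof (rule wp_conseq[OF wp_improve[OF conjunct1[OF I] conn big f]])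
        fix s3 :: state and a3
        assume Q3: "sorted_state s3 \<and>
          (if 0 < scal s3 ''f'' then approx3_step {..<n} E (stored_parts n s2) (stored_parts n s3)
           else stored_parts n s3 = stored_parts n s2 \<and> ?largest s3 = ?largest s2 \<and>
            \<not> (\<exists>R. approx3_step {..<n} E (stored_parts n s2) R)) \<and>
          a3 \<le> Suc a2 + 100 + 100 * (n + 2 * card E)"
        note srt3 = sorted[OF conjunct1[OF Q3]]
        have dec: "?largest s3 + ?J s3 < ?largest s2 + ?J s2"
        proof (cases "0 < scal s3 ''f''")
          case True
          then have "approx3_step {..<n} E (stored_parts n s2) (stored_parts n s3)" using Q3 by simp
          then have "partition_size (stored_parts n s3) < partition_size (stored_parts n s2)"
            using approx3_step_decreasing[OF _ fin] by blast
          then have "?largest s3 < ?largest s2"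
            using partition_size_sorted[OF srt(3)] partition_size_sorted[OF srt3(3)] by simp
          then show ?thesis using True f by simp
        qed (use Q3 f in simp)
        have steps: "(approx3_step {..<n} E)\<^sup>*\<^sup>* (stored_parts n s) (stored_parts n s3)"
          using I Q3 by (cases "0 < scal s3 ''f''") (auto intro: rtranclp.rtrancl_into_rtrancl)
        have "?K * Suc (?largest s3 + ?J s3) \<le> ?K * (?largest s2 + ?J s2)"
          using dec by (intro mult_le_mono2) simp
        then have "?K + ?K * (?largest s3 + ?J s3) \<le> ?K * (?largest s2 + ?J s2)"
          by (simp only: mult_Suc_right)
        moreover have "a3 \<le> Suc a2 + 100 + 100 * (n + 2 * card E)" using Q3 by blast
        moreover have "a2 + ?K * (?largest s2 + ?J s2) \<le> Suc a1 + ?K * (n + 1)" using I by blast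
        ultimately have "a3 + ?K * (?largest s3 + ?J s3) \<le> Suc a1 + ?K * (n + 1)" by linarith
        then show "?I s3 a3 \<and> ?largest s3 + ?J s3 < ?largest s2 + ?J s2"
          using Q3 dec steps by simp
      qed
    next
      fix s2 :: state and a2
      assume I: "?I s2 a2" and b: "\<not> bval ?b s2"
      note srt = sorted[OF conjunct1[OF I]]
      have "\<not> (\<exists>R. approx3_step {..<n} E (stored_parts n s2) R)"
      proof (cases "scal s2 ''f'' = 0")
        case True
        then show ?thesis using I by blast
      next
        case False
        then have "2 * ?largest s2 \<le> card {..<n}" using b srt by simp
        then show ?thesis using small_parts_terminal[OF srt(3)] by blast
      qed
      moreover have "a2 \<le> Suc a1 + ?K * (n + 1)" using I by linarith
      then have "Suc a2 \<le> a + 40 + 5 * n + ?K * (n + 1)" using Q1 by linarith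
      ultimately show "?Q s2 (Suc a2)" using I unfolding approx3_loop_def by blast
    qed
    then show "wp W (Assign ''f'' (Lit 1)) s1 a1 (\<lambda>s2 a2. wp W (While ?b improve) s2 a2 ?Q)"
      using W by simp
  qed
qed


lemma wp_approx3_init:
  assumes s: "stores_graph n E s" and conn: "connected_graph {..<n} E" and n3: "3 \<le> n"
  shows "wp W approx3_init s a (\<lambda>s' a'. feasible_partition 3 {..<n} E (stored_parts n s') \<and>
    a' \<le> a + 100 + 60 * (n + 2 * card E))" (is "wp W approx3_init s a ?Q")
proof -
  let ?V = "{..<n}"
  let ?ones = "for_loop ''x'' (Store ''part'' (Var ''x'') (Lit 1))"
  let ?C = "component E (?V - {0}) 1"
  let ?rest = "Seq sort_parts (Seq (Assign ''i'' (Var ''A'')) (Seq pick split_part))"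
  have connV: "induces_connected E ?V" using induces_connected_whole[OF simple] conn by simp
  have 01: "0 \<in> ?V" "1 \<in> ?V" "1 \<in> ?V - {0}" using n3 by auto
  have C: "?C \<subseteq> ?V - {0}" "induces_connected E ?C" "induces_connected E (?V - ?C)"
    using component_subset[OF 01(3)] induces_connected_component[OF 01(3)]
      induces_connected_Diff_component[OF connV 01(1,2)] by simp_all
  have "wp W ?ones s a (\<lambda>s1 a1. part_class n s1 1 = ?V \<and> a1 \<le> a + 2 + 4 * n)"
  proof (rule wp_for_loop[where n = n and
      I = "\<lambda>i s1 a1. (\<forall>y<i. arr s1 ''part'' y = 1) \<and> a1 \<le> a + 1 + 4 * i"])
    show "scal s ''n'' = n" using s by (simp add: stores_graph_def)
    show "n \<le> W" using W by simp
  next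
    fix i and s1 :: state and a1
    assume "i < n" "scal s1 ''x'' = i" "(\<forall>y<i. arr s1 ''part'' y = 1) \<and> a1 \<le> a + 1 + 4 * i"
    then show "wp W (Store ''part'' (Var ''x'') (Lit 1)) s1 (Suc a1)
      (\<lambda>s1 a1. (\<forall>y<Suc i. arr s1 ''part'' y = 1) \<and> Suc a1 \<le> a + 1 + 4 * Suc i)"
      using W by (auto simp: less_Suc_eq)
  next
    fix s1 :: state and a1
    assume "(\<forall>y<n. arr s1 ''part'' y = 1) \<and> a1 \<le> a + 1 + 4 * n"
    then show "part_class n s1 1 = ?V \<and> Suc a1 \<le> a + 2 + 4 * n" by (auto simp: part_class_def)
  qed auto
  then show ?thesis unfolding approx3_init_def wp_Seq
  proof (rule wp_conseq)
    fix s1 :: state and a1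
    assume f1: "frame ?ones s s1" and Q1: "part_class n s1 1 = ?V \<and> a1 \<le> a + 2 + 4 * n"
    have s1: "stores_graph n E s1" by (rule stores_graph_frame[OF s f1]) auto
    let ?s1 = "s1\<lparr>scal := (scal s1)(''L'' := 1, ''i'' := 2, ''v'' := 0, ''s'' := 1)\<rparr>"
    have s1': "stores_graph n E ?s1" using s1 by (simp add: stores_graph_def)
    have pc1: "part_class n ?s1 1 = ?V" using Q1 by simp
    have "wp W split_part ?s1 (a1 + 4) (\<lambda>s2 a2. wp W ?rest s2 a2 ?Q)"
    proof (rule wp_conseq[OF wp_split_part[OF s1', where L = 1 and C = ?C]])
      show "?C = component E (part_class n ?s1 1 - {scal ?s1 ''v''}) (scal ?s1 ''s'')"
        unfolding pc1 by simp
    next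
      fix s2 :: state and a2
      assume f2: "frame split_part ?s1 s2" and
        Q2: "(\<forall>y<n. arr s2 ''part'' y =
            (if y \<in> part_class n ?s1 1 - ?C then scal ?s1 ''i'' else arr ?s1 ''part'' y)) \<and>
          a2 \<le> (a1 + 4) + 20 + 20 * (n + 2 * card E)"
      have s2: "stores_graph n E s2" by (rule stores_graph_frame[OF s1' f2]) auto
      have CV: "?C \<subseteq> part_class n ?s1 1" using C(1) pc1 by blast
      have i2: "scal ?s1 ''i'' = 2" by simp
      have empty: "part_class n ?s1 2 = {}" "part_class n ?s1 3 = {}"
      proof -
        have "part_class n ?s1 l \<inter> part_class n ?s1 1 = {}" if "l \<noteq> 1" for l
          using that unfolding part_class_def by blast
        then have "part_class n ?s1 l = {}" if "l \<noteq> 1" for l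
          using that part_class_subset[of n ?s1 l] pc1 by blast
        then show "part_class n ?s1 2 = {}" "part_class n ?s1 3 = {}" by simp_all
      qed
      note pcs = part_class_split[OF conjunct1[OF Q2] CV, unfolded i2 pc1]
      have pc2: "part_class n s2 1 = ?C" "part_class n s2 2 = ?V - ?C" "part_class n s2 3 = {}"
        using pcs(1) pcs(2) pcs(3)[of 3] empty by simp_all
      have vals: "arr s2 ''part'' y \<in> {1, 2, 3}" if "y < n" for y
      proof -
        have "y \<in> part_class n s2 1 \<union> part_class n s2 2" unfolding pc2 using that by simp
        then show ?thesis by (auto simp: part_class_def)
      qed
      show "wp W ?rest s2 a2 ?Q" unfolding wp_Seq
      proof (rule wp_conseq[OF wp_sort_parts[OF s2 vals]])
        fix s3 :: state and a3
        assume f3: "frame sort_parts s2 s3" and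
          Q3: "(\<forall>l\<in>{1, 2, 3}. arr s3 ''cnt'' l = card (part_class n s2 l)) \<and>
            {scal s3 ''A'', scal s3 ''B'', scal s3 ''L''} = {1, 2, 3} \<and>
            card (part_class n s2 (scal s3 ''A'')) \<le> card (part_class n s2 (scal s3 ''B'')) \<and>
            card (part_class n s2 (scal s3 ''B'')) \<le> card (part_class n s2 (scal s3 ''L'')) \<and>
            a3 \<le> a2 + 30 + 5 * n"
        define A B L where "A = scal s3 ''A''" and "B = scal s3 ''B''" and "L = scal s3 ''L''"
        have perm: "{A, B, L} = {1, 2, 3}"
          and le: "card (part_class n s2 A) \<le> card (part_class n s2 B)"
            "card (part_class n s2 B) \<le> card (part_class n s2 L)"
          using Q3 unfolding A_def B_def L_def by blast+
        note ne = label_permutation[OF perm]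
        have pos: "0 < card (part_class n s2 1)" "0 < card (part_class n s2 2)"
        proof -
          have "part_class n s2 1 \<noteq> {}" "part_class n s2 2 \<noteq> {}"
            unfolding pc2 using C(2,3) unfolding induces_connected_iff by blast+
          then show "0 < card (part_class n s2 1)" "0 < card (part_class n s2 2)"
            by (simp_all add: card_gt_0_iff)
        qed
        \<comment> \<open>The empty class is the only one of size 0, so sorting makes it the
          smallest.\<close>
        have A3: "A = 3"
        proof (rule ccontr)
          assume "A \<noteq> 3"
          moreover have "A \<in> {1, 2, 3}" unfolding perm[symmetric] by simp
          ultimately have "0 < card (part_class n s2 A)" using pos by auto
          moreover have "3 \<in> {A, B, L}" unfolding perm by simp
          then have "B = 3 \<or> L = 3" using \<open>A \<noteq> 3\<close> by blast
          then have "card (part_class n s2 B) = 0" using le pc2(3) by auto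
          ultimately show False using le by simp
        qed
        have "B \<in> {1, 2, 3}" "L \<in> {1, 2, 3}" unfolding perm[symmetric] by simp_all
        then have BL: "B = 1 \<and> L = 2 \<or> B = 2 \<and> L = 1" using A3 ne by auto
        define X Y where "X = part_class n s2 L" and "Y = part_class n s2 B"
        have XY: "X \<union> Y = ?V" "X \<inter> Y = {}" "induces_connected E X" "induces_connected E Y"
          using BL C pc2 unfolding X_def Y_def by auto
        have "card (X \<union> Y) = card X + card Y" using XY(2) unfolding X_def Y_def by (intro card_Un_disjoint) auto
        then have "n = card X + card Y" unfolding XY(1) by simp
        moreover have "card Y \<le> card X" unfolding X_def Y_def by (rule le(2))
        \<comment> \<open>The larger of two parts covering at least three vertices has two vertices,
          so a second cut is possible.\<close>
        ultimately have big: "2 \<le> card X" using n3 by linarith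
        have s3: "stores_graph n E s3" by (rule stores_graph_frame[OF s2 f3]) auto
        have pc3: "part_class n s3 = part_class n s2"
          using frame_arr[OF f3, of "''part''"] by (intro part_class_cong) simp
        let ?s3 = "s3\<lparr>scal := (scal s3)(''i'' := A)\<rparr>"
        have s3': "stores_graph n E ?s3" using s3 by (simp add: stores_graph_def)
        have L3: "part_class n ?s3 (scal ?s3 ''L'') = X" by (simp add: pc3 X_def L_def)
        have "wp W pick ?s3 (Suc a3) (\<lambda>s4 a4. wp W split_part s4 a4 ?Q)"
        proof (rule wp_conseq[OF wp_pick[OF s3', unfolded L3, OF big]])
          fix s4 :: state and a4
          assume f4: "frame pick ?s3 s4" and Q4: "scal s4 ''v'' \<in> X \<and> scal s4 ''s'' \<in> X \<and>
            scal s4 ''s'' \<noteq> scal s4 ''v'' \<and> a4 \<le> (Suc a3) + 10 + 5 * n"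
          have s4: "stores_graph n E s4" by (rule stores_graph_frame[OF s3' f4]) auto
          have m4: "scal s4 ''i'' = A" "scal s4 ''L'' = L"
            using frame_scal[OF f4, of "''i''"] frame_scal[OF f4, of "''L''"] by (simp_all add: L_def)
          have "arr s4 ''part'' = arr s3 ''part''" using frame_arr[OF f4, of "''part''"] by simp
          then have pc4: "part_class n s4 = part_class n s2" using part_class_cong pc3 by metis
          have L4: "part_class n s4 L = X" by (simp add: pc4 X_def)
          let ?D = "component E (X - {scal s4 ''v''}) (scal s4 ''s'')"
          have xX: "scal s4 ''s'' \<in> X - {scal s4 ''v''}" using Q4 by simp
          have D: "?D \<subseteq> X" "induces_connected E ?D" "induces_connected E (X - ?D)"
            using component_subset[OF xX, of E] induces_connected_component[OF xX, of E]
              induces_connected_Diff_component[OF XY(3), of "scal s4 ''v''" "scal s4 ''s''"] Q4 by auto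
          show "wp W split_part s4 a4 ?Q"
          proof (rule wp_conseq[OF wp_split_part[OF s4 m4(2), where C = ?D, unfolded L4]])
            fix s5 :: state and a5
            assume Q5: "(\<forall>y<n. arr s5 ''part'' y =
                (if y \<in> X - ?D then scal s4 ''i'' else arr s4 ''part'' y)) \<and>
              a5 \<le> a4 + 20 + 20 * (n + 2 * card E)"
            note pcs5 = part_class_split[of n s5 s4 L ?D A, unfolded L4,
                OF conjunct1[OF Q5, unfolded m4] D(1) ne(2)]
            have "part_class n s5 L = ?D" "part_class n s5 A = X - ?D" "part_class n s5 B = Y"
              using pcs5(1,2) pcs5(3)[of B] ne A3 pc2(3) by (auto simp: pc4 Y_def)
            then have "stored_parts n s5 = {X - ?D, Y, ?D}" using stored_parts_labels[OF perm, of n s5] by simp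
            moreover have "feasible_partition 3 ?V E {X - ?D, Y, ?D}"
              unfolding feasible_partition_3 using XY D by blast
            moreover have "a5 \<le> a + 100 + 60 * (n + 2 * card E)" using Q1 Q2 Q3 Q4 Q5 by simp
            ultimately show "?Q s5 a5" by simp
          qed (use Q4 m4 A3 W in auto)
        qed
        then show "wp W (Assign ''i'' (Var ''A'')) s3 a3 (\<lambda>s' a'. wp W pick s' a' (\<lambda>s' a'. wp W split_part s' a' ?Q))"
          using A3 W by (simp add: A_def[symmetric])
      qed
    qed (use n3 W pc1 in auto)
    then show "wp W (Assign ''L'' (Lit 1)) s1 a1 (\<lambda>s' a'. wp W (Assign ''i'' (Lit 2)) s' a' (\<lambda>s' a'.
      wp W (Assign ''v'' (Lit 0)) s' a' (\<lambda>s' a'. wp W (Assign ''s'' (Lit 1)) s' a' (\<lambda>s' a'.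
      wp W split_part s' a' (\<lambda>s' a'. wp W sort_parts s' a' (\<lambda>s' a'. wp W (Assign ''i'' (Var ''A'')) s' a'
      (\<lambda>s' a'. wp W pick s' a' (\<lambda>s' a'. wp W split_part s' a' ?Q))))))))"
      using W by (simp add: eval_nat_numeral)
  qed
qed

text \<open>Connectedness excludes isolated vertices, so the degree sum is at least
  \<open>n\<close>. This turns bounds in n + |E| into multiples of |E|, as a bound of the form n |E|
  requires.\<close>

lemma card_edges:
  assumes "connected_graph {..<n} E" "2 \<le> n"
  shows "n \<le> 2 * card E"
proof -
  have conn: "induces_connected E {..<n}" using induces_connected_whole[OF simple] assms by simp
  have "1 \<le> card (nb E v)" if "v < n" for v
  proof -
    have "(if v = 0 then 1 else 0) \<in> {..<n} - {v}" using assms(2) by simp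
    then have "{v} \<subset> {..<n}" using that by blast
    then have "adjacent E {v} ({..<n} - {v})" by (rule not_adjacent_outside[OF conn]) simp
    then have "nb E v \<noteq> {}" by (auto simp: adjacent_def nb_def)
    then have "card (nb E v) \<noteq> 0" by simp
    then show ?thesis by linarith
  qed
  then have "(\<Sum>v<n. 1) \<le> (\<Sum>v<n. card (nb E v))" by (intro sum_mono) auto
  then show ?thesis using sum_card_nb by simp
qed

end

section \<open>From the clock to the stated running time\<close>

lemma runs_withinI:
  assumes "wp W c s 0 (\<lambda>s' a. Q s' \<and> a \<le> T)"
  obtains s' where "runs_within W T c s s'" "frame c s s'" "Q s'"
proof -
  obtain t s' where t: "exec W c s t s'" "Q s'" "0 + t \<le> T" using assms unfolding wp_def by blast
  have "runs_within W T c s s'" unfolding runs_within_def using t by auto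
  then show thesis using that t(2) frame_exec[OF t(1)] by blast
qed

lemma implements_approx3_program:
  assumes n: "3 \<le> n" and simple: "simple_graph {..<n} E" and conn: "connected_graph {..<n} E"
  shows "implements_approx3 approx3_init approx3_main (4 * (n + card E)) (2000 * (n * card E)) n E"
proof -
  let ?W = "4 * (n + card E)" and ?T = "2000 * (n * card E)"
  \<comment> \<open>The word bound 4 (n + |E|) reaches n + 2 |E| + 4 because n is at least
    3.\<close>
  interpret stored_graph n E ?W
    by unfold_locales (use simple n in simp_all)
  have ne: "n \<le> 2 * card E" using card_edges[OF conn] n by simp
  define x where "x = n * card E"
  have "card E \<noteq> 0" using ne n by simp
  then have x: "n \<le> x" "card E \<le> x" "1 \<le> x" using n unfolding x_def by simp_all
  define t1 where "t1 = 100 + 60 * (n + 2 * card E)"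
  define t2 where "t2 = 40 + 5 * n + (102 + 100 * (n + 2 * card E)) * (n + 1)"
  have t1: "t1 \<le> 280 * x" unfolding t1_def using x by simp
  \<comment> \<open>With n at most 2 |E| and |E| at least 1, the three terms are at most 102 |E|,
    200 |E| and 200 |E|. Multiplying by n + 1 gives at most 1004 x; the remaining 40 + 5 n is at
    most 45 x. Both phases together stay below 2000 x.\<close>
  have "(102 + 100 * (n + 2 * card E)) * (n + 1) \<le> (502 * card E) * (n + 1)"
  proof (rule mult_le_mono1)
    have "100 * (n + 2 * card E) = 100 * n + 200 * card E" by simp
    then show "102 + 100 * (n + 2 * card E) \<le> 502 * card E" using ne \<open>card E \<noteq> 0\<close> by linarith
  qed
  also have "\<dots> = 502 * x + 502 * card E" by (simp add: x_def algebra_simps)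
  finally have t2: "t2 \<le> 1100 * x" unfolding t2_def using x by linarith
  have init: "wp ?W approx3_init s a (\<lambda>s' a'. stores_graph n E s' \<and>
      feasible_partition 3 {..<n} E (stored_parts n s') \<and> a' \<le> a + t1)"
    if s: "stores_graph n E s" for s a
  proof (rule wp_conseq[OF wp_approx3_init[OF s conn n]])
    fix s' a'
    assume f: "frame approx3_init s s'" and
      Q: "feasible_partition 3 {..<n} E (stored_parts n s') \<and> a' \<le> a + 100 + 60 * (n + 2 * card E)"
    have "stores_graph n E s'" by (rule stores_graph_frame[OF s f]) auto
    then show "stores_graph n E s' \<and> feasible_partition 3 {..<n} E (stored_parts n s') \<and> a' \<le> a + t1"
      using Q by (simp add: t1_def)
  qed
  have main: "wp ?W approx3_main s a (\<lambda>s' a'.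
      approx3_loop {..<n} E (stored_parts n s) (stored_parts n s') \<and> a' \<le> a + t2)"
    if "stores_graph n E s" "feasible_partition 3 {..<n} E (stored_parts n s)" for s a
    by (rule wp_conseq[OF wp_approx3_main[OF that(1) conn that(2)]]) (simp add: t2_def)
  show ?thesis unfolding implements_approx3_def
  proof (intro conjI allI impI)
    fix s assume s: "stores_graph n E s"
    have "wp ?W approx3_init s 0 (\<lambda>s' a'. (stores_graph n E s' \<and>
      feasible_partition 3 {..<n} E (stored_parts n s')) \<and> a' \<le> ?T)"
      by (rule wp_conseq[OF init[OF s]]) (use t1 x_def in simp)
    then show "\<exists>s'. runs_within ?W ?T approx3_init s s' \<and> stores_graph n E s' \<and>
        feasible_partition 3 {..<n} E (stored_parts n s')"
      by (rule runs_withinI) blast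
    have "wp ?W (Seq approx3_init approx3_main) s 0
      (\<lambda>s' a'. approx3_output {..<n} E (stored_parts n s') \<and> a' \<le> ?T)"
      unfolding wp_Seq
    proof (rule wp_conseq[OF init[OF s]])
      fix s1 a1
      assume Q1: "stores_graph n E s1 \<and> feasible_partition 3 {..<n} E (stored_parts n s1) \<and> a1 \<le> 0 + t1"
      then have "stores_graph n E s1" "feasible_partition 3 {..<n} E (stored_parts n s1)" by blast+
      then show "wp ?W approx3_main s1 a1
        (\<lambda>s' a'. approx3_output {..<n} E (stored_parts n s') \<and> a' \<le> ?T)"
      proof (rule wp_conseq[OF main])
        fix s2 a2
        assume "approx3_loop {..<n} E (stored_parts n s1) (stored_parts n s2) \<and> a2 \<le> a1 + t2"
        then show "approx3_output {..<n} E (stored_parts n s2) \<and> a2 \<le> ?T"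
          using Q1 t1 t2 unfolding approx3_output_def x_def[symmetric] by auto
      qed
    qed
    then show "\<exists>s'. runs_within ?W ?T (Seq approx3_init approx3_main) s s' \<and>
        approx3_output {..<n} E (stored_parts n s')"
      by (rule runs_withinI) blast
  next
    fix s assume s: "stores_graph n E s \<and> feasible_partition 3 {..<n} E (stored_parts n s)"
    have "wp ?W approx3_main s 0 (\<lambda>s' a'.
      approx3_loop {..<n} E (stored_parts n s) (stored_parts n s') \<and> a' \<le> ?T)"
      by (rule wp_conseq[OF main[OF conjunct1[OF s] conjunct2[OF s]]]) (use t2 x_def in simp)
    then show "\<exists>s'. runs_within ?W ?T approx3_main s s' \<and>
        approx3_loop {..<n} E (stored_parts n s) (stored_parts n s')"
      by (rule runs_withinI) blast
  qed
qed

text \<open>The algorithm is nondeterministic, so the ratio is claimed for every output; the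
  existence of outputs and the absence of infinite runs keep this from being vacuous. The program
  and its constants are fixed before the graph.\<close>

theorem theorem1:
  "(\<exists>init loop C K. \<forall>n E.
      3 \<le> n \<and> simple_graph {..<n} E \<and> connected_graph {..<n} E \<longrightarrow>
        implements_approx3 init loop (K * (n + card E)) (C * (n * card E)) n E) \<and>
   (\<forall>(V :: 'a set) E. 3 \<le> card V \<and> simple_graph V E \<and> connected_graph V E \<longrightarrow>
      (\<exists>Q. approx3_output V E Q) \<and>
      \<not> (\<exists>P. \<forall>i :: nat. approx3_step V E (P i) (P (Suc i))) \<and>
      (\<forall>V1 V2 V3. approx3_output V E {V1, V2, V3} \<and> card V1 \<le> card V2 \<and> card V2 \<le> card V3 \<longrightarrow>
         feasible_partition 3 V E {V1, V2, V3} \<and>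
         real (card V3) \<le> 3 / 2 * real (opt_bgp 3 V E))) \<and>
   (simple_graph {..<12} (path_edges 12) \<and> connected_graph {..<12} (path_edges 12) \<and>
      opt_bgp 3 {..<12} (path_edges 12) = 4 \<and>
      (\<exists>V1 V2 V3. approx3_output {..<12} (path_edges 12) {V1, V2, V3} \<and>
         card V1 \<le> card V2 \<and> card V2 \<le> card V3 \<and> card V3 = 6 \<and>
         real (card V3) = 3 / 2 * real (opt_bgp 3 {..<12} (path_edges 12))))"
proof (intro conjI)
  show "\<exists>init loop C K. \<forall>n E.
      3 \<le> n \<and> simple_graph {..<n} E \<and> connected_graph {..<n} E \<longrightarrow>
        implements_approx3 init loop (K * (n + card E)) (C * (n * card E)) n E"
    using implements_approx3_program by blast
  show "\<forall>(V :: 'a set) E. 3 \<le> card V \<and> simple_graph V E \<and> connected_graph V E \<longrightarrow>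
      (\<exists>Q. approx3_output V E Q) \<and>
      \<not> (\<exists>P. \<forall>i :: nat. approx3_step V E (P i) (P (Suc i))) \<and>
      (\<forall>V1 V2 V3. approx3_output V E {V1, V2, V3} \<and> card V1 \<le> card V2 \<and> card V2 \<le> card V3 \<longrightarrow>
         feasible_partition 3 V E {V1, V2, V3} \<and>
         real (card V3) \<le> 3 / 2 * real (opt_bgp 3 V E))"
  proof (intro allI impI, elim conjE, intro conjI)
    fix V :: "'a set" and E
    assume V: "3 \<le> card V" "simple_graph V E" "connected_graph V E"
    have fin: "finite V" using V(2) by (simp add: simple_graph_def)
    have "induces_connected E V" using induces_connected_whole[OF V(2)] V(3) by simp
    then obtain P where "feasible_partition 3 V E P" using feasible_tripartition_exists V(1) by blast
    then show "\<exists>Q. approx3_output V E Q"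
      using approx3_loop_exists[OF fin, of E P] unfolding approx3_output_def by blast
    show "\<not> (\<exists>P. \<forall>i :: nat. approx3_step V E (P i) (P (Suc i)))"
      by (rule approx3_terminates[OF fin])
    show "\<forall>V1 V2 V3. approx3_output V E {V1, V2, V3} \<and> card V1 \<le> card V2 \<and> card V2 \<le> card V3 \<longrightarrow>
         feasible_partition 3 V E {V1, V2, V3} \<and>
         real (card V3) \<le> 3 / 2 * real (opt_bgp 3 V E)"
      using approx3_output_ratio[OF V(2,3)] by blast
  qed
  show "simple_graph {..<12} (path_edges 12)" by (rule simple_graph_path)
  show "connected_graph {..<12} (path_edges 12)"
    using induces_connected_whole[OF simple_graph_path[of 12]] induces_connected_path[of 0 12 12]
    by (simp add: lessThan_atLeast0)
  show opt: "opt_bgp 3 {..<12} (path_edges 12) = 4" by (rule opt_bgp_path_12)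
  show "\<exists>V1 V2 V3. approx3_output {..<12} (path_edges 12) {V1, V2, V3} \<and>
         card V1 \<le> card V2 \<and> card V2 \<le> card V3 \<and> card V3 = 6 \<and>
         real (card V3) = 3 / 2 * real (opt_bgp 3 {..<12} (path_edges 12))"
    using approx3_output_path_12 opt
    by (intro exI[of _ "{0..<3}"] exI[of _ "{3..<6}"] exI[of _ "{6..<12}"]) simp
qed

end
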